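(* Let $A$ be a $d\times d$ generalized Cartan matrix with all off-diagonal entries equal to $0$ or $-1$, let $F$ be a finite field, and let $G_{KM}(A,F)$ be the corresponding simply-connected Kac-Moody group over $F$. Let $U=U(A,F)$ be the subgroup of $G_{KM}(A,F)$ generated by the positive root subgroups. If $|F|>(d-1)^2$, then $U$ has property $(T)$, and $$\kappa(U,S)\ge\sqrt{\frac2d\left(1-\frac{d-1}{\sqrt{|F|}}\right)},$$ where $S$ is the union of the simple root subgroups.
   Context: Generalized Cartan matrix: an integer matrix $A=(a_{ij})$ with $a_{ii}=2$, $a_{ij}\le0$ for $i\ne j$, and $a_{ij}=0\iff a_{ji}=0$. $G_{KM}(A,F)$ is the simply-connected (Tits) Kac-Moody group: let $\Phi$ be the set of real roots of the Kac-Moody algebra of $A$, with Weyl group $W$, simple roots $\alpha_1,\dots,\alpha_d$ and positive real roots $\Phi^+$. The group is generated by symbols $x_\alpha(r)$ ($\alpha\in\Phi$, $r\in F$) subject to the standard Steinberg-type relations: $x_\alpha(r)x_\alpha(s)=x_\alpha(r+s)$; for each prenilpotent pair $\{\alpha,\beta\}$ (i.e. some elements of $W$ send both roots into $\Phi^+$ and into $-\Phi^+$, respectively) with $\alpha\neq\pm\beta$ the Chevalley commutator formula $[x_\alpha(r),x_\beta(s)]=\prod x_{i\alpha+j\beta}(C_{ij}^{\alpha\beta}r^is^j)$, the product over roots $i\alpha+j\beta\in\Phi$ with $i,j\ge1$, with the integer structure constants of the Kac-Moody algebra; and, with $w_i(t)=x_{\alpha_i}(t)x_{-\alpha_i}(-t^{-1})x_{\alpha_i}(t)$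 and $h_i(t)=w_i(t)w_i(1)^{-1}$ for $t\in F^\times$, the usual relations describing conjugation of root elements by $w_i(1)$ and $h_i(t)$, and $h_i(t)h_i(t')=h_i(tt')$. The root subgroup of $\alpha\in\Phi$ is $\{x_\alpha(r): r\in F\}$; it is positive if $\alpha\in\Phi^+$ and simple if $\alpha\in\{\alpha_1,\ldots,\alpha_d\}$. Kazhdan constant: for a discrete group $G$ and $S\subseteq G$, $\kappa(G,S)$ is the infimum, over all unitary representations $V$ of $G$ (on complex Hilbert spaces) without nonzero $G$-invariant vectors, of $\inf\{\varepsilon>0: \exists\,0\ne v\in V,\ \|sv-v\|\le\varepsilon\|v\|\ \forall s\in S\}$. $G$ has property $(T)$ if $\kappa(G,S)>0$ for some finite $S\subseteq G$. *)

theory Defs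
  imports "HOL-Analysis.Analysis" "HOL-Algebra.Generated_Groups"
begin

section \<open>Generalized Cartan matrices and real roots\<close>

definition generalized_cartan_matrix :: "int ^ 'n ^ 'n \<Rightarrow> bool" where
  "generalized_cartan_matrix A \<longleftrightarrow>
     (\<forall>i. A $ i $ i = 2) \<and>
     (\<forall>i j. i \<noteq> j \<longrightarrow> A $ i $ j \<le> 0) \<and>
     (\<forall>i j. A $ i $ j = 0 \<longleftrightarrow> A $ j $ i = 0)"

text \<open>Roots are written in coordinates with respect to the simple roots, as elements of the root
  lattice \<open>int ^ 'n\<close>. The entry \<open>A $ i $ j\<close> is the value of the simple root \<open>j\<close> on the simple
  coroot \<open>i\<close>, so the value of \<open>\<beta>\<close> on the simple coroot \<open>i\<close> is \<open>(A *v \<beta>) $ i\<close>.\<close>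

definition simple_root :: "'n \<Rightarrow> int ^ 'n" where
  "simple_root i = axis i 1"

definition coroot_value :: "int ^ 'n ^ 'n \<Rightarrow> int ^ 'n \<Rightarrow> 'n \<Rightarrow> int" where
  "coroot_value A \<beta> i = (A *v \<beta>) $ i"

definition simple_reflection :: "int ^ 'n ^ 'n \<Rightarrow> 'n \<Rightarrow> int ^ 'n \<Rightarrow> int ^ 'n" where
  "simple_reflection A i \<beta> = \<beta> - coroot_value A \<beta> i *s simple_root i"

inductive_set weyl_group :: "int ^ 'n ^ 'n \<Rightarrow> (int ^ 'n \<Rightarrow> int ^ 'n) set"
  for A :: "int ^ 'n ^ 'n" where
  one: "id \<in> weyl_group A"
| step: "w \<in> weyl_group A \<Longrightarrow> simple_reflection A i \<circ> w \<in> weyl_group A"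

definition real_roots :: "int ^ 'n ^ 'n \<Rightarrow> (int ^ 'n) set" where
  "real_roots A = {w (simple_root i) | w i. w \<in> weyl_group A}"

definition positive_real_roots :: "int ^ 'n ^ 'n \<Rightarrow> (int ^ 'n) set" where
  "positive_real_roots A = {\<alpha> \<in> real_roots A. \<forall>i. 0 \<le> \<alpha> $ i}"

definition prenilpotent :: "int ^ 'n ^ 'n \<Rightarrow> int ^ 'n \<Rightarrow> int ^ 'n \<Rightarrow> bool" where
  "prenilpotent A \<alpha> \<beta> \<longleftrightarrow>
     (\<exists>w \<in> weyl_group A. w \<alpha> \<in> positive_real_roots A \<and> w \<beta> \<in> positive_real_roots A) \<and>
     (\<exists>w \<in> weyl_group A. - w \<alpha> \<in> positive_real_roots A \<and> - w \<beta> \<in> positive_real_roots A)"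


section \<open>The Kac-Moody algebra\<close>

text \<open>The (derived) complex Kac-Moody algebra is presented by the Chevalley generators and the
  Chevalley-Serre relations: its elements are the terms below up to \<open>km_eq A\<close>. Enlarging the Cartan
  subalgebra to that of a minimal realization would not change the real root spaces. When
  \<open>A\<close> is symmetrizable, dividing out the largest ideal that meets the Cartan subalgebra
  trivially gives the same algebra, by the Gabber-Kac theorem.\<close>

datatype 'n km_term =
    Gen_e 'n
  | Gen_f 'n
  | Gen_h 'n
  | Zero
  | Add "'n km_term" "'n km_term"
  | Scale complex "'n km_term"
  | Bracket "'n km_term" "'n km_term"

inductive km_eq :: "int ^ 'n ^ 'n \<Rightarrow> 'n km_term \<Rightarrow> 'n km_term \<Rightarrow> bool"
  for A :: "int ^ 'n ^ 'n" where
  refl: "km_eq A x x"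
| sym: "km_eq A x y \<Longrightarrow> km_eq A y x"
| trans: "km_eq A x y \<Longrightarrow> km_eq A y z \<Longrightarrow> km_eq A x z"
| cong_Add: "km_eq A x x' \<Longrightarrow> km_eq A y y' \<Longrightarrow> km_eq A (Add x y) (Add x' y')"
| cong_Scale: "km_eq A x x' \<Longrightarrow> km_eq A (Scale c x) (Scale c x')"
| cong_Bracket: "km_eq A x x' \<Longrightarrow> km_eq A y y' \<Longrightarrow> km_eq A (Bracket x y) (Bracket x' y')"
| add_assoc: "km_eq A (Add (Add x y) z) (Add x (Add y z))"
| add_commute: "km_eq A (Add x y) (Add y x)"
| add_Zero: "km_eq A (Add Zero x) x"
| add_minus: "km_eq A (Add x (Scale (- 1) x)) Zero"
| scale_one: "km_eq A (Scale 1 x) x"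
| scale_scale: "km_eq A (Scale c (Scale d x)) (Scale (c * d) x)"
| scale_add_left: "km_eq A (Scale (c + d) x) (Add (Scale c x) (Scale d x))"
| scale_add_right: "km_eq A (Scale c (Add x y)) (Add (Scale c x) (Scale c y))"
| bracket_add_left: "km_eq A (Bracket (Add x y) z) (Add (Bracket x z) (Bracket y z))"
| bracket_add_right: "km_eq A (Bracket x (Add y z)) (Add (Bracket x y) (Bracket x z))"
| bracket_scale_left: "km_eq A (Bracket (Scale c x) y) (Scale c (Bracket x y))"
| bracket_scale_right: "km_eq A (Bracket x (Scale c y)) (Scale c (Bracket x y))"
| bracket_self: "km_eq A (Bracket x x) Zero"
| jacobi: "km_eq A (Add (Bracket x (Bracket y z))
                        (Add (Bracket y (Bracket z x)) (Bracket z (Bracket x y)))) Zero"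
| rel_hh: "km_eq A (Bracket (Gen_h i) (Gen_h j)) Zero"
| rel_he: "km_eq A (Bracket (Gen_h i) (Gen_e j)) (Scale (of_int (A $ i $ j)) (Gen_e j))"
| rel_hf: "km_eq A (Bracket (Gen_h i) (Gen_f j)) (Scale (- of_int (A $ i $ j)) (Gen_f j))"
| rel_ef: "km_eq A (Bracket (Gen_e i) (Gen_f j)) (if i = j then Gen_h i else Zero)"
| serre_e: "i \<noteq> j \<Longrightarrow> km_eq A ((Bracket (Gen_e i) ^^ nat (1 - A $ i $ j)) (Gen_e j)) Zero"
| serre_f: "i \<noteq> j \<Longrightarrow> km_eq A ((Bracket (Gen_f i) ^^ nat (1 - A $ i $ j)) (Gen_f j)) Zero"

text \<open>The exponential series of \<open>ad x\<close> at \<open>y\<close>, cut off where the powers of \<open>ad x\<close> begin to vanish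
  at \<open>y\<close>. It is applied only to multiples of real root vectors, which are locally ad-nilpotent.\<close>

definition exp_ad :: "int ^ 'n ^ 'n \<Rightarrow> 'n km_term \<Rightarrow> 'n km_term \<Rightarrow> 'n km_term" where
  "exp_ad A x y =
     foldr Add
       (map (\<lambda>k. Scale (1 / fact k) ((Bracket x ^^ k) y))
          [0 ..< (LEAST n. km_eq A ((Bracket x ^^ n) y) Zero)])
       Zero"

definition reflection_automorphism :: "int ^ 'n ^ 'n \<Rightarrow> 'n \<Rightarrow> 'n km_term \<Rightarrow> 'n km_term" where
  "reflection_automorphism A i =
     exp_ad A (Gen_e i) \<circ> exp_ad A (Scale (- 1) (Gen_f i)) \<circ> exp_ad A (Gen_e i)"

text \<open>A Chevalley system chooses a root vector for every real root, compatibly up to sign with the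
  automorphisms that lift the simple reflections. Such systems exist (Tits). Any two choices differ by signs
  only, and replacing \<open>e \<alpha>\<close> by \<open>- e \<alpha>\<close> amounts to renaming \<open>x\<^sub>\<alpha>(r)\<close> to \<open>x\<^sub>\<alpha>(- r)\<close> in the
  presentation of the Kac-Moody group.\<close>

definition chevalley_system :: "int ^ 'n ^ 'n \<Rightarrow> (int ^ 'n \<Rightarrow> 'n km_term) \<Rightarrow> bool" where
  "chevalley_system A e \<longleftrightarrow>
     (\<forall>i. km_eq A (e (simple_root i)) (Gen_e i)) \<and>
     (\<forall>i. km_eq A (e (- simple_root i)) (Gen_f i)) \<and>
     (\<forall>\<alpha> \<in> real_roots A. \<not> km_eq A (e \<alpha>) Zero) \<and>
     (\<forall>\<alpha> \<in> real_roots A. \<forall>i.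
        km_eq A (reflection_automorphism A i (e \<alpha>)) (e (simple_reflection A i \<alpha>)) \<or>
        km_eq A (reflection_automorphism A i (e \<alpha>))
          (Scale (- 1) (e (simple_reflection A i \<alpha>))))"

definition reflection_sign ::
  "int ^ 'n ^ 'n \<Rightarrow> (int ^ 'n \<Rightarrow> 'n km_term) \<Rightarrow> 'n \<Rightarrow> int ^ 'n \<Rightarrow> int" where
  "reflection_sign A e i \<alpha> =
     (if km_eq A (reflection_automorphism A i (e \<alpha>)) (e (simple_reflection A i \<alpha>))
      then 1 else - 1)"

definition int_comb :: "int ^ 'n \<Rightarrow> int ^ 'n \<Rightarrow> nat \<times> nat \<Rightarrow> int ^ 'n" where
  "int_comb \<alpha> \<beta> = (\<lambda>(i, j). int i *s \<alpha> + int j *s \<beta>)"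

text \<open>The factors of the Chevalley commutator formula, in an arbitrary but fixed order. For a
  prenilpotent pair there are only finitely many.\<close>

definition commutator_indices ::
  "int ^ 'n ^ 'n \<Rightarrow> int ^ 'n \<Rightarrow> int ^ 'n \<Rightarrow> (nat \<times> nat) list" where
  "commutator_indices A \<alpha> \<beta> =
     (SOME ijs. distinct ijs \<and>
        set ijs = {ij. 1 \<le> fst ij \<and> 1 \<le> snd ij \<and> int_comb \<alpha> \<beta> ij \<in> real_roots A})"

text \<open>The integers \<open>C\<^sub>i\<^sub>j\<close> for which the commutator formula, with the commutator
  \<open>x y x\<^sup>-\<^sup>1 y\<^sup>-\<^sup>1\<close>, holds for the one-parameter groups \<open>exp (r ad (e \<alpha>))\<close> of the Kac-Moody
  algebra. The formula determines their values at the indices that occur in it.\<close>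

definition structure_constants ::
  "int ^ 'n ^ 'n \<Rightarrow> (int ^ 'n \<Rightarrow> 'n km_term) \<Rightarrow> int ^ 'n \<Rightarrow> int ^ 'n \<Rightarrow> nat \<times> nat \<Rightarrow> int" where
  "structure_constants A e \<alpha> \<beta> =
     (SOME C. \<forall>r s y.
        km_eq A
          (exp_ad A (Scale r (e \<alpha>)) (exp_ad A (Scale s (e \<beta>))
             (exp_ad A (Scale (- r) (e \<alpha>)) (exp_ad A (Scale (- s) (e \<beta>)) y))))
          (foldr
             (\<lambda>ij. exp_ad A
                (Scale (of_int (C ij) * r ^ fst ij * s ^ snd ij) (e (int_comb \<alpha> \<beta> ij))))
             (commutator_indices A \<alpha> \<beta>) y))"


section \<open>Groups given by generators and relations\<close>

text \<open>A letter \<open>(True, x)\<close> stands for the generator \<open>x\<close> and \<open>(False, x)\<close> for its inverse.\<close>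

type_synonym 'x word = "(bool \<times> 'x) list"

definition inverse_word :: "'x word \<Rightarrow> 'x word" where
  "inverse_word u = rev (map (\<lambda>(b, x). (\<not> b, x)) u)"

abbreviation words_over :: "'x set \<Rightarrow> 'x word set" where
  "words_over X \<equiv> lists (UNIV \<times> X)"

inductive_set word_congruence :: "'x set \<Rightarrow> ('x word \<times> 'x word) set \<Rightarrow> ('x word \<times> 'x word) set"
  for X :: "'x set" and R :: "('x word \<times> 'x word) set" where
  refl: "u \<in> words_over X \<Longrightarrow> (u, u) \<in> word_congruence X R"
| sym: "(u, v) \<in> word_congruence X R \<Longrightarrow> (v, u) \<in> word_congruence X R"
| trans: "(u, v) \<in> word_congruence X R \<Longrightarrow> (v, w) \<in> word_congruence X R
            \<Longrightarrow> (u, w) \<in> word_congruence X R"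
| append: "(u, v) \<in> word_congruence X R \<Longrightarrow> (u', v') \<in> word_congruence X R
            \<Longrightarrow> (u @ u', v @ v') \<in> word_congruence X R"
| cancel: "x \<in> X \<Longrightarrow> ([(b, x), (\<not> b, x)], []) \<in> word_congruence X R"
| rel: "(u, v) \<in> R \<Longrightarrow> u \<in> words_over X \<Longrightarrow> v \<in> words_over X \<Longrightarrow> (u, v) \<in> word_congruence X R"

definition word_class :: "'x set \<Rightarrow> ('x word \<times> 'x word) set \<Rightarrow> 'x word \<Rightarrow> 'x word set" where
  "word_class X R u = word_congruence X R `` {u}"

definition presented_group :: "'x set \<Rightarrow> ('x word \<times> 'x word) set \<Rightarrow> 'x word set monoid" where
  "presented_group X R =
     \<lparr> carrier = words_over X // word_congruence X R,
       monoid.mult = (\<lambda>a b. \<Union>u \<in> a. \<Union>v \<in> b. word_class X R (u @ v)),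
       one = word_class X R [] \<rparr>"

lemma word_congruence_in_words:
  "(u, v) \<in> word_congruence X R \<Longrightarrow> u \<in> words_over X \<and> v \<in> words_over X"
  by (induction rule: word_congruence.induct) auto

lemma equiv_word_congruence: "equiv (words_over X) (word_congruence X R)"
proof (rule equivI)
  show "word_congruence X R \<subseteq> words_over X \<times> words_over X"
    using word_congruence_in_words by fast
  show "refl_on (words_over X) (word_congruence X R)"
    by (rule refl_onI) (rule word_congruence.refl)
  show "sym (word_congruence X R)"
    by (rule symI) (rule word_congruence.sym)
  show "trans (word_congruence X R)"
    by (rule transI) (rule word_congruence.trans)
qed

lemma presented_group_carrier:
  "carrier (presented_group X R) = word_class X R ` words_over X"
  by (auto simp: presented_group_def quotient_def word_class_def)

lemma presented_group_mult:
  assumes "u \<in> words_over X" "v \<in> words_over X"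
  shows "word_class X R u \<otimes>\<^bsub>presented_group X R\<^esub> word_class X R v = word_class X R (u @ v)"
proof -
  have "(u' @ v', u @ v) \<in> word_congruence X R"
    if "u' \<in> word_class X R u" "v' \<in> word_class X R v" for u' v'
    using that unfolding word_class_def
    by (auto intro!: word_congruence.append word_congruence.sym[of u] word_congruence.sym[of v])
  then have "word_class X R (u' @ v') = word_class X R (u @ v)"
    if "u' \<in> word_class X R u" "v' \<in> word_class X R v" for u' v'
    using that equiv_class_eq[OF equiv_word_congruence] unfolding word_class_def by blast
  moreover have "u \<in> word_class X R u" "v \<in> word_class X R v"
    using assms by (auto simp: word_class_def intro: word_congruence.refl)
  ultimately have "(\<Union>u' \<in> word_class X R u. \<Union>v' \<in> word_class X R v. word_class X R (u' @ v')) =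
      word_class X R (u @ v)"
    by blast
  then show ?thesis by (simp add: presented_group_def)
qed

lemma inverse_word_in_words: "u \<in> words_over X \<Longrightarrow> inverse_word u \<in> words_over X"
  by (auto simp: inverse_word_def in_lists_conv_set)

lemma inverse_word_left:
  "u \<in> words_over X \<Longrightarrow> (inverse_word u @ u, []) \<in> word_congruence X R"
proof (induction u)
  case Nil
  then show ?case by (simp add: inverse_word_def word_congruence.refl)
next
  case (Cons l u)
  obtain b x where l: "l = (b, x)" by force
  from Cons.prems l have x: "x \<in> X" and u: "u \<in> words_over X" by auto
  have "([(\<not> b, x), (b, x)] @ u, [] @ u) \<in> word_congruence X R"
    using word_congruence.cancel[OF x, of "\<not> b" R] u
    by (intro word_congruence.append word_congruence.refl) auto
  then have "(inverse_word u @ [(\<not> b, x), (b, x)] @ u, inverse_word u @ [] @ u)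
      \<in> word_congruence X R"
    by (rule word_congruence.append[OF word_congruence.refl[OF inverse_word_in_words[OF u]]])
  then have "(inverse_word (l # u) @ l # u, inverse_word u @ u) \<in> word_congruence X R"
    by (simp add: inverse_word_def l)
  then show ?case using Cons.IH[OF u] by (rule word_congruence.trans)
qed

lemma group_presented_group: "group (presented_group X R)"
proof (rule groupI)
  have one: "\<one>\<^bsub>presented_group X R\<^esub> = word_class X R []"
    by (simp add: presented_group_def)
  show "\<one>\<^bsub>presented_group X R\<^esub> \<in> carrier (presented_group X R)"
    by (auto simp: one presented_group_carrier)
  fix a assume "a \<in> carrier (presented_group X R)"
  then obtain u where u: "u \<in> words_over X" "a = word_class X R u"
    by (auto simp: presented_group_carrier)
  show "\<one>\<^bsub>presented_group X R\<^esub> \<otimes>\<^bsub>presented_group X R\<^esub> a = a"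
    using u by (simp add: one presented_group_mult)
  have "word_class X R (inverse_word u @ u) = word_class X R []"
    using equiv_class_eq[OF equiv_word_congruence inverse_word_left[OF u(1)]]
    by (simp add: word_class_def)
  then show "\<exists>b \<in> carrier (presented_group X R). b \<otimes>\<^bsub>presented_group X R\<^esub> a = \<one>\<^bsub>presented_group X R\<^esub>"
    using u inverse_word_in_words[OF u(1)]
    by (intro bexI[of _ "word_class X R (inverse_word u)"])
       (auto simp: one presented_group_mult presented_group_carrier)
next
  fix a b assume "a \<in> carrier (presented_group X R)" "b \<in> carrier (presented_group X R)"
  then obtain u v where uv: "u \<in> words_over X" "a = word_class X R u"
    "v \<in> words_over X" "b = word_class X R v"
    by (auto simp: presented_group_carrier)
  then have "a \<otimes>\<^bsub>presented_group X R\<^esub> b = word_class X R (u @ v)"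
    by (simp only: presented_group_mult)
  then show "a \<otimes>\<^bsub>presented_group X R\<^esub> b \<in> carrier (presented_group X R)"
    using uv(1,3) unfolding presented_group_carrier by (metis append_in_lists_conv image_eqI)
next
  fix a b c assume "a \<in> carrier (presented_group X R)" "b \<in> carrier (presented_group X R)"
    "c \<in> carrier (presented_group X R)"
  then obtain u v w where uvw: "u \<in> words_over X" "a = word_class X R u"
    "v \<in> words_over X" "b = word_class X R v" "w \<in> words_over X" "c = word_class X R w"
    unfolding presented_group_carrier by blast
  moreover from uvw have "u @ v \<in> words_over X" "v @ w \<in> words_over X"
    by (simp_all only: append_in_lists_conv conj_absorb)
  ultimately show "a \<otimes>\<^bsub>presented_group X R\<^esub> b \<otimes>\<^bsub>presented_group X R\<^esub> c =
      a \<otimes>\<^bsub>presented_group X R\<^esub> (b \<otimes>\<^bsub>presented_group X R\<^esub> c)"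
    by (simp only: presented_group_mult append_assoc)
qed


section \<open>The simply-connected Kac-Moody group\<close>

text \<open>The symbol \<open>x\<^sub>\<alpha>(r)\<close> is the pair \<open>(\<alpha>, r)\<close>.\<close>

type_synonym ('n, 'f) km_word = "((int ^ 'n) \<times> 'f) word"

definition x_word :: "int ^ 'n \<Rightarrow> 'f \<Rightarrow> ('n::finite, 'f) km_word" where
  "x_word \<alpha> r = [(True, (\<alpha>, r))]"

definition w_word :: "'n \<Rightarrow> 'f::field \<Rightarrow> ('n::finite, 'f) km_word" where
  "w_word i t =
     x_word (simple_root i) t @ x_word (- simple_root i) (- inverse t) @ x_word (simple_root i) t"

definition h_word :: "'n \<Rightarrow> 'f::field \<Rightarrow> ('n::finite, 'f) km_word" where
  "h_word i t = w_word i t @ inverse_word (w_word i 1)"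

text \<open>The relations \<open>w\<^sub>i(1) h\<^sub>j(t) w\<^sub>i(1)\<^sup>-\<^sup>1 = h\<^sub>j(t) h\<^sub>i(t ^ (- A $ j $ i))\<close>, which some authors
  list as well, follow from \<open>h_conj\<close> applied to the letters of \<open>w\<^sub>i(1)\<close>.\<close>

inductive_set km_relations ::
  "int ^ 'n ^ 'n \<Rightarrow> (int ^ 'n \<Rightarrow> 'n km_term) \<Rightarrow> (('n::finite, 'f::field) km_word \<times> ('n, 'f) km_word) set"
  for A :: "int ^ 'n ^ 'n" and e :: "int ^ 'n \<Rightarrow> 'n km_term" where
  add: "\<alpha> \<in> real_roots A \<Longrightarrow>
    (x_word \<alpha> r @ x_word \<alpha> s, x_word \<alpha> (r + s)) \<in> km_relations A e"
| commutator: "\<alpha> \<in> real_roots A \<Longrightarrow> \<beta> \<in> real_roots A \<Longrightarrow> prenilpotent A \<alpha> \<beta> \<Longrightarrow>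
    \<alpha> \<noteq> \<beta> \<Longrightarrow> \<alpha> \<noteq> - \<beta> \<Longrightarrow>
    (x_word \<alpha> r @ x_word \<beta> s @ inverse_word (x_word \<alpha> r) @ inverse_word (x_word \<beta> s),
     concat (map
       (\<lambda>ij. x_word (int_comb \<alpha> \<beta> ij)
          (of_int (structure_constants A e \<alpha> \<beta> ij) * r ^ fst ij * s ^ snd ij))
       (commutator_indices A \<alpha> \<beta>))) \<in> km_relations A e"
| w_conj: "\<alpha> \<in> real_roots A \<Longrightarrow>
    (w_word i 1 @ x_word \<alpha> r @ inverse_word (w_word i 1),
     x_word (simple_reflection A i \<alpha>) (of_int (reflection_sign A e i \<alpha>) * r))
      \<in> km_relations A e"
| h_conj: "\<alpha> \<in> real_roots A \<Longrightarrow> t \<noteq> 0 \<Longrightarrow>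
    (h_word i t @ x_word \<alpha> r @ inverse_word (h_word i t),
     x_word \<alpha> (t powi coroot_value A \<alpha> i * r)) \<in> km_relations A e"
| h_mult: "t \<noteq> 0 \<Longrightarrow> t' \<noteq> 0 \<Longrightarrow>
    (h_word i t @ h_word i t', h_word i (t * t')) \<in> km_relations A e"

definition km_group ::
  "'f itself \<Rightarrow> int ^ 'n ^ 'n \<Rightarrow> (int ^ 'n \<Rightarrow> 'n km_term) \<Rightarrow> ('n::finite, 'f::field) km_word set monoid" where
  "km_group _ A e = presented_group (real_roots A \<times> UNIV) (km_relations A e)"

definition root_subgroup ::
  "'f itself \<Rightarrow> int ^ 'n ^ 'n \<Rightarrow> (int ^ 'n \<Rightarrow> 'n km_term) \<Rightarrow> int ^ 'n
     \<Rightarrow> ('n::finite, 'f::field) km_word set set" where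
  "root_subgroup _ A e \<alpha> =
     {word_class (real_roots A \<times> UNIV) (km_relations A e) (x_word \<alpha> r) | r. True}"

definition km_U ::
  "'f itself \<Rightarrow> int ^ 'n ^ 'n \<Rightarrow> (int ^ 'n \<Rightarrow> 'n km_term) \<Rightarrow> ('n::finite, 'f::field) km_word set monoid" where
  "km_U F A e = (km_group F A e)
     \<lparr> carrier := generate (km_group F A e) (\<Union>\<alpha> \<in> positive_real_roots A. root_subgroup F A e \<alpha>) \<rparr>"

definition simple_root_elements ::
  "'f itself \<Rightarrow> int ^ 'n ^ 'n \<Rightarrow> (int ^ 'n \<Rightarrow> 'n km_term) \<Rightarrow> ('n::finite, 'f::field) km_word set set" where
  "simple_root_elements F A e = (\<Union>i. root_subgroup F A e (simple_root i))"


section \<open>Unitary representations and Kazhdan constants\<close>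

class complex_hilbert_space = real_inner + complete_space +
  fixes scaleC :: "complex \<Rightarrow> 'a \<Rightarrow> 'a"
    and cinner :: "'a \<Rightarrow> 'a \<Rightarrow> complex"
  assumes scaleC_add_right: "scaleC c (x + y) = scaleC c x + scaleC c y"
    and scaleC_add_left: "scaleC (c + d) x = scaleC c x + scaleC d x"
    and scaleC_scaleC: "scaleC c (scaleC d x) = scaleC (c * d) x"
    and scaleR_scaleC: "scaleR r x = scaleC (complex_of_real r) x"
    and cinner_add_left: "cinner (x + y) z = cinner x z + cinner y z"
    and cinner_scaleC_left: "cinner (scaleC c x) y = c * cinner x y"
    and cinner_commute: "cinner x y = cnj (cinner y x)"
    and inner_cinner: "inner x y = Re (cinner x y)"

instantiation complex :: complex_hilbert_space
begin

definition scaleC_complex :: "complex \<Rightarrow> complex \<Rightarrow> complex" where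
  "scaleC_complex c x = c * x"

definition cinner_complex :: "complex \<Rightarrow> complex \<Rightarrow> complex" where
  "cinner_complex x y = x * cnj y"

instance
  by standard
     (auto simp: scaleC_complex_def cinner_complex_def algebra_simps inner_complex_def
        scaleR_conv_of_real)

end

definition closed_csubspace :: "'v::complex_hilbert_space set \<Rightarrow> bool" where
  "closed_csubspace V \<longleftrightarrow>
     0 \<in> V \<and> (\<forall>x \<in> V. \<forall>y \<in> V. x + y \<in> V) \<and> (\<forall>c. \<forall>x \<in> V. scaleC c x \<in> V) \<and> closed V"

definition unitary_on :: "'v::complex_hilbert_space set \<Rightarrow> ('v \<Rightarrow> 'v) \<Rightarrow> bool" where
  "unitary_on V T \<longleftrightarrow>
     T ` V = V \<and>
     (\<forall>x \<in> V. \<forall>y \<in> V. T (x + y) = T x + T y) \<and>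
     (\<forall>c. \<forall>x \<in> V. T (scaleC c x) = scaleC c (T x)) \<and>
     (\<forall>x \<in> V. \<forall>y \<in> V. cinner (T x) (T y) = cinner x y)"

text \<open>Representation spaces are closed subspaces of an ambient Hilbert space \<open>'v\<close>. Every Hilbert
  space occurs (as \<open>UNIV\<close>) for a suitable type \<open>'v\<close>; conversely a single \<open>'v\<close> is enough to compute the
  Kazhdan constant of a countable group as soon as it is infinite-dimensional, because it then
  contains all separable Hilbert spaces up to isomorphism, hence all cyclic representations.\<close>

definition unitary_representation ::
  "('g, 'm) monoid_scheme \<Rightarrow> 'v::complex_hilbert_space set \<Rightarrow> ('g \<Rightarrow> 'v \<Rightarrow> 'v) \<Rightarrow> bool" where
  "unitary_representation G V \<pi> \<longleftrightarrow>
     closed_csubspace V \<and>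
     (\<forall>g \<in> carrier G. unitary_on V (\<pi> g)) \<and>
     (\<forall>g \<in> carrier G. \<forall>h \<in> carrier G. \<forall>x \<in> V. \<pi> (g \<otimes>\<^bsub>G\<^esub> h) x = \<pi> g (\<pi> h x))"

definition no_invariant_vectors ::
  "('g, 'm) monoid_scheme \<Rightarrow> 'v::complex_hilbert_space set \<Rightarrow> ('g \<Rightarrow> 'v \<Rightarrow> 'v) \<Rightarrow> bool" where
  "no_invariant_vectors G V \<pi> \<longleftrightarrow> (\<forall>v \<in> V. (\<forall>g \<in> carrier G. \<pi> g v = v) \<longrightarrow> v = 0)"

text \<open>The infimum is taken in \<open>ereal\<close> because the zero representation contributes the infimum of
  the empty set, \<open>\<infinity>\<close>.\<close>

definition kazhdan_constant_of_rep ::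
  "'g set \<Rightarrow> 'v::complex_hilbert_space set \<Rightarrow> ('g \<Rightarrow> 'v \<Rightarrow> 'v) \<Rightarrow> ereal" where
  "kazhdan_constant_of_rep S V \<pi> =
     Inf (ereal ` {\<epsilon>. 0 < \<epsilon> \<and> (\<exists>v \<in> V. v \<noteq> 0 \<and> (\<forall>s \<in> S. norm (\<pi> s v - v) \<le> \<epsilon> * norm v))})"

definition kazhdan_constant ::
  "'v::complex_hilbert_space itself \<Rightarrow> ('g, 'm) monoid_scheme \<Rightarrow> 'g set \<Rightarrow> ereal" where
  "kazhdan_constant _ G S =
     Inf {kazhdan_constant_of_rep S V \<pi> | (V :: 'v set) \<pi>.
            unitary_representation G V \<pi> \<and> no_invariant_vectors G V \<pi>}"

definition property_T ::
  "'v::complex_hilbert_space itself \<Rightarrow> ('g, 'm) monoid_scheme \<Rightarrow> bool" where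
  "property_T v G \<longleftrightarrow> (\<exists>S. finite S \<and> S \<subseteq> carrier G \<and> 0 < kazhdan_constant v G S)"

end

theory Submission
  imports Defs
begin

text \<open>
  Let \<open>X\<^sub>i\<close> be the simple root subgroups and \<open>q = |F|\<close>. In a unitary representation of \<open>U\<close> let \<open>P\<^sub>i\<close> be the
  projection onto the vectors fixed by \<open>X\<^sub>i\<close>, put \<open>Q\<^sub>i = 1 - P\<^sub>i\<close> and \<open>T = Q\<^sub>1 + \<dots> + Q\<^sub>d\<close>. The proof is a
  spectral gap argument for \<open>T\<close>.

  Two simple root subgroups commute if \<open>a\<^sub>i\<^sub>j = 0\<close>, and they generate a quotient of the Heisenberg group over
  \<open>F\<close> if \<open>a\<^sub>i\<^sub>j = - 1\<close>. In the first case \<open>Q\<^sub>i Q\<^sub>j \<ge> 0\<close>. In the second case the fixed spaces of \<open>X\<^sub>i\<close>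
  and \<open>X\<^sub>j\<close> meet at an angle of cosine at most \<open>1 / \<surd>q\<close> away from the vectors fixed by the centre
  (\<open>heisenberg_pair_bound\<close>), which yields \<open>Q\<^sub>i Q\<^sub>j + Q\<^sub>j Q\<^sub>i \<ge> - (Q\<^sub>i + Q\<^sub>j) / \<surd>q\<close>. Summing over
  all pairs, \<open>T\<^sup>2 \<ge> \<mu> T\<close> with \<open>\<mu> = 1 - (d - 1) / \<surd>q\<close>. A vector in the kernel of \<open>T\<close> is fixed by all \<open>X\<^sub>i\<close>.
  If there is no such vector except \<open>0\<close> and \<open>\<mu> > 0\<close>, then \<open>T \<ge> \<mu>\<close>
  (\<open>sum_complements_spectral_gap\<close>). So every \<open>v\<close> satisfies \<open>\<parallel>Q\<^sub>i v\<parallel>\<^sup>2 \<ge> (\<mu> / d) \<parallel>v\<parallel>\<^sup>2\<close> for some \<open>i\<close>, and as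
  \<open>2 \<parallel>Q\<^sub>i v\<parallel>\<^sup>2\<close> is the mean of \<open>\<parallel>x v - v\<parallel>\<^sup>2\<close> over \<open>x \<in> X\<^sub>i\<close>, some element of \<open>X\<^sub>i\<close> moves \<open>v\<close> by at least
  \<open>\<surd>(2 \<mu> / d) \<parallel>v\<parallel>\<close>.

  The invariant vectors of \<open>U\<close> are those fixed by all \<open>X\<^sub>i\<close>, because \<open>U\<close> is already
  generated by the simple root subgroups. Every positive real root arises from the simple
  roots by repeatedly forming \<open>w \<alpha>\<^sub>i + w \<alpha>\<^sub>j\<close> with positive \<open>w \<alpha>\<^sub>i\<close>, \<open>w \<alpha>\<^sub>j\<close> and \<open>a\<^sub>i\<^sub>j = - 1\<close>
  (\<open>positive_real_root_induct\<close>, an induction on the length of Weyl group elements), and the commutator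
  formula for \<open>\<alpha>\<^sub>i, \<alpha>\<^sub>j\<close>, conjugated by a lift of \<open>w\<close>, produces the root subgroup of the sum.

  Both parts use that the commutator formula of two adjacent simple roots \<open>\<alpha>\<^sub>i\<close> and \<open>\<alpha>\<^sub>j\<close> has a single factor,
  with a structure constant that is nonzero in \<open>F\<close>. The first claim follows from the invariant quadratic form. The second
  (\<open>structure_constant_simple_pair\<close>) is a computation in the Kac-Moody algebra, where \<open>ad e\<^sub>i\<close> and
  \<open>ad e\<^sub>j\<close> satisfy the Heisenberg relations and the constant turns out to be \<open>\<plusminus>1\<close>.
\<close>

section \<open>Spectral gaps of sums of projections\<close>

definition orthogonal_projection_on :: "'v::real_inner set \<Rightarrow> ('v \<Rightarrow> 'v) \<Rightarrow> bool" where
  "orthogonal_projection_on V P \<longleftrightarrow>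
     (\<forall>x\<in>V. P x \<in> V) \<and>
     (\<forall>x\<in>V. \<forall>y\<in>V. P (x + y) = P x + P y) \<and>
     (\<forall>c. \<forall>x\<in>V. P (c *\<^sub>R x) = c *\<^sub>R P x) \<and>
     (\<forall>x\<in>V. P (P x) = P x) \<and>
     (\<forall>x\<in>V. \<forall>y\<in>V. inner (P x) y = inner x (P y))"

lemma orthogonal_projection_onD:
  assumes "orthogonal_projection_on V P" "x \<in> V"
  shows "P x \<in> V" "y \<in> V \<Longrightarrow> P (x + y) = P x + P y" "P (c *\<^sub>R x) = c *\<^sub>R P x"
    "P (P x) = P x" "y \<in> V \<Longrightarrow> inner (P x) y = inner x (P y)"
  using assms unfolding orthogonal_projection_on_def by blast+

lemma orthogonal_projection_on_diff:
  assumes V: "subspace V" and P: "orthogonal_projection_on V P" and "x \<in> V" "y \<in> V"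
  shows "P (x - y) = P x - P y"
proof -
  have "P (x + (-1) *\<^sub>R y) = P x + (-1) *\<^sub>R P y"
    using assms by (simp only: orthogonal_projection_onD subspace_mul)
  then show ?thesis by simp
qed

lemma orthogonal_projection_on_complement:
  assumes V: "subspace V" and P: "orthogonal_projection_on V P"
  shows "orthogonal_projection_on V (\<lambda>x. x - P x)"
  unfolding orthogonal_projection_on_def
  using orthogonal_projection_onD[OF P] subspace_diff[OF V]
  by (auto simp: orthogonal_projection_on_diff[OF V P] scaleR_diff_right inner_diff_left inner_diff_right)

lemma inner_orthogonal_projection:
  assumes "orthogonal_projection_on V P" "x \<in> V"
  shows "inner (P x) x = (norm (P x))\<^sup>2"
  using orthogonal_projection_onD(1,4)[OF assms] orthogonal_projection_onD(5)[OF assms(1)] assms(2)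
  by (metis power2_norm_eq_inner)

text \<open>The complements of two commuting projections commute as well, and the product of two commuting
  projections is again a projection, hence a positive operator.\<close>

lemma commuting_projections_inner_nonneg:
  assumes V: "subspace V" and P: "orthogonal_projection_on V P" and R: "orthogonal_projection_on V R"
    and v: "v \<in> V" and comm: "P (R v) = R (P v)"
  shows "0 \<le> inner (v - P v) (v - R v)"
proof -
  note Pd = orthogonal_projection_onD[OF P] and Rd = orthogonal_projection_onD[OF R]
  have "inner v (R (P v)) = inner (R v) (P v)" "inner (P v) (R v) = inner v (P (R v))"
    "inner (P v) (P (R v)) = inner v (P (R v))" "inner (R v) (P (R v)) = inner (R v) (P v)"
    "inner v (R v) = inner (R v) (R v)" "inner v (P v) = inner (P v) (P v)"
    "inner (R (P v)) (R (P v)) = inner (R (P v)) (P v)"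
    using Pd Rd v by (metis comm)+
  then have "inner (v - P v) (v - R v) = inner (v - P v - R v + P (R v)) (v - P v - R v + P (R v))"
    using comm by (simp add: algebra_simps inner_diff_left inner_diff_right inner_add_left inner_add_right inner_commute)
  then show ?thesis by simp
qed

text \<open>Spectrally, \<open>T\<^sup>2 \<ge> \<mu> T\<close> with \<open>T \<ge> 0\<close> confines the spectrum of \<open>T\<close> to \<open>0\<close> and
  \<open>[\<mu>, \<infinity>)\<close>, and the trivial kernel excludes \<open>0\<close> (an isolated point of the spectrum would be an
  eigenvalue). The gradient flow of \<open>E(x) = \<langle>T x, x\<rangle>\<close> replaces the spectral theorem. Its Euler steps
  \<open>u\<^sub>n\<^sub>+\<^sub>1 = u\<^sub>n - c T u\<^sub>n\<close> decrease \<open>E\<close> geometrically, so they converge, and the limit lies in the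
  kernel. Along the flow the decrease of \<open>\<parallel>u\<^sub>n\<parallel>\<^sup>2\<close> is at most \<open>2 c E(u\<^sub>n)\<close>, whereas \<open>E(u\<^sub>n)\<close> decreases by at
  least \<open>(2 - t) \<mu> c E(u\<^sub>n)\<close>, where \<open>t = c d\<close>; comparing the total decreases and letting
  \<open>t\<close> tend to \<open>0\<close> gives the bound.\<close>

lemma spectral_gap_from_square:
  fixes T :: "'v::{real_inner,banach} \<Rightarrow> 'v"
  assumes V: "subspace V" "closed V"
    and TV: "\<And>x. x \<in> V \<Longrightarrow> T x \<in> V"
    and add: "\<And>x y. x \<in> V \<Longrightarrow> y \<in> V \<Longrightarrow> T (x + y) = T x + T y"
    and scale: "\<And>c x. x \<in> V \<Longrightarrow> T (c *\<^sub>R x) = c *\<^sub>R T x"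
    and adj: "\<And>x y. x \<in> V \<Longrightarrow> y \<in> V \<Longrightarrow> inner (T x) y = inner x (T y)"
    and upper: "\<And>x. x \<in> V \<Longrightarrow> (norm (T x))\<^sup>2 \<le> d * inner (T x) x"
    and lower: "\<And>x. x \<in> V \<Longrightarrow> \<mu> * inner (T x) x \<le> (norm (T x))\<^sup>2"
    and ker: "\<And>x. x \<in> V \<Longrightarrow> T x = 0 \<Longrightarrow> x = 0"
    and \<mu>: "0 < \<mu>" "\<mu> \<le> d"
    and v: "v \<in> V"
  shows "\<mu> * (norm v)\<^sup>2 \<le> inner (T v) v"
proof -
  have d: "0 < d" using \<mu> by simp
  have Enn: "0 \<le> inner (T x) x" if "x \<in> V" for x
    using order_trans[OF zero_le_power2 upper[OF that]] d by (simp add: zero_le_mult_iff)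
  have bound: "norm (T x) \<le> d * norm x" if "x \<in> V" for x
  proof (cases "T x = 0")
    case False
    have "norm (T x) * norm (T x) \<le> d * (norm (T x) * norm x)"
      using order_trans[OF upper[OF that] mult_left_mono[OF norm_cauchy_schwarz]] d
      by (simp add: power2_eq_square)
    then show ?thesis using False by simp
  qed (use d in simp)
  have diff: "T (x - y) = T x - T y" if "x \<in> V" "y \<in> V" for x y
    using add[OF that(1) subspace_mul[OF V(1) that(2), of "-1"]] scale[OF that(2), of "-1"] by simp
  have main: "(2 - t) * \<mu> * (norm v)\<^sup>2 \<le> 2 * inner (T v) v" if t: "0 < t" "t \<le> 1" for t
  proof -
    define c where "c = t / d"
    have c: "0 < c" "c * d = t" using t d by (auto simp: c_def)
    define f where "f x = x - c *\<^sub>R T x" for x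
    define u where "u n = (f ^^ n) v" for n
    define E where "E n = inner (T (u n)) (u n)" for n
    define N where "N n = (norm (u n))\<^sup>2" for n
    have u0: "u 0 = v" and uS: "u (Suc n) = u n - c *\<^sub>R T (u n)" for n
      by (simp_all add: u_def f_def)
    have uV: "u n \<in> V" for n
      by (induction n) (auto simp: u0 uS v TV intro!: subspace_diff[OF V(1)] subspace_mul[OF V(1)])
    define \<rho> where "\<rho> = 1 - c * (2 - t) * \<mu>"
    have c2: "0 < c * (2 - t)" using c t by simp
    have Estep: "E (Suc n) \<le> E n - c * (2 - t) * (norm (T (u n)))\<^sup>2" for n
    proof -
      let ?w = "T (u n)"
      have w: "?w \<in> V" using TV uV by blast
      have "inner (T ?w) ?w \<le> d * (norm ?w)\<^sup>2"
        using order_trans[OF norm_cauchy_schwarz mult_right_mono[OF bound[OF w] norm_ge_zero[of ?w]]]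
        by (simp add: power2_eq_square)
      then have "c\<^sup>2 * inner (T ?w) ?w \<le> c\<^sup>2 * (d * (norm ?w)\<^sup>2)"
        by (intro mult_left_mono) auto
      also have "\<dots> = c * t * (norm ?w)\<^sup>2" using c by (simp add: power2_eq_square)
      finally have *: "c\<^sup>2 * inner (T ?w) ?w \<le> c * t * (norm ?w)\<^sup>2" .
      have "E (Suc n) = E n - 2 * c * inner ?w ?w + c\<^sup>2 * inner (T ?w) ?w"
        using adj[OF w uV, of n] w uV
        by (simp add: E_def uS diff scale subspace_mul[OF V(1)] inner_diff_left inner_diff_right
            algebra_simps power2_eq_square inner_commute)
      then show ?thesis using * by (simp add: algebra_simps power2_norm_eq_inner)
    qed
    have Edec: "c * (2 - t) * (\<mu> * E n) \<le> E n - E (Suc n)" for n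
    proof -
      have "c * (2 - t) * (\<mu> * E n) \<le> c * (2 - t) * (norm (T (u n)))\<^sup>2"
        using lower[OF uV, of n] c2 by (intro mult_left_mono) (auto simp: E_def)
      then show ?thesis using Estep[of n] by simp
    qed
    have "c * (2 - t) * \<mu> \<le> c * (2 - t) * d" using c2 \<mu> by (intro mult_left_mono) auto
    also have "\<dots> = (c * d) * (2 - t)" by simp
    also have "\<dots> = 1 - (1 - t)\<^sup>2" unfolding c(2) by (simp add: algebra_simps power2_eq_square)
    also have "\<dots> \<le> 1" by simp
    finally have \<rho>: "0 \<le> \<rho>" "\<rho> < 1" using c2 \<mu> by (auto simp: \<rho>_def)
    have Egeo: "E n \<le> \<rho> ^ n * E 0" for n
    proof (induction n)
      case (Suc n)
      have "E (Suc n) \<le> \<rho> * E n" using Edec[of n] by (simp add: \<rho>_def algebra_simps)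
      also have "\<dots> \<le> \<rho> * (\<rho> ^ n * E 0)" using Suc \<rho> by (intro mult_left_mono) auto
      finally show ?case by simp
    qed simp
    have E0: "0 \<le> E n" for n unfolding E_def by (rule Enn[OF uV])
    have Elim: "E \<longlonglongrightarrow> 0"
    proof (rule tendsto_sandwich[OF _ _ tendsto_const])
      show "(\<lambda>n. \<rho> ^ n * E 0) \<longlonglongrightarrow> 0"
        using \<rho> by (auto intro!: tendsto_mult_left_zero LIMSEQ_power_zero)
    qed (use E0 Egeo in auto)
    have Tu: "norm (T (u n)) \<le> sqrt (d * E 0) * sqrt \<rho> ^ n" for n
    proof -
      have "(norm (T (u n)))\<^sup>2 \<le> d * (\<rho> ^ n * E 0)"
        using order_trans[OF upper[OF uV, of n, folded E_def] mult_left_mono[OF Egeo[of n]]] d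
        by simp
      then have "norm (T (u n)) \<le> sqrt (d * (\<rho> ^ n * E 0))" by (rule real_le_rsqrt)
      then show ?thesis by (simp add: real_sqrt_mult real_sqrt_power algebra_simps)
    qed
    have sr: "sqrt \<rho> < 1" "0 \<le> sqrt \<rho>" using \<rho> by auto
    have sm: "summable (\<lambda>n. T (u n))"
      by (rule summable_comparison_test'[where g = "\<lambda>n. sqrt (d * E 0) * sqrt \<rho> ^ n" and N = 0])
         (use Tu sr in \<open>auto intro!: summable_mult summable_geometric\<close>)
    have usum: "u n = v - c *\<^sub>R (\<Sum>k<n. T (u k))" for n
      by (induction n) (auto simp: u0 uS algebra_simps)
    define l where "l = v - c *\<^sub>R (\<Sum>k. T (u k))"
    have "(\<lambda>n. v - c *\<^sub>R (\<Sum>k<n. T (u k))) \<longlonglongrightarrow> l"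
      unfolding l_def using summable_LIMSEQ[OF sm] by (intro tendsto_intros)
    then have ul: "u \<longlonglongrightarrow> l" by (simp flip: usum)
    have lV: "l \<in> V" using closed_sequentially[OF V(2) _ ul] uV by blast
    have "(\<lambda>n. d * norm (l - u n) + norm (T (u n))) \<longlonglongrightarrow> d * norm (l - l) + norm (0::'v)"
      using ul summable_LIMSEQ_zero[OF sm] by (intro tendsto_intros)
    moreover have "norm (T l) \<le> d * norm (l - u n) + norm (T (u n))" for n
      using bound[OF subspace_diff[OF V(1) lV uV], of n] norm_triangle_sub[of "T l" "T (u n)"]
      by (simp add: diff[OF lV uV, of n])
    ultimately have "norm (T l) \<le> 0"
      using LIMSEQ_le_const[of "\<lambda>n. d * norm (l - u n) + norm (T (u n))" 0 "norm (T l)"] by auto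
    then have "l = 0" using ker[OF lV] by simp
    then have Nlim: "N \<longlonglongrightarrow> 0" using tendsto_power[OF tendsto_norm[OF ul], of 2] by (simp add: N_def[abs_def])
    \<comment> \<open>Both terms tend to \<open>0\<close>, so it is enough that their difference decreases.\<close>
    define D where "D n = 2 * E n - (2 - t) * \<mu> * N n" for n
    have "D (Suc n) \<le> D n" for n
    proof -
      have "N (Suc n) = N n - 2 * c * E n + c\<^sup>2 * inner (T (u n)) (T (u n))"
        unfolding N_def E_def uS power2_norm_eq_inner
        by (simp add: inner_diff_left inner_diff_right inner_commute power2_eq_square)
      then have "N n - N (Suc n) \<le> 2 * c * E n" by simp
      then have "(2 - t) * \<mu> * (N n - N (Suc n)) \<le> (2 - t) * \<mu> * (2 * c * E n)"
        using t \<mu> by (intro mult_left_mono) auto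
      also have "\<dots> \<le> 2 * (E n - E (Suc n))" using Edec[of n] by (simp add: algebra_simps)
      finally show ?thesis by (simp add: D_def algebra_simps)
    qed
    then have "decseq D" by (rule decseq_SucI)
    moreover have "D \<longlonglongrightarrow> 2 * 0 - (2 - t) * \<mu> * 0"
      unfolding D_def[abs_def] by (intro tendsto_intros Elim Nlim)
    ultimately have "0 \<le> D 0" using decseq_ge[of D 0 0] by simp
    then show ?thesis by (simp add: D_def E_def N_def u0)
  qed
  have "((\<lambda>t. (2 - t) * \<mu> * (norm v)\<^sup>2) \<longlongrightarrow> (2 - 0) * \<mu> * (norm v)\<^sup>2) (at_right 0)"
    by (intro tendsto_intros)
  moreover have "\<forall>\<^sub>F t in at_right 0. (2 - t) * \<mu> * (norm v)\<^sup>2 \<le> 2 * inner (T v) v"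
    using main by (auto simp: eventually_at_right_field intro!: exI[of _ 1])
  ultimately have "(2 - 0) * \<mu> * (norm v)\<^sup>2 \<le> 2 * inner (T v) v"
    by (rule tendsto_upperbound) simp
  then show ?thesis by simp
qed

text \<open>For \<open>T = \<Sum> Q\<^sub>i\<close> one has \<open>T\<^sup>2 = \<Sum> Q\<^sub>i + \<Sum>\<^sub>i\<^sub>\<noteq>\<^sub>j Q\<^sub>i Q\<^sub>j\<close>. Each \<open>Q\<^sub>i\<close> occurs in \<open>|I| - 1\<close> pairs, so the
  pair bounds sum up to \<open>T\<^sup>2 \<ge> (1 - (|I| - 1) \<epsilon>) T\<close>.\<close>

lemma sum_complements_spectral_gap:
  fixes V :: "'v::{real_inner,banach} set"
  assumes V: "subspace V" "closed V" and I: "finite I" "I \<noteq> {}"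
    and Q: "\<And>i. i \<in> I \<Longrightarrow> orthogonal_projection_on V (Q i)"
    and pair: "\<And>i j v. i \<in> I \<Longrightarrow> j \<in> I \<Longrightarrow> i \<noteq> j \<Longrightarrow> v \<in> V \<Longrightarrow>
       - \<epsilon> * ((norm (Q i v))\<^sup>2 + (norm (Q j v))\<^sup>2) \<le> 2 * inner (Q i v) (Q j v)"
    and \<epsilon>: "0 \<le> \<epsilon>" "(real (card I) - 1) * \<epsilon> < 1"
    and ker: "\<And>v. v \<in> V \<Longrightarrow> (\<And>i. i \<in> I \<Longrightarrow> Q i v = 0) \<Longrightarrow> v = 0"
    and v: "v \<in> V"
  shows "(1 - (real (card I) - 1) * \<epsilon>) * (norm v)\<^sup>2 \<le> (\<Sum>i\<in>I. (norm (Q i v))\<^sup>2)"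
proof -
  define T where "T x = (\<Sum>i\<in>I. Q i x)" for x
  define d where "d = real (card I)"
  have d: "1 \<le> d" using I by (simp add: d_def Suc_leI card_gt_0_iff)
  note Qd = orthogonal_projection_onD[OF Q]
  have E: "inner (T x) x = (\<Sum>i\<in>I. (norm (Q i x))\<^sup>2)" if "x \<in> V" for x
    unfolding T_def inner_sum_left by (rule sum.cong[OF HOL.refl]) (rule inner_orthogonal_projection[OF Q that])
  have sq: "(norm (T x))\<^sup>2 = (\<Sum>i\<in>I. \<Sum>j\<in>I. inner (Q i x) (Q j x))" for x
    unfolding T_def power2_norm_eq_inner inner_sum_left by (simp only: inner_sum_right)
  have "(1 - (d - 1) * \<epsilon>) * (norm v)\<^sup>2 \<le> inner (T v) v"
  proof (rule spectral_gap_from_square[OF V, where d = d])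
    fix x assume x: "x \<in> V"
    show "T x \<in> V" unfolding T_def using Qd(1) x by (intro subspace_sum[OF V(1)])
    show "T (c *\<^sub>R x) = c *\<^sub>R T x" for c unfolding T_def scaleR_sum_right by (rule sum.cong[OF HOL.refl]) (use Qd(3) x in blast)
    show "T (x + y) = T x + T y" if "y \<in> V" for y
      unfolding T_def sum.distrib[symmetric] using Qd(2) x that by (intro sum.cong) auto
    show "inner (T x) y = inner x (T y)" if "y \<in> V" for y
      unfolding T_def inner_sum_left inner_sum_right using Qd(5) x that by (intro sum.cong) auto
    show "x = 0" if "T x = 0"
    proof (rule ker[OF x])
      have "(\<Sum>i\<in>I. (norm (Q i x))\<^sup>2) = 0" using E[OF x] that by simp
      then show "Q i x = 0" if "i \<in> I" for i
        using that by (simp add: sum_nonneg_eq_0_iff[OF I(1)])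
    qed
    have "(norm (T x))\<^sup>2 \<le> (\<Sum>i\<in>I. norm (Q i x))\<^sup>2"
      unfolding T_def by (intro power_mono norm_sum) auto
    also have "\<dots> \<le> d * (\<Sum>i\<in>I. (norm (Q i x))\<^sup>2)"
      using sum_squared_le_sum_of_squares[of "\<lambda>i. norm (Q i x)" I] by (simp add: d_def mult.commute)
    finally show "(norm (T x))\<^sup>2 \<le> d * inner (T x) x" by (simp add: E x)
    let ?a = "\<lambda>i. (norm (Q i x))\<^sup>2"
    have diag: "(\<Sum>j\<in>I. g j) = g i + (\<Sum>j\<in>I - {i}. g j)" if "i \<in> I" for i and g :: "_ \<Rightarrow> real"
      using that I by (simp add: sum.remove)
    have card: "real (card (I - {i})) = d - 1" if "i \<in> I" for i
      using that I d by (simp add: d_def of_nat_diff Suc_leI card_gt_0_iff)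
    have swap: "(\<Sum>i\<in>I. \<Sum>j\<in>I - {i}. ?a j) = (d - 1) * (\<Sum>i\<in>I. ?a i)"
    proof -
      have "(\<Sum>i\<in>I. \<Sum>j\<in>I - {i}. ?a j) = (\<Sum>i\<in>I. (\<Sum>j\<in>I. ?a j) - ?a i)"
        by (intro sum.cong HOL.refl) (simp add: diag)
      then show ?thesis by (simp add: sum_subtractf d_def algebra_simps)
    qed
    have "(\<Sum>i\<in>I. \<Sum>j\<in>I - {i}. ?a i) = (\<Sum>i\<in>I. (d - 1) * ?a i)"
      unfolding sum_constant by (intro sum.cong HOL.refl) (simp only: card)
    then have "(\<Sum>i\<in>I. \<Sum>j\<in>I - {i}. ?a i + ?a j) = 2 * ((d - 1) * (\<Sum>i\<in>I. ?a i))"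
      using swap by (simp add: sum.distrib sum_distrib_left)
    then have "- \<epsilon> * (2 * ((d - 1) * (\<Sum>i\<in>I. ?a i))) = (\<Sum>i\<in>I. \<Sum>j\<in>I - {i}. - \<epsilon> * (?a i + ?a j))"
      unfolding sum_distrib_left[symmetric] by (rule arg_cong[OF HOL.sym])
    also have "\<dots> \<le> (\<Sum>i\<in>I. \<Sum>j\<in>I - {i}. 2 * inner (Q i x) (Q j x))"
      using pair x by (intro sum_mono) blast
    also have "\<dots> = 2 * ((norm (T x))\<^sup>2 - (\<Sum>i\<in>I. ?a i))"
    proof -
      have "(norm (T x))\<^sup>2 = (\<Sum>i\<in>I. ?a i + (\<Sum>j\<in>I - {i}. inner (Q i x) (Q j x)))"
        unfolding sq by (intro sum.cong HOL.refl) (simp add: diag power2_norm_eq_inner)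
      then have "(norm (T x))\<^sup>2 - (\<Sum>i\<in>I. ?a i) = (\<Sum>i\<in>I. \<Sum>j\<in>I - {i}. inner (Q i x) (Q j x))"
        by (simp only: sum.distrib add_diff_cancel_left')
      then show ?thesis by (simp only: sum_distrib_left)
    qed
    finally show "(1 - (d - 1) * \<epsilon>) * inner (T x) x \<le> (norm (T x))\<^sup>2"
      using x by (simp add: E algebra_simps)
  next
    show "1 - (d - 1) * \<epsilon> \<le> d" using mult_nonneg_nonneg[of "d - 1" \<epsilon>] \<epsilon> d by linarith
  qed (use \<epsilon> v in \<open>auto simp: d_def\<close>)
  then show ?thesis by (simp add: E v d_def)
qed

text \<open>The projection \<open>C\<close> splits the space into a part on which \<open>P\<close> and \<open>R\<close> commute, where the
  complements have a nonnegative inner product, and a part on which the ranges of \<open>P\<close> and \<open>R\<close> meet at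
  an angle with cosine at most \<open>\<epsilon>\<close>. There \<open>P + R \<le> 1 + \<epsilon>\<close>, so the sum \<open>S\<close> of the complements satisfies
  \<open>S \<ge> 1 - \<epsilon>\<close> and therefore \<open>S\<^sup>2 \<ge> (1 - \<epsilon>) S\<close>, which is the assertion.\<close>

lemma pair_bound_from_angle:
  assumes V: "subspace V" and P: "orthogonal_projection_on V P" and R: "orthogonal_projection_on V R"
    and C: "orthogonal_projection_on V C"
    and CP: "\<And>x. x \<in> V \<Longrightarrow> C (P x) = P (C x)" and CR: "\<And>x. x \<in> V \<Longrightarrow> C (R x) = R (C x)"
    and comm: "\<And>x. x \<in> V \<Longrightarrow> C x = x \<Longrightarrow> P (R x) = R (P x)"
    and angle: "\<And>x. x \<in> V \<Longrightarrow> C x = 0 \<Longrightarrow> inner (P x) (R x) \<le> \<epsilon> * (norm (P x) * norm (R x))"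
    and \<epsilon>: "0 \<le> \<epsilon>" "\<epsilon> \<le> 1" and v: "v \<in> V"
  shows "- \<epsilon> * ((norm (v - P v))\<^sup>2 + (norm (v - R v))\<^sup>2) \<le> 2 * inner (v - P v) (v - R v)"
proof -
  note Pd = orthogonal_projection_onD[OF P] and Rd = orthogonal_projection_onD[OF R]
    and Cd = orthogonal_projection_onD[OF C]
  define x where "x = v - C v"
  have x: "x \<in> V" "C x = 0"
    unfolding x_def using v Cd by (auto intro: subspace_diff[OF V] simp: orthogonal_projection_on_diff[OF V C])
  define S where "S = (x - P x) + (x - R x)"
  have eP: "inner (P x) x = (norm (P x))\<^sup>2" and eR: "inner (R x) x = (norm (R x))\<^sup>2"
    using inner_orthogonal_projection P R x by blast+
  have P': "inner (x - P x) x = (norm (x - P x))\<^sup>2" and R': "inner (x - R x) x = (norm (x - R x))\<^sup>2"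
    using inner_orthogonal_projection[OF orthogonal_projection_on_complement[OF V P] x(1)]
      inner_orthogonal_projection[OF orthogonal_projection_on_complement[OF V R] x(1)] by auto
  have "(norm (P x + R x))\<^sup>2 \<le> (1 + \<epsilon>) * inner (P x + R x) x"
  proof -
    have "2 * (norm (P x) * norm (R x)) \<le> (norm (P x))\<^sup>2 + (norm (R x))\<^sup>2"
      using sum_squares_bound[of "norm (P x)" "norm (R x)"] by (simp add: power2_eq_square)
    then have "\<epsilon> * (2 * (norm (P x) * norm (R x))) \<le> \<epsilon> * ((norm (P x))\<^sup>2 + (norm (R x))\<^sup>2)"
      using \<epsilon> by (intro mult_left_mono)
    moreover have "(norm (P x + R x))\<^sup>2 = (norm (P x))\<^sup>2 + (norm (R x))\<^sup>2 + 2 * inner (P x) (R x)"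
      by (simp add: power2_norm_eq_inner inner_add_left inner_add_right inner_commute)
    ultimately show ?thesis
      using angle[OF x] by (simp add: inner_add_left eP eR algebra_simps)
  qed
  also have "\<dots> \<le> (1 + \<epsilon>) * (norm (P x + R x) * norm x)"
    using \<epsilon> by (intro mult_left_mono norm_cauchy_schwarz) auto
  finally have PR: "norm (P x + R x) \<le> (1 + \<epsilon>) * norm x"
    using \<epsilon> by (cases "norm (P x + R x) = 0") (auto simp: power2_eq_square)
  have Sx: "(1 - \<epsilon>) * (norm x)\<^sup>2 \<le> inner S x"
  proof -
    have "inner (P x + R x) x \<le> (1 + \<epsilon>) * norm x * norm x"
      by (rule order_trans[OF norm_cauchy_schwarz mult_right_mono[OF PR norm_ge_zero]])
    then show ?thesis
      by (simp add: S_def inner_diff_left inner_add_left power2_norm_eq_inner[symmetric] algebra_simps power2_eq_square)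
  qed
  have nS: "(1 - \<epsilon>) * norm x \<le> norm S"
  proof (cases "x = 0")
    case False
    have "(1 - \<epsilon>) * norm x * norm x \<le> norm S * norm x"
      using Sx norm_cauchy_schwarz[of S x] by (simp add: power2_eq_square)
    then show ?thesis using False by simp
  qed simp
  have "(1 - \<epsilon>) * inner S x \<le> (1 - \<epsilon>) * (norm S * norm x)"
    using \<epsilon> by (intro mult_left_mono norm_cauchy_schwarz) auto
  also have "\<dots> \<le> norm S * norm S"
    using mult_left_mono[OF nS norm_ge_zero[of S]] by (simp add: algebra_simps)
  finally have "(1 - \<epsilon>) * inner S x \<le> (norm S)\<^sup>2" by (simp add: power2_eq_square)
  moreover have "inner S x = (norm (x - P x))\<^sup>2 + (norm (x - R x))\<^sup>2"
    by (simp add: S_def inner_add_left P' R')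
  moreover have "(norm S)\<^sup>2 = (norm (x - P x))\<^sup>2 + (norm (x - R x))\<^sup>2 + 2 * inner (x - P x) (x - R x)"
    by (simp add: S_def power2_norm_eq_inner inner_add_left inner_add_right inner_commute)
  ultimately have x_part: "- \<epsilon> * ((norm (x - P x))\<^sup>2 + (norm (x - R x))\<^sup>2) \<le> 2 * inner (x - P x) (x - R x)"
    by (simp add: algebra_simps)
  define y where "y = C v"
  have y: "y \<in> V" "C y = y" and vxy: "v = x + y" using v Cd by (auto simp: y_def x_def)
  have y_part: "0 \<le> inner (y - P y) (y - R y)"
    by (rule commuting_projections_inner_nonneg[OF V P R y(1) comm[OF y]])
  have sep: "inner a b = 0" if "a \<in> V" "b \<in> V" "C a = 0" "C b = b" for a b
    using Cd(5)[OF that(1) that(2)] that by simp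
  have P0: "P 0 = 0" "R 0 = 0" using Pd(3)[OF v, of 0] Rd(3)[OF v, of 0] by auto
  have xs: "x - P x \<in> V" "x - R x \<in> V" "C (x - P x) = 0" "C (x - R x) = 0"
    and ys: "y - P y \<in> V" "y - R y \<in> V" "C (y - P y) = y - P y" "C (y - R y) = y - R y"
    using x y Pd Rd CP CR by (auto simp: orthogonal_projection_on_diff[OF V C] P0 intro: subspace_diff[OF V])
  have dec: "v - P v = (x - P x) + (y - P y)" "v - R v = (x - R x) + (y - R y)"
    using x y Pd Rd by (auto simp: vxy)
  have z: "inner (x - P x) (y - R y) = 0" "inner (x - R x) (y - P y) = 0"
    "inner (x - P x) (y - P y) = 0" "inner (x - R x) (y - R y) = 0"
    using sep xs ys by blast+
  have "2 * inner (v - P v) (v - R v) = 2 * inner (x - P x) (x - R x) + 2 * inner (y - P y) (y - R y)"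
    unfolding dec using z by (simp only: inner_add_left inner_add_right) (simp add: inner_commute)
  moreover have "(norm (v - P v))\<^sup>2 = (norm (x - P x))\<^sup>2 + (norm (y - P y))\<^sup>2"
    "(norm (v - R v))\<^sup>2 = (norm (x - R x))\<^sup>2 + (norm (y - R y))\<^sup>2"
    unfolding dec power2_norm_eq_inner using z by (simp_all only: inner_add_left inner_add_right) (simp_all add: inner_commute)
  moreover have "0 \<le> \<epsilon> * ((norm (y - P y))\<^sup>2 + (norm (y - R y))\<^sup>2)" using \<epsilon> by simp
  ultimately show ?thesis using x_part y_part by (simp add: algebra_simps)
qed

section \<open>Averages over finite groups\<close>

definition isometric_action_on :: "'v::real_inner set \<Rightarrow> ('f::ab_group_add \<Rightarrow> 'v \<Rightarrow> 'v) \<Rightarrow> bool" where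
  "isometric_action_on V T \<longleftrightarrow>
     (\<forall>r. \<forall>x\<in>V. T r x \<in> V) \<and>
     (\<forall>r. \<forall>x\<in>V. \<forall>y\<in>V. T r (x + y) = T r x + T r y) \<and>
     (\<forall>r c. \<forall>x\<in>V. T r (c *\<^sub>R x) = c *\<^sub>R T r x) \<and>
     (\<forall>x\<in>V. T 0 x = x) \<and>
     (\<forall>r s. \<forall>x\<in>V. T (r + s) x = T r (T s x)) \<and>
     (\<forall>r. \<forall>x\<in>V. \<forall>y\<in>V. inner (T r x) (T r y) = inner x y)"

text \<open>The average over a finite group is the orthogonal projection onto the fixed vectors.\<close>

definition average :: "('f::finite \<Rightarrow> 'v::real_inner \<Rightarrow> 'v) \<Rightarrow> 'v \<Rightarrow> 'v" where
  "average T x = (1 / real CARD('f)) *\<^sub>R (\<Sum>r\<in>UNIV. T r x)"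

lemma isometric_action_onD:
  assumes "isometric_action_on V T" "x \<in> V"
  shows "T r x \<in> V" "y \<in> V \<Longrightarrow> T r (x + y) = T r x + T r y" "T r (c *\<^sub>R x) = c *\<^sub>R T r x"
    "T 0 x = x" "T (r + s) x = T r (T s x)" "y \<in> V \<Longrightarrow> inner (T r x) (T r y) = inner x y"
  using assms unfolding isometric_action_on_def by blast+

lemma isometric_action_sum:
  assumes V: "subspace V" and T: "isometric_action_on V T" and "finite I" "\<And>i. i \<in> I \<Longrightarrow> g i \<in> V"
  shows "T r (\<Sum>i\<in>I. g i) = (\<Sum>i\<in>I. T r (g i))"
  using assms(3,4)
proof (induction I rule: finite_induct)
  case empty
  show ?case using isometric_action_onD(3)[OF T subspace_0[OF V], of r 0] by simp
next
  case (insert i I)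
  then show ?case using isometric_action_onD(2)[OF T] by (auto simp: subspace_sum[OF V])
qed

lemma average_in:
  assumes "subspace V" "isometric_action_on V T" "x \<in> V"
  shows "average T x \<in> V"
  unfolding average_def using isometric_action_onD(1)[OF assms(2,3)]
  by (intro subspace_mul[OF assms(1)] subspace_sum[OF assms(1)]) auto

lemma action_average:
  fixes T :: "'f::{ab_group_add,finite} \<Rightarrow> 'v::real_inner \<Rightarrow> 'v"
  assumes "subspace V" "isometric_action_on V T" "isometric_action_on V S" "x \<in> V"
  shows "S s (average T x) = (1 / real CARD('f)) *\<^sub>R (\<Sum>r\<in>UNIV. S s (T r x))"
  unfolding average_def using isometric_action_onD(1)[OF assms(2,4)]
  by (simp add: isometric_action_onD(3)[OF assms(3)] subspace_sum[OF assms(1)]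
      isometric_action_sum[OF assms(1,3)])

lemma average_of_constant: "(1 / real CARD('f::finite)) *\<^sub>R (\<Sum>r\<in>(UNIV::'f set). x) = (x::'v::real_inner)"
  by (simp add: sum_constant_scaleR)

lemma action_average_self:
  fixes T :: "'f::{ab_group_add,finite} \<Rightarrow> 'v::real_inner \<Rightarrow> 'v"
  assumes "subspace V" "isometric_action_on V T" "x \<in> V"
  shows "T s (average T x) = average T x"
proof -
  have "(\<Sum>r\<in>UNIV. T s (T r x)) = (\<Sum>r\<in>UNIV. T (s + r) x)"
    using isometric_action_onD(5)[OF assms(2,3)] by simp
  also have "\<dots> = (\<Sum>r\<in>UNIV. T r x)"
    by (rule sum.reindex_bij_betw) (rule bij_betw_byWitness[where f' = "\<lambda>r. r - s"], auto)
  finally show ?thesis by (simp add: action_average[OF assms(1,2,2,3)]) (simp add: average_def)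
qed

lemma average_fixed:
  fixes T :: "'f::{ab_group_add,finite} \<Rightarrow> 'v::real_inner \<Rightarrow> 'v"
  assumes "\<And>r. T r x = x"
  shows "average T x = x"
  unfolding average_def assms by (rule average_of_constant)

lemma orthogonal_projection_on_average:
  fixes T :: "'f::{ab_group_add,finite} \<Rightarrow> 'v::real_inner \<Rightarrow> 'v"
  assumes V: "subspace V" and T: "isometric_action_on V T"
  shows "orthogonal_projection_on V (average T)"
proof -
  note Td = isometric_action_onD[OF T]
  have "inner (average T x) y = inner x (average T y)" if x: "x \<in> V" and y: "y \<in> V" for x y
  proof -
    have "inner (T r x) y = inner x (T (- r) y)" for r
      using Td(6)[OF x Td(1)[OF y, of "- r"], of r] Td(4)[OF y] Td(5)[OF y, of r "- r"] by simp
    then have "(\<Sum>r\<in>UNIV. inner (T r x) y) = (\<Sum>r\<in>UNIV. inner x (T (- r) y))" by simp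
    also have "\<dots> = (\<Sum>r\<in>UNIV. inner x (T r y))"
      by (rule sum.reindex_bij_betw) (simp add: bij_uminus)
    finally show ?thesis by (simp add: average_def inner_sum_left inner_sum_right)
  qed
  moreover have "average T (average T x) = average T x" if "x \<in> V" for x
    by (intro average_fixed action_average_self[OF V T that])
  moreover have "average T (c *\<^sub>R x) = c *\<^sub>R average T x" if "x \<in> V" for c x
    using Td(3)[OF that] by (simp add: average_def scaleR_sum_right)
  moreover have "average T (x + y) = average T x + average T y" if "x \<in> V" "y \<in> V" for x y
    using Td(2)[OF that] by (simp add: average_def sum.distrib scaleR_add_right)
  ultimately show ?thesis
    unfolding orthogonal_projection_on_def using average_in[OF V T]
    by (intro conjI allI ballI) assumption+
qed

text \<open>The mean of \<open>\<parallel>T r x - x\<parallel>\<^sup>2\<close> over the group is \<open>2 \<parallel>x - P x\<parallel>\<^sup>2\<close>, where \<open>P\<close> is the average.\<close>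

lemma norm_average_complement:
  fixes T :: "'f::{ab_group_add,finite} \<Rightarrow> 'v::real_inner \<Rightarrow> 'v"
  assumes V: "subspace V" and T: "isometric_action_on V T" and x: "x \<in> V"
    and small: "\<And>r. norm (T r x - x) \<le> \<delta>"
  shows "2 * (norm (x - average T x))\<^sup>2 \<le> \<delta>\<^sup>2"
proof -
  note Td = isometric_action_onD[OF T x]
  note P = orthogonal_projection_on_average[OF V T]
  have "(norm (T r x - x))\<^sup>2 = 2 * inner x x - 2 * inner (T r x) x" for r
    using Td(6)[OF x, of r] by (simp add: power2_norm_eq_inner inner_diff_left inner_diff_right inner_commute)
  then have "(\<Sum>r\<in>UNIV. (norm (T r x - x))\<^sup>2)
      = real CARD('f) * (2 * inner x x) - 2 * inner (\<Sum>r\<in>UNIV. T r x) x"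
    by (simp add: sum_subtractf inner_sum_left sum_distrib_left)
  also have "inner (\<Sum>r\<in>UNIV. T r x) x = real CARD('f) * inner (average T x) x"
    by (simp add: average_def)
  finally have "(\<Sum>r\<in>UNIV. (norm (T r x - x))\<^sup>2)
      = real CARD('f) * (2 * (inner x x - inner (average T x) x))" by (simp add: algebra_simps)
  moreover have "(\<Sum>r\<in>UNIV. (norm (T r x - x))\<^sup>2) \<le> (\<Sum>r\<in>(UNIV::'f set). \<delta>\<^sup>2)"
    using small by (intro sum_mono power_mono) auto
  ultimately have "2 * (inner x x - inner (average T x) x) \<le> \<delta>\<^sup>2" by simp
  then show ?thesis
    using inner_orthogonal_projection[OF orthogonal_projection_on_complement[OF V P] x]
    by (simp add: inner_diff_left)
qed

lemma averages_commute:
  fixes X Y :: "'f::{ab_group_add,finite} \<Rightarrow> 'v::real_inner \<Rightarrow> 'v"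
  assumes V: "subspace V" and X: "isometric_action_on V X" and Y: "isometric_action_on V Y"
    and x: "x \<in> V" and comm: "\<And>r s. X r (Y s x) = Y s (X r x)"
  shows "average X (average Y x) = average Y (average X x)"
proof -
  have "average X (average Y x) = (1 / real CARD('f)) *\<^sub>R (\<Sum>r\<in>UNIV. X r (average Y x))"
    by (simp add: average_def)
  also have "\<dots> = (1 / real CARD('f)) *\<^sub>R ((1 / real CARD('f)) *\<^sub>R (\<Sum>r\<in>UNIV. \<Sum>s\<in>UNIV. X r (Y s x)))"
    by (simp add: action_average[OF V Y X x] scaleR_sum_right)
  also have "(\<Sum>r\<in>UNIV. \<Sum>s\<in>UNIV. X r (Y s x)) = (\<Sum>s\<in>UNIV. \<Sum>r\<in>UNIV. Y s (X r x))"
    unfolding comm by (rule sum.swap)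
  also have "(1 / real CARD('f)) *\<^sub>R ((1 / real CARD('f)) *\<^sub>R (\<Sum>s\<in>UNIV. \<Sum>r\<in>UNIV. Y s (X r x)))
      = (1 / real CARD('f)) *\<^sub>R (\<Sum>s\<in>UNIV. Y s (average X x))"
    by (simp add: action_average[OF V X Y x] scaleR_sum_right)
  also have "\<dots> = average Y (average X x)" by (simp add: average_def)
  finally show ?thesis .
qed

text \<open>A quotient of the Heisenberg group over a field with \<open>q\<close> elements acts. Its centre \<open>Z\<close> serves as the
  splitting: on the fixed vectors of \<open>Z\<close> the two subgroups commute. On their orthogonal complement
  the average \<open>P\<^sub>Z\<close> vanishes, and for nonzero \<open>r\<close> the commutation relation turns \<open>P\<^sub>Y (X r) P\<^sub>Y\<close> into
  \<open>(X r) P\<^sub>Z P\<^sub>Y\<close>, because \<open>c r s\<close> runs through the field together with \<open>s\<close>. So only \<open>r = 0\<close> contributes to \<open>P\<^sub>Y P\<^sub>X P\<^sub>Y\<close>, which makes it \<open>P\<^sub>Y / q\<close>, and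
  \<open>\<parallel>P\<^sub>X P\<^sub>Y\<parallel>\<^sup>2 \<le> 1 / q\<close>.\<close>

lemma heisenberg_pair_bound:
  fixes X Y Z :: "'f::{field,finite} \<Rightarrow> 'v::real_inner \<Rightarrow> 'v"
  assumes V: "subspace V"
    and X: "isometric_action_on V X" and Y: "isometric_action_on V Y" and Z: "isometric_action_on V Z"
    and c: "c \<noteq> 0"
    and XY: "\<And>r s x. x \<in> V \<Longrightarrow> X r (Y s x) = Z (c * r * s) (Y s (X r x))"
    and XZ: "\<And>r s x. x \<in> V \<Longrightarrow> X r (Z s x) = Z s (X r x)"
    and YZ: "\<And>r s x. x \<in> V \<Longrightarrow> Y r (Z s x) = Z s (Y r x)"
    and v: "v \<in> V"
  shows "- (1 / sqrt (real CARD('f))) * ((norm (v - average X v))\<^sup>2 + (norm (v - average Y v))\<^sup>2)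
    \<le> 2 * inner (v - average X v) (v - average Y v)"
proof -
  define \<epsilon> where "\<epsilon> = 1 / sqrt (real CARD('f))"
  have q: "1 \<le> real CARD('f)" by (simp add: Suc_leI)
  have \<epsilon>: "0 \<le> \<epsilon>" "\<epsilon> \<le> 1" using q by (auto simp: \<epsilon>_def real_le_rsqrt)
  note Xd = isometric_action_onD[OF X] and Yd = isometric_action_onD[OF Y] and Zd = isometric_action_onD[OF Z]
  note PX = orthogonal_projection_on_average[OF V X] and PY = orthogonal_projection_on_average[OF V Y]
    and PZ = orthogonal_projection_on_average[OF V Z]
  have ZX: "average Z (average X x) = average X (average Z x)" if "x \<in> V" for x
    using averages_commute[OF V X Z that] XZ that by simp
  have ZY: "average Z (average Y x) = average Y (average Z x)" if "x \<in> V" for x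
    using averages_commute[OF V Y Z that] YZ that by simp
  have "- \<epsilon> * ((norm (v - average X v))\<^sup>2 + (norm (v - average Y v))\<^sup>2)
    \<le> 2 * inner (v - average X v) (v - average Y v)"
  proof (rule pair_bound_from_angle[where P = "average X" and R = "average Y" and C = "average Z",
        OF V PX PY PZ _ _ _ _ \<epsilon> v])
    fix x assume x: "x \<in> V"
    show "average Z (average X x) = average X (average Z x)" by (rule ZX[OF x])
    show "average Z (average Y x) = average Y (average Z x)" by (rule ZY[OF x])
  next
    fix x assume x: "x \<in> V" "average Z x = x"
    have Zfix: "Z s x = x" for s using action_average_self[OF V Z x(1), of s] x(2) by simp
    have "X r (Y s x) = Y s (X r x)" for r s
      by (simp only: XY[OF x(1)] Zfix YZ[OF Xd(1)[OF x(1)], symmetric] XZ[OF x(1), symmetric])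
    then show "average X (average Y x) = average Y (average X x)"
      by (rule averages_commute[OF V X Y x(1)])
  next
    fix x assume x: "x \<in> V" "average Z x = 0"
    let ?y = "average Y x"
    have y: "?y \<in> V" by (rule average_in[OF V Y x(1)])
    have Yy: "Y s ?y = ?y" for s by (rule action_average_self[OF V Y x(1)])
    have Zy: "average Z ?y = 0"
      using ZY[OF x(1)] x(2) orthogonal_projection_onD(3)[OF PY x(1), of 0] by simp
    have YX: "average Y (X r ?y) = (if r = 0 then ?y else 0)" for r
    proof (cases "r = 0")
      case True
      then show ?thesis using Xd(4)[OF y] by (simp add: average_fixed Yy)
    next
      case False
      have "Y s (X r ?y) = Z (- (c * r * s)) (X r ?y)" for s
      proof -
        have "X r ?y = Z (c * r * s) (Y s (X r ?y))" using XY[OF y, of r s] Yy by simp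
        then have "Z (- (c * r * s)) (X r ?y) = Z (- (c * r * s) + c * r * s) (Y s (X r ?y))"
          unfolding Zd(5)[OF Yd(1)[OF Xd(1)[OF y]]] by (rule arg_cong)
        then show ?thesis using Zd(4)[OF Yd(1)[OF Xd(1)[OF y]]] by simp
      qed
      then have "average Y (X r ?y) = (1 / real CARD('f)) *\<^sub>R (\<Sum>s\<in>UNIV. Z (- (c * r * s)) (X r ?y))"
        by (simp add: average_def)
      also have "(\<Sum>s\<in>UNIV. Z (- (c * r * s)) (X r ?y)) = (\<Sum>s\<in>UNIV. Z s (X r ?y))"
      proof (rule sum.reindex_bij_betw)
        show "bij (\<lambda>s. - (c * r * s))"
          by (rule bij_betw_byWitness[where f' = "\<lambda>s. - s / (c * r)"]) (use c False in auto)
      qed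
      also have "(1 / real CARD('f)) *\<^sub>R (\<Sum>s\<in>UNIV. Z s (X r ?y)) = X r (average Z ?y)"
        using XZ[OF y] by (simp add: action_average[OF V Z X y])
      finally show ?thesis using False Zy Xd(3)[OF y, of r 0] by simp
    qed
    have YXY: "average Y (average X ?y) = (1 / real CARD('f)) *\<^sub>R ?y"
    proof -
      have "average Y (average X ?y) = (1 / real CARD('f)) *\<^sub>R (\<Sum>s\<in>UNIV. (1 / real CARD('f)) *\<^sub>R (\<Sum>r\<in>UNIV. Y s (X r ?y)))"
        by (simp add: average_def[of Y "average X _"] action_average[OF V X Y y])
      also have "\<dots> = (1 / real CARD('f)) *\<^sub>R (\<Sum>r\<in>UNIV. average Y (X r ?y))"
        unfolding average_def[of Y "X _ (average Y x)"] scaleR_sum_right by (rule sum.swap)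
      also have "(\<Sum>r\<in>UNIV. average Y (X r ?y)) = ?y" unfolding YX by (simp add: sum.delta)
      finally show ?thesis .
    qed
    have "(norm (average X ?y))\<^sup>2 = inner (average X ?y) ?y"
      by (rule inner_orthogonal_projection[OF PX y, symmetric])
    also have "\<dots> = inner (average Y (average X ?y)) ?y"
      using orthogonal_projection_onD(5)[OF PY average_in[OF V X y] y] orthogonal_projection_onD(4)[OF PY x(1)]
      by simp
    also have "\<dots> = (\<epsilon> * norm ?y)\<^sup>2"
      by (simp add: YXY \<epsilon>_def power_divide power_mult_distrib power2_norm_eq_inner)
    finally have ny: "norm (average X ?y) = \<epsilon> * norm ?y"
      using \<epsilon> by (simp add: power2_eq_iff_nonneg)
    have "inner (average X x) ?y = inner (average X x) (average X ?y)"
      using orthogonal_projection_onD(5)[OF PX average_in[OF V X x(1)] y] orthogonal_projection_onD(4)[OF PX x(1)]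
      by simp
    also have "\<dots> \<le> norm (average X x) * (\<epsilon> * norm ?y)"
      using norm_cauchy_schwarz[of "average X x" "average X ?y"] by (simp add: ny)
    finally show "inner (average X x) ?y \<le> \<epsilon> * (norm (average X x) * norm ?y)" by (simp add: algebra_simps)
  qed
  then show ?thesis by (simp add: \<epsilon>_def)
qed

text \<open>Some \<open>T i\<close> moves \<open>v\<close> by as much as the spectral gap forces its distance from the fixed
  vectors to be.\<close>

lemma sum_of_displacements_bound:
  fixes T :: "'n::finite \<Rightarrow> 'f::{ab_group_add,finite} \<Rightarrow> 'v::{real_inner,banach} \<Rightarrow> 'v"
  assumes V: "subspace V" "closed V"
    and T: "\<And>i. isometric_action_on V (T i)"
    and pair: "\<And>i j v. i \<noteq> j \<Longrightarrow> v \<in> V \<Longrightarrow>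
       - \<epsilon> * ((norm (v - average (T i) v))\<^sup>2 + (norm (v - average (T j) v))\<^sup>2)
         \<le> 2 * inner (v - average (T i) v) (v - average (T j) v)"
    and \<epsilon>: "0 \<le> \<epsilon>" "(real CARD('n) - 1) * \<epsilon> < 1"
    and fixed: "\<And>v. v \<in> V \<Longrightarrow> (\<And>i r. T i r v = v) \<Longrightarrow> v = 0"
    and v: "v \<in> V" "v \<noteq> 0"
    and \<delta>: "0 < \<delta>" "\<And>i r. norm (T i r v - v) \<le> \<delta> * norm v"
  shows "sqrt (2 / real CARD('n) * (1 - (real CARD('n) - 1) * \<epsilon>)) \<le> \<delta>"
proof -
  let ?d = "real CARD('n)"
  have "(1 - (real (card (UNIV :: 'n set)) - 1) * \<epsilon>) * (norm v)\<^sup>2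
      \<le> (\<Sum>i\<in>UNIV. (norm (v - average (T i) v))\<^sup>2)"
  proof (rule sum_complements_spectral_gap[where Q = "\<lambda>i x. x - average (T i) x", OF V _ _ _ pair \<epsilon> _ v(1)])
    show "orthogonal_projection_on V (\<lambda>x. x - average (T i) x)" for i
      by (rule orthogonal_projection_on_complement[OF V(1) orthogonal_projection_on_average[OF V(1) T]])
    fix w assume w: "w \<in> V" "\<And>i. i \<in> UNIV \<Longrightarrow> w - average (T i) w = 0"
    then have "T i r w = w" for i r
      using action_average_self[OF V(1) T w(1), of i r] by simp
    then show "w = 0" by (rule fixed[OF w(1)])
  qed simp_all
  also have "\<dots> \<le> (\<Sum>i\<in>(UNIV :: 'n set). (\<delta> * norm v)\<^sup>2 / 2)"
    using norm_average_complement[OF V(1) T v(1) \<delta>(2)] by (intro sum_mono) (simp add: field_simps)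
  also have "\<dots> = ?d * \<delta>\<^sup>2 / 2 * (norm v)\<^sup>2" by (simp add: power_mult_distrib)
  finally have "1 - (?d - 1) * \<epsilon> \<le> ?d * \<delta>\<^sup>2 / 2"
    using v(2) by (simp only: mult_le_cancel_right) (simp add: zero_less_power2 not_le[symmetric])
  then have "2 / ?d * (1 - (?d - 1) * \<epsilon>) \<le> \<delta>\<^sup>2"
    by (simp add: field_simps)
  then show ?thesis using \<delta>(1) by (simp add: real_le_lsqrt)
qed

section \<open>Exponentials of locally nilpotent operators\<close>

definition locally_nilpotent :: "('a::real_vector \<Rightarrow> 'a) \<Rightarrow> bool" where
  "locally_nilpotent X \<longleftrightarrow> (\<forall>v. \<exists>n. (X ^^ n) v = 0)"

abbreviation divided_power :: "('a::real_vector \<Rightarrow> 'a) \<Rightarrow> nat \<Rightarrow> 'a \<Rightarrow> 'a" where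
  "divided_power X n v \<equiv> (1 / fact n) *\<^sub>R (X ^^ n) v"

text \<open>The series is cut off in the same way as in \<open>exp_ad\<close>.\<close>

definition exp_op :: "('a::real_vector \<Rightarrow> 'a) \<Rightarrow> 'a \<Rightarrow> 'a" where
  "exp_op X v = (\<Sum>k<(LEAST n. (X ^^ n) v = 0). divided_power X k v)"

lemma linear_funpow: "linear (X :: 'a::real_vector \<Rightarrow> 'a) \<Longrightarrow> linear (X ^^ n)"
  by (induction n) (auto simp: linear_iff)

lemma funpow_commute:
  fixes X :: "'a \<Rightarrow> 'a"
  shows "(\<And>v. X (Y v) = Y (X v)) \<Longrightarrow> (X ^^ n) (Y v) = Y ((X ^^ n) v)"
  by (induction n) auto

lemma funpow_eq_0_mono:
  fixes X :: "'a::real_vector \<Rightarrow> 'a"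
  assumes "linear X" "(X ^^ n) v = 0" "n \<le> m"
  shows "(X ^^ m) v = 0"
proof -
  have "(X ^^ m) v = (X ^^ (m - n)) ((X ^^ n) v)"
    using assms(3) by (metis comp_apply funpow_add le_add_diff_inverse2)
  then show ?thesis using assms(2) linear_0[OF linear_funpow[OF assms(1)]] by simp
qed

lemma exp_op_eq:
  assumes "linear X" "(X ^^ n) v = 0"
  shows "exp_op X v = (\<Sum>k<n. divided_power X k v)"
proof -
  let ?m = "LEAST n. (X ^^ n) v = 0"
  have "(X ^^ ?m) v = 0" "?m \<le> n" using assms(2) by (rule LeastI, rule Least_le)
  then show ?thesis
    unfolding exp_op_def
    by (intro sum.mono_neutral_left) (auto intro: funpow_eq_0_mono[OF assms(1) \<open>(X ^^ ?m) v = 0\<close>] simp: not_less)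
qed

lemma linear_exp_op:
  assumes X: "linear X" "locally_nilpotent X"
  shows "linear (exp_op X)"
proof (rule linearI)
  note lin = linear_funpow[OF X(1)]
  fix v w :: 'a and c :: real
  obtain n m where nm: "(X ^^ n) v = 0" "(X ^^ m) w = 0"
    using X(2) unfolding locally_nilpotent_def by blast
  then have 0: "(X ^^ max n m) v = 0" "(X ^^ max n m) w = 0"
    by (auto intro: funpow_eq_0_mono[OF X(1)])
  then have 1: "(X ^^ max n m) (v + w) = 0" by (simp add: linear_add[OF lin])
  show "exp_op X (v + w) = exp_op X v + exp_op X w"
    by (simp add: exp_op_eq[OF X(1) 1] exp_op_eq[OF X(1) 0(1)] exp_op_eq[OF X(1) 0(2)]
        linear_add[OF lin] scaleR_add_right sum.distrib)
  have 2: "(X ^^ n) (c *\<^sub>R v) = 0" by (simp add: linear_scale[OF lin] nm)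
  show "exp_op X (c *\<^sub>R v) = c *\<^sub>R exp_op X v"
    by (simp add: exp_op_eq[OF X(1) 2] exp_op_eq[OF X(1) nm(1)] linear_scale[OF lin] scaleR_sum_right
        mult.commute)
qed

lemma apply_divided_power:
  assumes "linear X"
  shows "X (divided_power X n v) = real (Suc n) *\<^sub>R divided_power X (Suc n) v"
proof -
  have "1 / fact n = real (Suc n) * (1 / fact (Suc n))" by (simp del: of_nat_Suc)
  then show ?thesis by (simp only: linear_scale[OF assms] funpow.simps comp_apply scaleR_scaleR)
qed

text \<open>The binomial theorem for commuting operators, with the factorials absorbed.\<close>

lemma divided_power_add:
  assumes A: "linear A" and B: "linear B" and AB: "\<And>v. A (B v) = B (A v)"
  shows "divided_power (\<lambda>v. A v + B v) n v = (\<Sum>i\<le>n. divided_power A i (divided_power B (n - i) v))"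
proof (induction n)
  case (Suc n)
  let ?S = "\<lambda>v. A v + B v"
  let ?a = "\<lambda>i j. divided_power A i (divided_power B j v)"
  have S: "linear ?S" by (intro linear_compose_add A B)
  have Aa: "A (?a i j) = real (Suc i) *\<^sub>R ?a (Suc i) j" for i j
    by (rule apply_divided_power[OF A])
  have Ba: "B (?a i j) = real (Suc j) *\<^sub>R ?a i (Suc j)" for i j
  proof -
    have "B (?a i j) = divided_power A i (B (divided_power B j v))"
      by (simp add: linear_scale[OF B] funpow_commute[where X = A and Y = B, OF AB] linear_scale[OF linear_funpow[OF A]])
    also have "\<dots> = real (Suc j) *\<^sub>R ?a i (Suc j)"
      unfolding apply_divided_power[OF B] by (simp add: linear_scale[OF linear_funpow[OF A]] del: of_nat_Suc)
    finally show ?thesis .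
  qed
  have "real (Suc n) *\<^sub>R divided_power ?S (Suc n) v = ?S (divided_power ?S n v)"
    by (rule apply_divided_power[OF S, symmetric])
  also have "\<dots> = (\<Sum>i\<le>n. A (?a i (n - i))) + (\<Sum>i\<le>n. B (?a i (n - i)))"
    unfolding Suc.IH by (simp only: linear_sum[OF A] linear_sum[OF B])
  also have "(\<Sum>i\<le>n. A (?a i (n - i))) = (\<Sum>i\<le>Suc n. real i *\<^sub>R ?a i (Suc n - i))"
    unfolding Aa by (subst sum.atMost_Suc_shift) simp
  also have "(\<Sum>i\<le>n. B (?a i (n - i))) = (\<Sum>i\<le>Suc n. real (Suc n - i) *\<^sub>R ?a i (Suc n - i))"
    unfolding Ba by (subst sum.atMost_Suc) (auto intro!: sum.cong simp: Suc_diff_le simp del: of_nat_Suc)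
  also have "(\<Sum>i\<le>Suc n. real i *\<^sub>R ?a i (Suc n - i)) + (\<Sum>i\<le>Suc n. real (Suc n - i) *\<^sub>R ?a i (Suc n - i))
      = (\<Sum>i\<le>Suc n. real (Suc n) *\<^sub>R ?a i (Suc n - i))"
    unfolding sum.distrib[symmetric] scaleR_add_left[symmetric] by (intro sum.cong HOL.refl) (auto simp: of_nat_diff)
  also have "\<dots> = real (Suc n) *\<^sub>R (\<Sum>i\<le>Suc n. ?a i (Suc n - i))"
    by (rule scaleR_sum_right[symmetric])
  finally show ?case by (simp only: scaleR_cancel_left of_nat_eq_0_iff) simp
qed simp

lemma exp_op_add:
  assumes A: "linear A" "locally_nilpotent A" and B: "linear B" "locally_nilpotent B"
    and AB: "\<And>v. A (B v) = B (A v)"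
  shows "exp_op (\<lambda>v. A v + B v) v = exp_op A (exp_op B v)"
proof -
  let ?S = "\<lambda>v. A v + B v"
  let ?a = "\<lambda>v i j. divided_power A i (divided_power B j v)"
  have S: "linear ?S" by (intro linear_compose_add A B)
  obtain n where n: "(B ^^ n) v = 0" using B(2) unfolding locally_nilpotent_def by blast
  obtain m where m: "(A ^^ m) v = 0" using A(2) unfolding locally_nilpotent_def by blast
  have a0: "?a v i j = 0" if "m \<le> i \<or> n \<le> j" for i j
  proof (cases "n \<le> j")
    case True
    then show ?thesis
      using funpow_eq_0_mono[OF B(1) n] linear_0[OF linear_funpow[OF A(1)]] by simp
  next
    case False
    have "(A ^^ i) ((B ^^ j) v) = (B ^^ j) ((A ^^ i) v)"
      by (rule funpow_commute, rule funpow_commute[symmetric]) (rule AB[symmetric])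
    then show ?thesis
      using False that funpow_eq_0_mono[OF A(1) m] linear_0[OF linear_funpow[OF B(1)]]
      by (simp add: linear_scale[OF linear_funpow[OF A(1)]])
  qed
  have a1: "i < m" "j < n" if "?a v i j \<noteq> 0" for i j
    using a0[of i j] that by (meson not_less)+
  have "divided_power ?S (m + n) v = 0"
    unfolding divided_power_add[OF A(1) B(1) AB] by (intro sum.neutral ballI a0) auto
  then have mn: "(?S ^^ (m + n)) v = 0" by simp
  have Bv: "exp_op B v = (\<Sum>j<n. divided_power B j v)" by (rule exp_op_eq[OF B(1) n])
  have "exp_op ?S v = (\<Sum>k<m + n. \<Sum>i\<le>k. ?a v i (k - i))"
    unfolding exp_op_eq[OF S mn] divided_power_add[OF A(1) B(1) AB] ..
  also have "\<dots> = (\<Sum>(i, j)\<in>{(i, j). i + j < m + n}. ?a v i j)"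
    by (rule sum.triangle_reindex[symmetric])
  also have "\<dots> = (\<Sum>(i, j)\<in>{..<m} \<times> {..<n}. ?a v i j)"
  proof (rule sum.mono_neutral_right)
    show "finite {(i, j). i + j < m + n}"
      by (rule finite_subset[of _ "{..<m + n} \<times> {..<m + n}"]) auto
  qed (auto simp: a1 simp del: scaleR_eq_0_iff)
  also have "\<dots> = (\<Sum>i<m. \<Sum>j<n. ?a v i j)" by (rule sum.cartesian_product[symmetric])
  also have "\<dots> = (\<Sum>i<m. divided_power A i (exp_op B v))"
    unfolding Bv linear_sum[OF linear_funpow[OF A(1)]] scaleR_sum_right ..
  also have "\<dots> = exp_op A (exp_op B v)"
  proof (rule exp_op_eq[OF A(1), symmetric])
    have "divided_power A m (exp_op B v) = (\<Sum>j<n. ?a v m j)"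
      unfolding Bv linear_sum[OF linear_funpow[OF A(1)]] scaleR_sum_right ..
    also have "\<dots> = 0" by (intro sum.neutral ballI a0) auto
    finally show "(A ^^ m) (exp_op B v) = 0" by simp
  qed
  finally show ?thesis .
qed

lemma exp_op_minus:
  assumes X: "linear X" "locally_nilpotent X"
  shows "exp_op X (exp_op (\<lambda>v. - X v) v) = v"
proof -
  let ?Y = "\<lambda>v. - X v"
  have Y: "linear ?Y" by (intro linear_compose_neg X)
  have "(?Y ^^ n) v = (-1) ^ n *\<^sub>R (X ^^ n) v" for n v
    by (induction n) (auto simp: linear_scale[OF X(1)])
  then have "locally_nilpotent ?Y" using X(2) unfolding locally_nilpotent_def by simp
  then have "exp_op (\<lambda>v. X v + - X v) v = exp_op X (exp_op ?Y v)"
    by (rule exp_op_add[OF X Y]) (simp add: linear_neg[OF X(1)])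
  moreover have "exp_op (\<lambda>v. X v + - X v) v = (\<Sum>k<1. divided_power (\<lambda>v. X v + - X v) k v)"
    by (rule exp_op_eq) (auto intro: linearI)
  ultimately show ?thesis by simp
qed

text \<open>Operators that satisfy the relations of the Heisenberg algebra. The exponential of \<open>X\<close> conjugates \<open>Y\<close>
  to \<open>Y + Z\<close>, hence the exponential of \<open>Y\<close> to that of \<open>Y + Z\<close>, which splits because \<open>Y\<close> and \<open>Z\<close>
  commute.\<close>

locale heisenberg_operators =
  fixes X Y Z :: "'a::real_vector \<Rightarrow> 'a"
  assumes X: "linear X" "locally_nilpotent X" and Y: "linear Y" "locally_nilpotent Y"
    and XY: "X (Y v) = Y (X v) + Z v"
    and XZ: "X (Z v) = Z (X v)" and YZ: "Y (Z v) = Z (Y v)"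
begin

lemma linear_Z: "linear Z"
proof -
  have "Z = (\<lambda>v. X (Y v) - Y (X v))" by (simp add: XY)
  then show ?thesis
    using linear_compose_sub[OF linear_compose[OF Y(1) X(1)] linear_compose[OF X(1) Y(1)]]
    by (simp add: comp_def)
qed

lemma X_funpow_Y: "X ((Y ^^ n) v) = (Y ^^ n) (X v) + real n *\<^sub>R Z ((Y ^^ (n - 1)) v)"
proof (induction n)
  case (Suc n)
  have "X ((Y ^^ Suc n) v) = Y (X ((Y ^^ n) v)) + Z ((Y ^^ n) v)" by (simp add: XY)
  also have "Y (X ((Y ^^ n) v)) = (Y ^^ Suc n) (X v) + real n *\<^sub>R Z (Y ((Y ^^ (n - 1)) v))"
    by (simp add: Suc.IH linear_add[OF Y(1)] linear_scale[OF Y(1)] YZ)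
  also have "real n *\<^sub>R Z (Y ((Y ^^ (n - 1)) v)) = real n *\<^sub>R Z ((Y ^^ n) v)"
    by (cases n) auto
  finally show ?case by (simp add: algebra_simps)
qed simp

lemma funpow_X_funpow_Y:
  assumes "X v = 0"
  shows "(X ^^ n) ((Y ^^ n) v) = fact n *\<^sub>R (Z ^^ n) v"
proof (induction n)
  case (Suc n)
  have "(X ^^ Suc n) ((Y ^^ Suc n) v) = (X ^^ n) (X ((Y ^^ Suc n) v))"
    by (simp add: funpow_swap1)
  also have "X ((Y ^^ Suc n) v) = real (Suc n) *\<^sub>R Z ((Y ^^ n) v)"
    using X_funpow_Y[of "Suc n" v] assms linear_0[OF linear_funpow[OF Y(1)], of "Suc n"] by simp
  also have "(X ^^ n) (real (Suc n) *\<^sub>R Z ((Y ^^ n) v)) = real (Suc n) *\<^sub>R Z (fact n *\<^sub>R (Z ^^ n) v)"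
    by (simp add: linear_scale[OF linear_funpow[OF X(1)]] funpow_commute[where X = X and Y = Z, OF XZ] Suc.IH)
  finally show ?case by (simp add: linear_scale[OF linear_Z] algebra_simps)
qed simp

text \<open>On the kernel of \<open>X\<close> the operator \<open>n! Z\<^sup>n\<close> is \<open>X\<^sup>n Y\<^sup>n\<close>, so \<open>Z\<close> inherits the nilpotency of \<open>Y\<close>.
  An arbitrary vector enters this kernel after some power of \<open>Z\<close>, by induction on the power of \<open>X\<close>
  that annihilates it.\<close>

lemma locally_nilpotent_Z: "locally_nilpotent Z"
proof -
  have ker: "\<exists>n. (Z ^^ n) v = 0" if "X v = 0" for v
  proof -
    obtain n where "(Y ^^ n) v = 0" using Y(2) unfolding locally_nilpotent_def by blast
    then have "fact n *\<^sub>R (Z ^^ n) v = 0"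
      using funpow_X_funpow_Y[OF that, of n] linear_0[OF linear_funpow[OF X(1)]] by simp
    then show ?thesis by auto
  qed
  have "\<exists>n. (Z ^^ n) v = 0" if "(X ^^ m) v = 0" for m v
    using that
  proof (induction m arbitrary: v)
    case 0
    then show ?case by (intro exI[of _ 0]) simp
  next
    case (Suc m)
    then have "(X ^^ m) (X v) = 0" by (simp add: funpow_swap1)
    then obtain n where "(Z ^^ n) (X v) = 0" using Suc.IH by blast
    then have "X ((Z ^^ n) v) = 0" using funpow_commute[where X = Z and Y = X, OF XZ[symmetric]] by simp
    then obtain k where "(Z ^^ k) ((Z ^^ n) v) = 0" using ker by blast
    then have "(Z ^^ (k + n)) v = 0" by (simp add: funpow_add)
    then show ?case by blast
  qed
  then show ?thesis using X(2) unfolding locally_nilpotent_def by blast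
qed

lemma exp_op_X_Y: "exp_op X (Y v) = Y (exp_op X v) + Z (exp_op X v)"
proof -
  have step: "(X ^^ Suc k) (Y v) = Y ((X ^^ Suc k) v) + real (Suc k) *\<^sub>R Z ((X ^^ k) v)" for k
  proof (induction k)
    case 0
    show ?case by (simp add: XY)
  next
    case (Suc k)
    have "(X ^^ Suc (Suc k)) (Y v) = X (Y ((X ^^ Suc k) v)) + real (Suc k) *\<^sub>R X (Z ((X ^^ k) v))"
      using Suc.IH by (simp add: linear_add[OF X(1)] linear_scale[OF X(1)] del: of_nat_Suc)
    also have "\<dots> = Y ((X ^^ Suc (Suc k)) v) + real (Suc (Suc k)) *\<^sub>R Z ((X ^^ Suc k) v)"
      by (simp add: XY XZ algebra_simps scaleR_2)
    finally show ?case .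
  qed
  have dstep: "divided_power X (Suc k) (Y v) = Y (divided_power X (Suc k) v) + Z (divided_power X k v)" for k
    unfolding step
    by (simp add: scaleR_add_right linear_scale[OF Y(1)] linear_scale[OF linear_Z] del: of_nat_Suc)
  obtain n where n: "(X ^^ n) v = 0" using X(2) unfolding locally_nilpotent_def by blast
  then have n': "(X ^^ Suc n) v = 0" using linear_0[OF X(1)] by simp
  have n'': "(X ^^ Suc (Suc n)) (Y v) = 0"
    unfolding step using n n' by (simp add: linear_0[OF X(1)] linear_0[OF Y(1)] linear_0[OF linear_Z])
  have "exp_op X (Y v) = Y v + (\<Sum>k<Suc n. divided_power X (Suc k) (Y v))"
    unfolding exp_op_eq[OF X(1) n''] by (subst sum.lessThan_Suc_shift) simp
  also have "\<dots> = Y (v + (\<Sum>k<Suc n. divided_power X (Suc k) v)) + Z (\<Sum>k<Suc n. divided_power X k v)"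
    unfolding dstep sum.distrib by (simp add: linear_add[OF Y(1)] linear_sum[OF Y(1)] linear_sum[OF linear_Z]
        del: funpow.simps sum.lessThan_Suc)
  also have "v + (\<Sum>k<Suc n. divided_power X (Suc k) v) = (\<Sum>k<Suc (Suc n). divided_power X k v)"
    by (subst sum.lessThan_Suc_shift) simp
  also have "\<dots> = exp_op X v"
    by (rule exp_op_eq[OF X(1), symmetric]) (use n' linear_0[OF X(1)] in simp)
  also have "(\<Sum>k<Suc n. divided_power X k v) = exp_op X v"
    by (rule exp_op_eq[OF X(1) n', symmetric])
  finally show ?thesis .
qed

lemma exp_op_exp_op: "exp_op X (exp_op Y v) = exp_op (\<lambda>w. Z w + Y w) (exp_op X v)"
proof -
  let ?S = "\<lambda>w. Z w + Y w"
  note E = linear_exp_op[OF X]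
  have S: "linear ?S" by (intro linear_compose_add linear_Z Y)
  have pow: "exp_op X ((Y ^^ k) v) = (?S ^^ k) (exp_op X v)" for k
    by (induction k) (auto simp: exp_op_X_Y)
  obtain n where n: "(Y ^^ n) v = 0" using Y(2) unfolding locally_nilpotent_def by blast
  then have n': "(?S ^^ n) (exp_op X v) = 0" using pow[of n] linear_0[OF E] by simp
  have "exp_op X (exp_op Y v) = (\<Sum>k<n. (1 / fact k) *\<^sub>R exp_op X ((Y ^^ k) v))"
    by (simp add: exp_op_eq[OF Y(1) n] linear_sum[OF E] linear_scale[OF E])
  then show ?thesis unfolding pow exp_op_eq[OF S n'] .
qed

lemma exp_op_commutator:
  "exp_op X (exp_op Y (exp_op (\<lambda>v. - X v) (exp_op (\<lambda>v. - Y v) v))) = exp_op Z v"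
proof -
  have "exp_op X (exp_op Y w) = exp_op Z (exp_op Y (exp_op X w))" for w
    unfolding exp_op_exp_op
    by (rule exp_op_add[OF linear_Z locally_nilpotent_Z Y YZ[symmetric]])
  then show ?thesis by (simp add: exp_op_minus[OF X] exp_op_minus[OF Y])
qed

end

section \<open>The Kac-Moody algebra as a vector space\<close>

lemma km_Zero_if_idem:
  assumes "km_eq A (Add x x) x" shows "km_eq A x Zero"
proof -
  let ?m = "Scale (- 1) x"
  have "km_eq A (Add (Add x x) ?m) (Add x ?m)" by (intro km_eq.cong_Add assms km_eq.refl)
  then have "km_eq A (Add (Add x x) ?m) Zero" by (rule km_eq.trans[OF _ km_eq.add_minus])
  moreover have "km_eq A (Add (Add x x) ?m) x"
  proof (rule km_eq.trans[OF km_eq.add_assoc])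
    have "km_eq A (Add x (Add x ?m)) (Add x Zero)" by (intro km_eq.cong_Add km_eq.refl km_eq.add_minus)
    then show "km_eq A (Add x (Add x ?m)) x"
      by (meson km_eq.trans km_eq.add_commute km_eq.add_Zero)
  qed
  ultimately show ?thesis by (meson km_eq.trans km_eq.sym)
qed

lemma km_Scale_Zero: "km_eq A (Scale c Zero) Zero"
proof (rule km_Zero_if_idem)
  have "km_eq A (Scale c (Add Zero Zero)) (Scale c Zero)" by (intro km_eq.cong_Scale km_eq.add_Zero)
  then show "km_eq A (Add (Scale c Zero) (Scale c Zero)) (Scale c Zero)"
    by (meson km_eq.trans km_eq.sym km_eq.scale_add_right)
qed

lemma km_Bracket_Zero_left: "km_eq A (Bracket Zero x) Zero"
proof (rule km_Zero_if_idem)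
  have "km_eq A (Bracket (Add Zero Zero) x) (Bracket Zero x)"
    by (intro km_eq.cong_Bracket km_eq.add_Zero km_eq.refl)
  then show "km_eq A (Add (Bracket Zero x) (Bracket Zero x)) (Bracket Zero x)"
    by (meson km_eq.trans km_eq.sym km_eq.bracket_add_left)
qed

text \<open>Terms up to \<open>km_eq A\<close> form a Lie algebra that depends on the matrix \<open>A\<close>. A type cannot depend on
  \<open>A\<close>, so the type below is the product of these Lie algebras over all matrices, and
  \<open>component A\<close> embeds the factor at \<open>A\<close>.\<close>

quotient_type 'n km_product = "int ^ 'n ^ 'n \<Rightarrow> ('n::finite) km_term"
  / "\<lambda>x y. \<forall>A. km_eq A (x A) (y A)"
  by (auto intro!: equivpI reflpI sympI transpI intro: km_eq.refl km_eq.sym km_eq.trans)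

instantiation km_product :: (finite) real_vector
begin

lift_definition zero_km_product :: "'a km_product" is "\<lambda>_. Zero" .
lift_definition plus_km_product :: "'a km_product \<Rightarrow> 'a km_product \<Rightarrow> 'a km_product"
  is "\<lambda>x y A. Add (x A) (y A)" by (blast intro: km_eq.cong_Add)
lift_definition uminus_km_product :: "'a km_product \<Rightarrow> 'a km_product"
  is "\<lambda>x A. Scale (- 1) (x A)" by (blast intro: km_eq.cong_Scale)
definition minus_km_product :: "'a km_product \<Rightarrow> 'a km_product \<Rightarrow> 'a km_product" where
  "minus_km_product x y = x + - y"
lift_definition scaleR_km_product :: "real \<Rightarrow> 'a km_product \<Rightarrow> 'a km_product"
  is "\<lambda>r x A. Scale (complex_of_real r) (x A)" by (blast intro: km_eq.cong_Scale)

instance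
proof
  fix x y z :: "'a km_product" and r s :: real
  show "x + y + z = x + (y + z)" by transfer (simp add: km_eq.add_assoc)
  show "x + y = y + x" by transfer (simp add: km_eq.add_commute)
  show "0 + x = x" by transfer (simp add: km_eq.add_Zero)
  show "- x + x = 0" by transfer (meson km_eq.trans km_eq.add_commute km_eq.add_minus)
  show "x - y = x + - y" by (rule minus_km_product_def)
  show "r *\<^sub>R (x + y) = r *\<^sub>R x + r *\<^sub>R y" by transfer (simp add: km_eq.scale_add_right)
  show "(r + s) *\<^sub>R x = r *\<^sub>R x + s *\<^sub>R x" by transfer (simp add: km_eq.scale_add_left)
  show "r *\<^sub>R s *\<^sub>R x = (r * s) *\<^sub>R x" by transfer (simp add: km_eq.scale_scale)
  show "1 *\<^sub>R x = x" by transfer (simp add: km_eq.scale_one)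
qed

end

lift_definition cscale :: "complex \<Rightarrow> 'n::finite km_product \<Rightarrow> 'n km_product"
  is "\<lambda>c x A. Scale c (x A)" by (blast intro: km_eq.cong_Scale)

lift_definition lie :: "'n::finite km_product \<Rightarrow> 'n km_product \<Rightarrow> 'n km_product"
  is "\<lambda>x y A. Bracket (x A) (y A)" by (blast intro: km_eq.cong_Bracket)

lift_definition component :: "int ^ 'n ^ 'n \<Rightarrow> ('n::finite) km_term \<Rightarrow> 'n km_product"
  is "\<lambda>A x A'. if A' = A then x else Zero" .

lemma component_eq_iff: "component A x = component A y \<longleftrightarrow> km_eq A x y"
  by transfer (auto intro: km_eq.refl)

lemma component_eq_0_iff: "component A x = 0 \<longleftrightarrow> km_eq A x Zero"
  by transfer (auto intro: km_eq.refl)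

lemma component_Zero: "component A Zero = 0"
  by (simp add: component_eq_0_iff km_eq.refl)

lemma component_Add: "component A (Add x y) = component A x + component A y"
  by transfer (auto intro: km_eq.refl km_eq.sym[OF km_eq.add_Zero])

lemma component_Scale: "component A (Scale c x) = cscale c (component A x)"
  by transfer (auto intro: km_eq.refl km_eq.sym[OF km_Scale_Zero])

lemma component_Bracket: "component A (Bracket x y) = lie (component A x) (component A y)"
  by transfer (auto intro: km_eq.refl km_eq.sym[OF km_Bracket_Zero_left])

lemma lie_add_left: "lie (x + y) z = lie x z + lie y z"
  by transfer (simp add: km_eq.bracket_add_left)
lemma lie_add_right: "lie x (y + z) = lie x y + lie x z"
  by transfer (simp add: km_eq.bracket_add_right)
lemma lie_cscale_left: "lie (cscale c x) y = cscale c (lie x y)"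
  by transfer (simp add: km_eq.bracket_scale_left)
lemma lie_cscale_right: "lie x (cscale c y) = cscale c (lie x y)"
  by transfer (simp add: km_eq.bracket_scale_right)
lemma lie_self: "lie x x = 0"
  by transfer (simp add: km_eq.bracket_self)
lemma lie_jacobi: "lie x (lie y z) + (lie y (lie z x) + lie z (lie x y)) = 0"
  by transfer (simp add: km_eq.jacobi)
lemma cscale_add_right: "cscale c (x + y) = cscale c x + cscale c y"
  by transfer (simp add: km_eq.scale_add_right)
lemma cscale_add_left: "cscale (c + d) x = cscale c x + cscale d x"
  by transfer (simp add: km_eq.scale_add_left)
lemma cscale_cscale: "cscale c (cscale d x) = cscale (c * d) x"
  by transfer (simp add: km_eq.scale_scale)
lemma scaleR_cscale: "r *\<^sub>R x = cscale (complex_of_real r) x"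
  by transfer (simp add: km_eq.refl)
lemma cscale_minus_one: "cscale (- 1) x = - x"
  by transfer (simp add: km_eq.refl)

section \<open>The structure constants of adjacent simple roots\<close>

lemma cscale_zero_left: "cscale 0 x = 0"
  using cscale_add_left[of 0 0 x] by simp

lemma cscale_zero_right: "cscale c 0 = 0"
  using cscale_add_right[of c 0 0] by simp

lemma cscale_one: "cscale 1 x = x"
  using scaleR_cscale[of 1 x] by simp

lemma cscale_minus_left: "cscale (- c) x = - cscale c x"
  using cscale_cscale[of "- 1" c x] by (simp add: cscale_minus_one)

lemma cscale_minus_right: "cscale c (- x) = - cscale c x"
  using cscale_cscale[of c "- 1" x] cscale_cscale[of "- 1" c x] by (simp add: cscale_minus_one)

lemma cscale_eq_0_iff: "cscale c x = 0 \<longleftrightarrow> c = 0 \<or> x = 0"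
proof
  assume *: "cscale c x = 0"
  show "c = 0 \<or> x = 0"
  proof (cases "c = 0")
    case False
    then have "x = cscale (inverse c) (cscale c x)" by (simp add: cscale_cscale cscale_one)
    then show ?thesis by (simp add: * cscale_zero_right)
  qed simp
qed (auto simp: cscale_zero_left cscale_zero_right)

lemma linear_lie: "linear (lie x)"
  by (rule linearI) (simp_all add: lie_add_right scaleR_cscale lie_cscale_right)

lemmas lie_zero_right = linear_0[OF linear_lie]
  and lie_minus_right = linear_neg[OF linear_lie]

lemma lie_minus_left: "lie (- x) y = - lie x y"
  using lie_cscale_left[of "- 1" x y] by (simp add: cscale_minus_one)

lemma lie_antisym: "lie x y = - lie y x"
proof -
  have "lie (x + y) (x + y) = 0" by (rule lie_self)
  then have "lie x y + lie y x = 0"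
    unfolding lie_add_left lie_add_right by (simp add: lie_self add.commute)
  then show ?thesis by (simp only: eq_neg_iff_add_eq_0)
qed

lemma lie_derivation: "lie x (lie y z) = lie (lie x y) z + lie y (lie x z)"
proof -
  have "lie x (lie y z) = - (lie y (lie z x) + lie z (lie x y))"
    using lie_jacobi[of x y z] by (simp only: eq_neg_iff_add_eq_0)
  then show ?thesis
    using lie_antisym[of z x] lie_antisym[of z "lie x y"] by (simp add: lie_minus_right)
qed

lemma component_funpow_Bracket:
  "component A ((Bracket x ^^ k) y) = (lie (component A x) ^^ k) (component A y)"
  by (induction k) (simp_all add: component_Bracket)

lemma component_foldr_Add:
  "component A (foldr Add (map f xs) Zero) = (\<Sum>x\<leftarrow>xs. component A (f x))"
  by (induction xs) (simp_all add: component_Add component_Zero)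

lemma component_exp_ad:
  "component A (exp_ad A x y) = exp_op (lie (component A x)) (component A y)"
proof -
  have scale: "component A (Scale (1 / fact k) z) = (1 / fact k) *\<^sub>R component A z" for k z
    by (simp add: component_Scale scaleR_cscale)
  show ?thesis
    unfolding exp_ad_def exp_op_def component_foldr_Add interv_sum_list_conv_sum_set_nat
    by (simp add: scale component_funpow_Bracket component_eq_0_iff[symmetric] atLeast0LessThan)
qed

lemma locally_nilpotent_lie_cscale:
  assumes "locally_nilpotent (lie x)"
  shows "locally_nilpotent (lie (cscale c x))"
proof -
  have "(lie (cscale c x) ^^ n) v = cscale (c ^ n) ((lie x ^^ n) v)" for n v
    by (induction n) (simp_all add: cscale_one lie_cscale_left lie_cscale_right cscale_cscale mult.commute)
  then show ?thesis
    using assms unfolding locally_nilpotent_def by (metis cscale_zero_right)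
qed

lemma lie_funpow_Bracket_nilpotent:
  assumes "(lie x ^^ m) y = 0" "(lie x ^^ n) z = 0"
  shows "\<exists>k. (lie x ^^ k) (lie y z) = 0"
  using assms
proof (induction "m + n" arbitrary: m n y z)
  case 0
  then show ?case by (intro exI[of _ 0]) (simp add: lie_zero_right)
next
  case (Suc l)
  have L: "linear (lie x)" by (rule linear_lie)
  have left: "\<exists>k. (lie x ^^ k) (lie (lie x y) z) = 0"
  proof (cases m)
    case 0
    then have "lie (lie x y) z = 0"
      using Suc.prems(1) lie_antisym[of _ z] by (simp add: lie_zero_right)
    then show ?thesis by (intro exI[of _ 0]) simp
  next
    case (Suc m')
    then show ?thesis using Suc.hyps Suc.prems by (intro Suc.hyps(1)[of m' n]) (simp_all add: funpow_swap1)
  qed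
  have right: "\<exists>k. (lie x ^^ k) (lie y (lie x z)) = 0"
  proof (cases n)
    case 0
    then have "lie y (lie x z) = 0" using Suc.prems(2) by (simp add: lie_zero_right)
    then show ?thesis by (intro exI[of _ 0]) simp
  next
    case (Suc n')
    then show ?thesis using Suc.hyps Suc.prems by (intro Suc.hyps(1)[of m n']) (simp_all add: funpow_swap1)
  qed
  obtain k k' where "(lie x ^^ k) (lie (lie x y) z) = 0" "(lie x ^^ k') (lie y (lie x z)) = 0"
    using left right by blast
  then have "(lie x ^^ max k k') (lie (lie x y) z) = 0" "(lie x ^^ max k k') (lie y (lie x z)) = 0"
    by (auto intro: funpow_eq_0_mono[OF L])
  then have "(lie x ^^ max k k') (lie x (lie y z)) = 0"
    by (simp add: lie_derivation[of x y z] linear_add[OF linear_funpow[OF L]])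
  then have "(lie x ^^ Suc (max k k')) (lie y z) = 0" by (simp add: funpow_swap1)
  then show ?case by blast
qed

text \<open>Brackets with an element of one factor see only the component in that factor, so local nilpotency may
  be tested there.\<close>

lemma lie_component_only: "\<exists>y. lie (component A t) v = lie (component A t) (component A y)"
proof -
  have "\<exists>y. \<forall>A'. km_eq A' (Bracket (if A' = A then t else Zero) (f A'))
      (Bracket (if A' = A then t else Zero) (if A' = A then y else Zero))" for f
    by (rule exI[of _ "f A"])
       (auto intro: km_eq.refl km_eq.trans[OF km_Bracket_Zero_left] km_eq.sym[OF km_Bracket_Zero_left])
  then show ?thesis by transfer
qed

text \<open>The elements at which a derivation is locally nilpotent form a Lie subalgebra.\<close>

lemma locally_nilpotent_lie_if_generators:
  fixes A :: "int ^ 'n ^ 'n"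
  assumes e: "\<And>i. \<exists>n. (lie (component A t) ^^ n) (component A (Gen_e i)) = 0"
    and f: "\<And>i. \<exists>n. (lie (component A t) ^^ n) (component A (Gen_f i)) = 0"
    and h: "\<And>i. \<exists>n. (lie (component A t) ^^ n) (component A (Gen_h i)) = 0"
  shows "locally_nilpotent (lie (component A t))"
proof -
  let ?x = "lie (component A t)"
  note L = linear_lie[of "component A t"]
  have all_terms: "\<exists>n. (?x ^^ n) (component A y) = 0" for y
  proof (induction y)
    case Zero
    then show ?case by (intro exI[of _ 0]) (simp add: component_Zero)
  next
    case (Add y z)
    then obtain m n where "(?x ^^ m) (component A y) = 0" "(?x ^^ n) (component A z) = 0" by blast
    then have "(?x ^^ max m n) (component A y) = 0" "(?x ^^ max m n) (component A z) = 0"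
      by (auto intro: funpow_eq_0_mono[OF L])
    then have "(?x ^^ max m n) (component A (Add y z)) = 0"
      by (simp add: component_Add linear_add[OF linear_funpow[OF L]])
    then show ?case by blast
  next
    case (Scale c y)
    have "(?x ^^ n) (cscale c v) = cscale c ((?x ^^ n) v)" for n v
      by (rule funpow_commute) (rule lie_cscale_right)
    then show ?case using Scale by (auto simp: component_Scale cscale_eq_0_iff)
  next
    case (Bracket y z)
    then show ?case unfolding component_Bracket using lie_funpow_Bracket_nilpotent by blast
  qed (use e f h in auto)
  show ?thesis
    unfolding locally_nilpotent_def
  proof
    fix v
    obtain y where y: "?x v = ?x (component A y)" using lie_component_only by blast
    obtain n where "(?x ^^ n) (component A y) = 0" using all_terms by blast
    then have "(?x ^^ Suc n) v = 0" by (simp add: funpow_swap1 y) (simp add: funpow_swap1[symmetric] lie_zero_right)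
    then show "\<exists>n. (?x ^^ n) v = 0" by blast
  qed
qed

context
  fixes A :: "int ^ 'n ^ 'n"
begin

abbreviation "cE i \<equiv> component A (Gen_e i)"
abbreviation "cF i \<equiv> component A (Gen_f i)"
abbreviation "cH i \<equiv> component A (Gen_h i)"

lemma component_relations:
  "lie (cH i) (cE j) = cscale (of_int (A $ i $ j)) (cE j)"
  "lie (cE i) (cF j) = (if i = j then cH i else 0)"
  using km_eq.rel_he[of A i j] km_eq.rel_ef[of A i j]
  by (auto simp: component_eq_iff[symmetric] component_Bracket component_Scale component_Zero split: if_splits)

lemma component_serre: "i \<noteq> j \<Longrightarrow> (lie (cE i) ^^ nat (1 - A $ i $ j)) (cE j) = 0"
  using km_eq.serre_e[of i j A] by (simp add: component_eq_0_iff[symmetric] component_funpow_Bracket)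

lemma locally_nilpotent_lie_e: "locally_nilpotent (lie (cE i))"
proof (rule locally_nilpotent_lie_if_generators)
  have he: "lie (cE i) (cH j) = cscale (- of_int (A $ j $ i)) (cE i)" for j
    using lie_antisym[of "cE i" "cH j"] by (simp add: component_relations cscale_minus_left)
  have h: "(lie (cE i) ^^ 2) (cH j) = 0" for j
    by (simp add: numeral_2_eq_2 he lie_cscale_right lie_self cscale_zero_right)
  then show "\<exists>n. (lie (cE i) ^^ n) (cH j) = 0" for j by blast
  have "(lie (cE i) ^^ 3) (cF j) = 0" for j
    using h by (cases "i = j") (simp_all add: numeral_2_eq_2 numeral_3_eq_3 component_relations lie_zero_right)
  then show "\<exists>n. (lie (cE i) ^^ n) (cF j) = 0" for j by blast
  show "\<exists>n. (lie (cE i) ^^ n) (cE j) = 0" for j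
  proof (cases "j = i")
    case True
    then show ?thesis by (intro exI[of _ 1]) (simp add: lie_self)
  next
    case False
    then show ?thesis using component_serre[of i j] by blast
  qed
qed

lemma exp_op_lie_at_order_two:
  assumes "lie x (lie x y) = 0"
  shows "exp_op (lie x) y = y + lie x y"
proof -
  have "(lie x ^^ 2) y = 0" using assms by (simp add: numeral_2_eq_2)
  then show ?thesis unfolding exp_op_eq[OF linear_lie \<open>(lie x ^^ 2) y = 0\<close>] by (simp add: numeral_2_eq_2)
qed

context
  fixes i j :: 'n
  assumes ij: "i \<noteq> j" "A $ i $ j = - 1" "A $ j $ i = - 1" "A $ i $ i = 2" "A $ j $ j = 2"
begin

abbreviation (input) "eij \<equiv> lie (cE i) (cE j)"

lemma lie_e_z: "lie (cE i) eij = 0" "lie (cE j) eij = 0"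
proof -
  have "(lie (cE i) ^^ 2) (cE j) = 0" "(lie (cE j) ^^ 2) (cE i) = 0"
    using component_serre[of i j] component_serre[of j i] ij by simp_all
  then show "lie (cE i) eij = 0" "lie (cE j) eij = 0"
    using lie_antisym[of "cE i" "cE j"] by (simp_all add: numeral_2_eq_2 lie_minus_right)
qed

lemma lie_h_z: "lie (cH i) eij = eij"
  using ij cscale_add_left[of 2 "- 1" eij]
  by (simp add: lie_derivation[of "cH i"] component_relations lie_cscale_left lie_cscale_right cscale_one)

text \<open>The three exponentials carry \<open>e\<^sub>j\<close> to \<open>e\<^sub>j + [e\<^sub>i, e\<^sub>j]\<close>, then to \<open>[e\<^sub>i, e\<^sub>j]\<close>, which the last one fixes.\<close>

lemma reflection_automorphism_e: "component A (reflection_automorphism A i (Gen_e j)) = eij"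
proof -
  let ?f = "- cF i"
  have fz: "lie ?f eij = - cE j" and fe: "lie ?f (cE j) = 0"
  proof -
    have 1: "lie (cF i) (cE j) = 0"
      using lie_antisym[of "cF i" "cE j"] ij by (simp add: component_relations)
    then show "lie ?f (cE j) = 0" by (simp add: lie_minus_left)
    have "lie (cF i) (cE i) = - cH i"
      using lie_antisym[of "cF i" "cE i"] by (simp add: component_relations)
    then have "lie (cF i) eij = - lie (cH i) (cE j)"
      using 1 by (simp add: lie_derivation[of "cF i"] lie_zero_right lie_minus_left)
    also have "\<dots> = cE j" using ij by (simp add: component_relations cscale_minus_one)
    finally show "lie ?f eij = - cE j" by (simp add: lie_minus_left)
  qed
  have "component A (reflection_automorphism A i (Gen_e j))
      = exp_op (lie (cE i)) (exp_op (lie ?f) (exp_op (lie (cE i)) (cE j)))"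
    by (simp add: reflection_automorphism_def component_exp_ad component_Scale cscale_minus_one)
  also have "exp_op (lie (cE i)) (cE j) = cE j + eij"
    by (rule exp_op_lie_at_order_two) (rule lie_e_z)
  also have "exp_op (lie ?f) (cE j + eij) = cE j + eij - cE j"
    using exp_op_lie_at_order_two[of ?f "cE j + eij"] fz fe by (simp add: lie_add_right lie_minus_right)
  also have "exp_op (lie (cE i)) (cE j + eij - cE j) = eij"
    using exp_op_lie_at_order_two[of "cE i" eij] by (simp add: lie_e_z lie_zero_right)
  finally show ?thesis .
qed

lemma exp_op_lie_commutator:
  "exp_op (lie (cscale r (cE i))) (exp_op (lie (cscale s (cE j)))
     (exp_op (lie (cscale (- r) (cE i))) (exp_op (lie (cscale (- s) (cE j))) y)))
   = exp_op (lie (cscale (r * s) eij)) y"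
proof -
  interpret heisenberg_operators "lie (cscale r (cE i))" "lie (cscale s (cE j))" "lie (cscale (r * s) eij)"
  proof (rule heisenberg_operators.intro)
    have l: "lie (cscale r (cE i)) (cscale (r * s) eij) = 0" "lie (cscale s (cE j)) (cscale (r * s) eij) = 0"
      by (simp_all add: lie_cscale_left lie_cscale_right lie_e_z cscale_zero_right)
    show "lie (cscale r (cE i)) (lie (cscale (r * s) eij) v) = lie (cscale (r * s) eij) (lie (cscale r (cE i)) v)"
      "lie (cscale s (cE j)) (lie (cscale (r * s) eij) v) = lie (cscale (r * s) eij) (lie (cscale s (cE j)) v)" for v
      using lie_antisym[of 0 v] by (simp_all add: lie_derivation[of "cscale _ (component A _)"] l lie_zero_right)
    show "lie (cscale r (cE i)) (lie (cscale s (cE j)) v)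
        = lie (cscale s (cE j)) (lie (cscale r (cE i)) v) + lie (cscale (r * s) eij) v" for v
      by (simp add: lie_derivation[of "cscale r (cE i)"])
         (simp add: lie_cscale_left lie_cscale_right cscale_cscale mult.commute)
  qed (intro linear_lie locally_nilpotent_lie_cscale locally_nilpotent_lie_e)+
  have m: "lie (cscale (- c) x) = (\<lambda>v. - lie (cscale c x) v)" for c x
    by (simp add: fun_eq_iff cscale_minus_left lie_minus_left)
  show ?thesis unfolding m by (rule exp_op_commutator)
qed

end

end

text \<open>The root vector of \<open>\<alpha>\<^sub>i + \<alpha>\<^sub>j\<close> in a Chevalley system is \<open>\<epsilon> [e\<^sub>i, e\<^sub>j]\<close> with a sign \<open>\<epsilon>\<close>, because a reflection
  automorphism carries \<open>e\<^sub>j\<close> to \<open>[e\<^sub>i, e\<^sub>j]\<close>. The Heisenberg commutator formula shows that \<open>\<epsilon>\<close> is a possible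
  structure constant. It is the only one: for a structure constant \<open>C\<close>, evaluating the commutator formula
  at \<open>h\<^sub>i\<close>, with \<open>[[e\<^sub>i, e\<^sub>j], h\<^sub>i] = - [e\<^sub>i, e\<^sub>j]\<close>, gives \<open>C \<epsilon> = 1\<close>, as the root vector does not
  vanish.\<close>

lemma structure_constant_simple_pair:
  fixes A :: "int ^ 'n ^ 'n" and e :: "int ^ 'n \<Rightarrow> 'n km_term"
  assumes sys: "chevalley_system A e"
    and ij: "i \<noteq> j" "A $ i $ j = - 1" "A $ j $ i = - 1" "A $ i $ i = 2" "A $ j $ j = 2"
    and refl_j: "simple_reflection A i (simple_root j) = simple_root i + simple_root j"
    and root: "simple_root j \<in> real_roots A" "simple_root i + simple_root j \<in> real_roots A"
    and indices: "commutator_indices A (simple_root i) (simple_root j) = [(1, 1)]"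
  shows "structure_constants A e (simple_root i) (simple_root j) (1, 1) \<in> {1, - 1}"
proof -
  let ?c = "component A" and ?\<alpha> = "simple_root i" and ?\<beta> = "simple_root j"
  let ?z = "lie (?c (Gen_e i)) (?c (Gen_e j))"
  have gen: "?c (e (simple_root k)) = ?c (Gen_e k)" for k
    using sys unfolding chevalley_system_def component_eq_iff by blast
  define w where "w = ?c (e (?\<alpha> + ?\<beta>))"
  have w0: "w \<noteq> 0" using sys root(2) unfolding w_def chevalley_system_def component_eq_0_iff by blast
  have "?c (reflection_automorphism A i (e ?\<beta>)) = w \<or> ?c (reflection_automorphism A i (e ?\<beta>)) = cscale (- 1) w"
    using sys root(1) unfolding chevalley_system_def component_eq_iff[symmetric] component_Scale w_def refl_j[symmetric]
    by blast
  moreover have "?c (reflection_automorphism A i (e ?\<beta>)) = ?c (reflection_automorphism A i (Gen_e j))"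
    by (simp add: reflection_automorphism_def component_exp_ad gen)
  ultimately have "?z = w \<or> ?z = - w"
    unfolding reflection_automorphism_e[OF ij] cscale_minus_one by simp
  then obtain \<epsilon> :: int where \<epsilon>: "\<epsilon> = 1 \<or> \<epsilon> = - 1" and zw: "w = cscale (of_int \<epsilon>) ?z"
    by (metis cscale_minus_one cscale_one minus_minus of_int_1 of_int_minus)
  let ?P = "\<lambda>C. \<forall>r s y. km_eq A
      (exp_ad A (Scale r (e ?\<alpha>)) (exp_ad A (Scale s (e ?\<beta>))
         (exp_ad A (Scale (- r) (e ?\<alpha>)) (exp_ad A (Scale (- s) (e ?\<beta>)) y))))
      (foldr (\<lambda>ij. exp_ad A (Scale (of_int (C ij) * r ^ fst ij * s ^ snd ij) (e (int_comb ?\<alpha> ?\<beta> ij))))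
         (commutator_indices A ?\<alpha> ?\<beta>) y)"
  have comb: "int_comb ?\<alpha> ?\<beta> (1, 1) = ?\<alpha> + ?\<beta>" by (simp add: int_comb_def)
  have P_iff: "?P C \<longleftrightarrow> (\<forall>r s y. exp_op (lie (cscale (r * s) ?z)) (?c y)
      = exp_op (lie (cscale (of_int (C (1, 1)) * r * s) w)) (?c y))" for C
    unfolding indices component_eq_iff[symmetric] foldr.simps comp_apply id_apply fst_conv snd_conv comb
      power_one_right component_exp_ad component_Scale gen exp_op_lie_commutator[OF ij] w_def by (rule HOL.refl)
  have "?P (\<lambda>_. \<epsilon>)"
    unfolding P_iff zw using \<epsilon> by (auto simp: cscale_cscale)
  then have "?P (structure_constants A e ?\<alpha> ?\<beta>)"
    unfolding structure_constants_def by (rule someI[where P = ?P])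
  moreover define C where "C = structure_constants A e ?\<alpha> ?\<beta> (1, 1)"
  ultimately have "exp_op (lie (cscale (1 * 1) ?z)) (?c (Gen_h i)) = exp_op (lie (cscale (of_int C * 1 * 1) w)) (?c (Gen_h i))"
    unfolding P_iff by blast
  moreover have exp_h: "exp_op (lie (cscale a ?z)) (?c (Gen_h i)) = ?c (Gen_h i) - cscale a ?z" for a
  proof -
    have "lie ?z (?c (Gen_h i)) = - ?z" using lie_antisym[of ?z "?c (Gen_h i)"] lie_h_z[OF ij] by simp
    then have 1: "lie (cscale a ?z) (?c (Gen_h i)) = - cscale a ?z"
      by (simp add: lie_cscale_left cscale_minus_right)
    show ?thesis
      using exp_op_lie_at_order_two[of "cscale a ?z" "?c (Gen_h i)"] unfolding 1
      by (simp add: lie_minus_right lie_self)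
  qed
  ultimately have "?z = cscale (of_int C * of_int \<epsilon>) ?z"
    unfolding zw cscale_cscale exp_h by (simp add: cscale_one)
  then have "cscale (1 + - (of_int C * of_int \<epsilon>)) ?z = 0"
    by (simp only: cscale_add_left cscale_one cscale_minus_left) simp
  moreover have "?z \<noteq> 0" using w0 zw by (auto simp: cscale_zero_right)
  ultimately have "of_int (C * \<epsilon>) = (1 :: complex)" by (simp add: cscale_eq_0_iff)
  then have "C * \<epsilon> = 1" by (simp only: of_int_eq_1_iff)
  then show ?thesis using \<epsilon> unfolding C_def by auto
qed

section \<open>Simple reflections and the Weyl group\<close>

lemma coroot_value_sum: "coroot_value A \<beta> i = (\<Sum>k\<in>UNIV. A $ i $ k * \<beta> $ k)"
  by (simp add: coroot_value_def matrix_vector_mult_def)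

lemma coroot_value_add: "coroot_value A (x + y) i = coroot_value A x i + coroot_value A y i"
  by (simp add: coroot_value_sum algebra_simps sum.distrib)

lemma coroot_value_scale: "coroot_value A (c *s x) i = c * coroot_value A x i"
  by (simp add: coroot_value_sum sum_distrib_left algebra_simps)

lemma coroot_value_minus: "coroot_value A (- x) i = - coroot_value A x i"
  by (simp add: coroot_value_sum sum_negf)

lemma coroot_value_diff: "coroot_value A (x - y) i = coroot_value A x i - coroot_value A y i"
  using coroot_value_add[of A x "- y" i] by (simp add: coroot_value_minus)

lemma coroot_value_simple_root: "coroot_value A (simple_root j) i = A $ i $ j"
  by (simp add: coroot_value_sum simple_root_def axis_def if_distrib cong: if_cong)

lemmas coroot_value_simps = coroot_value_add coroot_value_scale coroot_value_minus coroot_value_diff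
  coroot_value_simple_root

lemma simple_reflection_add: "simple_reflection A i (x + y) = simple_reflection A i x + simple_reflection A i y"
  by (simp add: simple_reflection_def coroot_value_simps vec_eq_iff algebra_simps)

lemma simple_reflection_minus: "simple_reflection A i (- x) = - simple_reflection A i x"
  by (simp add: simple_reflection_def coroot_value_simps vec_eq_iff algebra_simps)

lemma simple_reflection_diff: "simple_reflection A i (x - y) = simple_reflection A i x - simple_reflection A i y"
  by (simp add: simple_reflection_def coroot_value_simps vec_eq_iff algebra_simps)

lemma simple_reflection_involution:
  assumes "A $ i $ i = 2"
  shows "simple_reflection A i (simple_reflection A i x) = x"
  using assms by (simp add: simple_reflection_def coroot_value_simps vec_eq_iff algebra_simps)

lemma simple_reflection_commute:
  assumes "A $ i $ j = 0" "A $ j $ i = 0"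
  shows "simple_reflection A i \<circ> simple_reflection A j = simple_reflection A j \<circ> simple_reflection A i"
  using assms by (simp add: simple_reflection_def coroot_value_simps vec_eq_iff fun_eq_iff algebra_simps)

lemma simple_reflection_braid:
  assumes "A $ i $ j = - 1" "A $ j $ i = - 1" "A $ i $ i = 2" "A $ j $ j = 2"
  shows "simple_reflection A i \<circ> simple_reflection A j \<circ> simple_reflection A i
    = simple_reflection A j \<circ> simple_reflection A i \<circ> simple_reflection A j"
  using assms by (simp add: simple_reflection_def coroot_value_simps vec_eq_iff fun_eq_iff algebra_simps)

lemma weyl_group_add: "w \<in> weyl_group A \<Longrightarrow> w (x + y) = w x + w y"
  by (induction rule: weyl_group.induct) (auto simp: simple_reflection_add)

lemma weyl_group_minus: "w \<in> weyl_group A \<Longrightarrow> w (- x) = - w x"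
  by (induction rule: weyl_group.induct) (auto simp: simple_reflection_minus)

lemma weyl_group_comp:
  assumes "w \<in> weyl_group A" "u \<in> weyl_group A" shows "w \<circ> u \<in> weyl_group A"
  using assms(1)
proof (induction rule: weyl_group.induct)
  case (step w i)
  then show ?case using weyl_group.step[of "w \<circ> u" A i] by (simp only: comp_assoc)
qed (use assms(2) in \<open>simp only: id_comp\<close>)

lemma simple_reflection_in_weyl_group: "simple_reflection A i \<in> weyl_group A"
  using weyl_group.step[OF weyl_group.one, of A i] by (simp only: comp_id)

lemma weyl_group_inverse:
  assumes A: "\<And>i. A $ i $ i = 2" and "w \<in> weyl_group A"
  shows "\<exists>u \<in> weyl_group A. \<forall>x. u (w x) = x"
  using assms(2)
proof (induction rule: weyl_group.induct)
  case one
  then show ?case by (auto intro: bexI[of _ id] weyl_group.one)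
next
  case (step w i)
  then obtain u where u: "u \<in> weyl_group A" "\<forall>x. u (w x) = x" by blast
  show ?case
  proof (rule bexI)
    show "u \<circ> simple_reflection A i \<in> weyl_group A"
      by (rule weyl_group_comp[OF u(1) simple_reflection_in_weyl_group])
    show "\<forall>x. (u \<circ> simple_reflection A i) ((simple_reflection A i \<circ> w) x) = x"
      by (simp add: simple_reflection_involution[OF A] u(2))
  qed
qed

lemma weyl_group_real_roots:
  assumes "w \<in> weyl_group A" "\<alpha> \<in> real_roots A" shows "w \<alpha> \<in> real_roots A"
proof -
  obtain u i where u: "u \<in> weyl_group A" "\<alpha> = u (simple_root i)"
    using assms(2) unfolding real_roots_def by blast
  then have "w \<alpha> = (w \<circ> u) (simple_root i)" by simp
  then show ?thesis using weyl_group_comp[OF assms(1) u(1)] unfolding real_roots_def by blast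
qed

lemma simple_root_in_real_roots: "simple_root i \<in> real_roots A"
  unfolding real_roots_def using weyl_group.one[of A]
  by (intro CollectI exI[of _ id] exI[of _ i] conjI) simp_all

lemma simple_root_in_positive_real_roots: "simple_root i \<in> positive_real_roots A"
  by (simp add: positive_real_roots_def simple_root_in_real_roots) (simp add: simple_root_def axis_def)

lemma simple_reflection_simple_root:
  "simple_reflection A i (simple_root j) = simple_root j - A $ i $ j *s simple_root i"
  by (simp add: simple_reflection_def coroot_value_simps)

lemma simple_reflection_self:
  "A $ i $ i = 2 \<Longrightarrow> simple_reflection A i (simple_root i) = - simple_root i"
  by (simp add: simple_reflection_simple_root vec_eq_iff)

lemma simple_reflection_adjacent:
  "A $ i $ j = - 1 \<Longrightarrow> simple_reflection A i (simple_root j) = simple_root i + simple_root j"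
  by (simp add: simple_reflection_simple_root vec_eq_iff)

section \<open>Length in the Weyl group\<close>

primrec reflections :: "int ^ 'n ^ 'n \<Rightarrow> 'n list \<Rightarrow> int ^ 'n \<Rightarrow> int ^ 'n" where
  "reflections A [] = id"
| "reflections A (i # is) = simple_reflection A i \<circ> reflections A is"

definition weyl_length :: "int ^ 'n ^ 'n \<Rightarrow> (int ^ 'n \<Rightarrow> int ^ 'n) \<Rightarrow> nat" where
  "weyl_length A w = (LEAST n. \<exists>is. length is = n \<and> w = reflections A is)"

lemma weyl_length_le: "weyl_length A (reflections A is) \<le> length is"
  unfolding weyl_length_def by (rule Least_le) blast

lemma reflections_in_weyl_group: "reflections A is \<in> weyl_group A"
  by (induction "is") (simp_all only: reflections.simps weyl_group.intros)

lemma reduced_word: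
  assumes "w \<in> weyl_group A"
  obtains "is" where "w = reflections A is" "length is = weyl_length A w"
proof -
  have "\<exists>is. w = reflections A is"
    using assms
  proof (induction rule: weyl_group.induct)
    case one
    show ?case by (rule exI[of _ "[]"]) (simp only: reflections.simps)
  next
    case (step w i)
    then obtain "is" where "w = reflections A is" by blast
    then show ?case by (intro exI[of _ "i # is"]) (simp only: reflections.simps)
  qed
  then have "\<exists>n is. length is = n \<and> w = reflections A is" by blast
  then have "\<exists>is. length is = weyl_length A w \<and> w = reflections A is"
    unfolding weyl_length_def by (rule LeastI_ex)
  then show ?thesis using that by blast
qed

lemma reflections_snoc: "reflections A (is @ [i]) = reflections A is \<circ> simple_reflection A i"
  by (induction "is") (simp_all only: append.simps reflections.simps comp_assoc comp_id id_comp)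

lemma weyl_length_comp_reflection_le:
  assumes "w \<in> weyl_group A"
  shows "weyl_length A (w \<circ> simple_reflection A i) \<le> Suc (weyl_length A w)"
proof -
  obtain "is" where "is": "w = reflections A is" "length is = weyl_length A w"
    using reduced_word[OF assms] .
  then have "w \<circ> simple_reflection A i = reflections A (is @ [i])"
    by (simp only: reflections_snoc)
  then show ?thesis using weyl_length_le[of A "is @ [i]"] "is"(2) by simp
qed

lemma weyl_length_decrease:
  assumes "w \<in> weyl_group A"
  obtains "w = id" | u j where "u \<in> weyl_group A" "w = u \<circ> simple_reflection A j" "weyl_length A w = Suc (weyl_length A u)"
proof -
  obtain "is" where "is": "w = reflections A is" "length is = weyl_length A w"
    using reduced_word[OF assms] .
  show ?thesis
  proof (cases "is" rule: rev_cases)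
    case Nil
    then show ?thesis using that(1) "is"(1) by (simp only: reflections.simps)
  next
    case (snoc js j)
    let ?u = "reflections A js"
    have w: "w = ?u \<circ> simple_reflection A j" using "is"(1) snoc by (simp only: reflections_snoc)
    have "weyl_length A w \<le> Suc (weyl_length A ?u)"
      unfolding w by (rule weyl_length_comp_reflection_le[OF reflections_in_weyl_group])
    moreover have "Suc (weyl_length A ?u) \<le> weyl_length A w"
      using weyl_length_le[of A js] "is"(2) snoc by simp
    ultimately show ?thesis using that(2)[OF reflections_in_weyl_group w] by simp
  qed
qed

section \<open>Positive real roots of simply laced matrices\<close>

locale simply_laced =
  fixes A :: "int ^ 'n ^ 'n"
  assumes cartan: "generalized_cartan_matrix A"
    and entries: "i \<noteq> j \<Longrightarrow> A $ i $ j = 0 \<or> A $ i $ j = - 1"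
begin

abbreviation "s \<equiv> simple_reflection A"
abbreviation "\<alpha> \<equiv> simple_root"
abbreviation "len \<equiv> weyl_length A"

lemma diag: "A $ i $ i = 2"
  using cartan unfolding generalized_cartan_matrix_def by blast

lemma symmetric: "A $ i $ j = A $ j $ i"
  using cartan entries[of i j] entries[of j i] unfolding generalized_cartan_matrix_def by (metis)

lemma adjacent_cases:
  assumes "i \<noteq> j"
  obtains "A $ i $ j = 0" "A $ j $ i = 0" | "A $ i $ j = - 1" "A $ j $ i = - 1"
  using entries[OF assms] symmetric[of i j] by metis

lemma reflection_cancel: "w \<circ> s i \<circ> s i = w"
  by (simp add: fun_eq_iff simple_reflection_involution[OF diag])

text \<open>If \<open>w s\<^sub>i\<close> is no shorter than \<open>w\<close>, the root \<open>w \<alpha>\<^sub>i\<close> is built from simple roots by adding adjacent pairs.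
  The induction is on the length of \<open>w = u s\<^sub>j\<close>. If \<open>s\<^sub>i\<close> and \<open>s\<^sub>j\<close> commute, \<open>w \<alpha>\<^sub>i = u \<alpha>\<^sub>i\<close>. Otherwise
  \<open>w \<alpha>\<^sub>i = u \<alpha>\<^sub>i + u \<alpha>\<^sub>j\<close>, and both summands come from the shorter \<open>u\<close> unless \<open>u\<close> descends at \<open>s\<^sub>i\<close>; then
  \<open>w = v s\<^sub>i s\<^sub>j\<close> with a still shorter \<open>v\<close>, and \<open>w \<alpha>\<^sub>i = v \<alpha>\<^sub>j\<close>. The braid relation transports the
  length condition to \<open>v\<close>.\<close>

lemma ascending_root:
  assumes simple: "\<And>i. P (\<alpha> i)"
    and sum: "\<And>w i j. w \<in> weyl_group A \<Longrightarrow> A $ i $ j = - 1 \<Longrightarrow> P (w (\<alpha> i)) \<Longrightarrow> P (w (\<alpha> j))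
      \<Longrightarrow> P (w (\<alpha> i + \<alpha> j))"
    and w: "w \<in> weyl_group A" "len w \<le> len (w \<circ> s i)"
  shows "P (w (\<alpha> i))"
  using w
proof (induction "len w" arbitrary: w i rule: less_induct)
  case less
  note W = weyl_group_comp[OF _ simple_reflection_in_weyl_group]
  show ?case
    using less.prems(1)
  proof (cases rule: weyl_length_decrease)
    case 1
    then show ?thesis using simple by simp
  next
    case (2 u j)
    note IH = less.hyps
    have ij: "i \<noteq> j"
    proof
      assume "i = j"
      then have "w \<circ> s i = u" using 2 by (simp only: reflection_cancel)
      then show False using less.prems(2) 2 by simp
    qed
    have le: "len (x \<circ> s k) \<le> Suc (len x)" if "x \<in> weyl_group A" for x k
      by (rule weyl_length_comp_reflection_le[OF that])
    from ij show ?thesis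
    proof (cases rule: adjacent_cases)
      case 1
      have "w \<circ> s i = (u \<circ> s i) \<circ> s j"
        unfolding 2(2) comp_assoc simple_reflection_commute[OF 1] ..
      then have "len u \<le> len (u \<circ> s i)"
        using le[OF W[OF 2(1)], of i j] less.prems(2) 2(3) by simp
      then have "P (u (\<alpha> i))" using IH[OF _ 2(1)] 2(3) by simp
      moreover have "w (\<alpha> i) = u (\<alpha> i)" unfolding 2(2) using 1 by (simp add: simple_reflection_simple_root vec_eq_iff)
      ultimately show ?thesis by simp
    next
      case adj: 2
      have sji: "s j (\<alpha> i) = \<alpha> i + \<alpha> j"
        by (simp add: simple_reflection_adjacent[OF adj(2)] add.commute)
      show ?thesis
      proof (cases "len u \<le> len (u \<circ> s i)")
        case True
        have "P (u (\<alpha> i))" using IH[OF _ 2(1) True] 2(3) by simp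
        moreover have "P (u (\<alpha> j))" using IH[OF _ 2(1), of j] 2(2,3) by simp
        ultimately have "P (u (\<alpha> i + \<alpha> j))" by (rule sum[OF 2(1) adj(1)])
        then show ?thesis unfolding 2(2) by (simp add: sji)
      next
        case False
        let ?v = "u \<circ> s i"
        have v: "?v \<in> weyl_group A" by (rule W[OF 2(1)])
        have u: "u = ?v \<circ> s i" by (simp only: reflection_cancel)
        have "w \<circ> s i = ?v \<circ> (s i \<circ> s j \<circ> s i)"
          unfolding 2(2) by (subst u) (simp only: comp_assoc)
        also have "\<dots> = (?v \<circ> s j) \<circ> s i \<circ> s j"
          unfolding simple_reflection_braid[OF adj diag diag] by (simp only: comp_assoc)
        finally have "len ?v \<le> len (?v \<circ> s j)"
          using le[OF W[OF W[OF v]], of j i j] le[OF W[OF v], of j i] less.prems(2) 2(3) False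
          by simp
        then have "P (?v (\<alpha> j))" using IH[OF _ v] False 2(3) by simp
        moreover have "w (\<alpha> i) = ?v (\<alpha> j)"
        proof -
          have "w (\<alpha> i) = ?v (s i (s j (\<alpha> i)))"
            unfolding 2(2) by (simp add: simple_reflection_involution[OF diag])
          also have "s i (s j (\<alpha> i)) = \<alpha> j"
            unfolding sji by (simp add: simple_reflection_add simple_reflection_self[OF diag]
                simple_reflection_adjacent[OF adj(1)])
          finally show ?thesis .
        qed
        ultimately show ?thesis by simp
      qed
    qed
  qed
qed

text \<open>For \<open>\<beta> = w \<alpha>\<^sub>i\<close> with \<open>w s\<^sub>i\<close> shorter than \<open>w\<close>, the previous lemma applies to \<open>w s\<^sub>i\<close> and makes
  \<open>- \<beta>\<close> positive, so only the ascending case occurs. The summands are translates of adjacent simple roots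
  because those are prenilpotent. Splitting off a multiple \<open>m \<alpha>\<^sub>j\<close> of a simple root by a reflection would
  leave pairs \<open>\<beta> - m \<alpha>\<^sub>j, \<alpha>\<^sub>j\<close> that need not be.\<close>

lemma positive_real_root_induct [consumes 1, case_names simple sum]:
  assumes \<beta>: "\<beta> \<in> positive_real_roots A"
    and simple: "\<And>i. P (\<alpha> i)"
    and sum: "\<And>w i j. w \<in> weyl_group A \<Longrightarrow> A $ i $ j = - 1
      \<Longrightarrow> w (\<alpha> i) \<in> positive_real_roots A \<Longrightarrow> w (\<alpha> j) \<in> positive_real_roots A
      \<Longrightarrow> P (w (\<alpha> i)) \<Longrightarrow> P (w (\<alpha> j)) \<Longrightarrow> P (w (\<alpha> i + \<alpha> j))"
  shows "P \<beta>"
proof -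
  let ?P = "\<lambda>\<beta>. \<beta> \<in> positive_real_roots A \<and> P \<beta>"
  have ascent: "?P (w (\<alpha> i))" if "w \<in> weyl_group A" "len w \<le> len (w \<circ> s i)" for w i
  proof (rule ascending_root[where P = ?P, OF _ _ that])
    show "?P (\<alpha> i)" for i using simple simple_root_in_positive_real_roots by blast
    fix u i j assume u: "u \<in> weyl_group A" "A $ i $ j = - 1" "?P (u (\<alpha> i))" "?P (u (\<alpha> j))"
    have "u (\<alpha> i + \<alpha> j) \<in> real_roots A"
      using weyl_group_real_roots[OF u(1) weyl_group_real_roots[OF simple_reflection_in_weyl_group simple_root_in_real_roots]]
      by (metis simple_reflection_adjacent[OF u(2)])
    moreover have "0 \<le> u (\<alpha> i + \<alpha> j) $ k" for k
      using u by (simp add: weyl_group_add positive_real_roots_def)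
    ultimately show "?P (u (\<alpha> i + \<alpha> j))"
      using sum[OF u(1,2)] u(3,4) by (simp add: positive_real_roots_def)
  qed
  obtain w i where w: "w \<in> weyl_group A" "\<beta> = w (\<alpha> i)"
    using \<beta> unfolding positive_real_roots_def real_roots_def by blast
  show ?thesis
  proof (cases "len w \<le> len (w \<circ> s i)")
    case True
    then show ?thesis using ascent[OF w(1)] w(2) by blast
  next
    case False
    let ?u = "w \<circ> s i"
    have u: "?u \<in> weyl_group A" by (rule weyl_group_comp[OF w(1) simple_reflection_in_weyl_group])
    have "?u (\<alpha> i) \<in> positive_real_roots A"
      using ascent[OF u, of i] False by (simp add: reflection_cancel)
    then have "0 \<le> (- \<beta>) $ k" for k
      using w by (simp add: positive_real_roots_def simple_reflection_self[OF diag] weyl_group_minus)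
    then have "\<beta> = 0"
      using \<beta> by (simp add: positive_real_roots_def vec_eq_iff) (meson antisym)
    moreover obtain v where "\<forall>x. v (w x) = x" "v \<in> weyl_group A" using weyl_group_inverse[OF diag w(1)] by blast
    ultimately have "\<alpha> i = 0" using w(2) weyl_group_add[of v A 0 0] by (metis add_0 add_cancel_right_left)
    then show ?thesis by (simp add: simple_root_def vec_eq_iff axis_def split: if_splits)
  qed
qed

text \<open>The Weyl-invariant quadratic form of the symmetric matrix \<open>A\<close>. Its value is \<open>2\<close> at every real root, which
  determines the real roots that are combinations of two simple roots.\<close>

definition "root_norm \<beta> = (\<Sum>k\<in>UNIV. \<beta> $ k * coroot_value A \<beta> k)"

lemma root_norm_diff_simple: "root_norm (\<beta> - c *s \<alpha> i) = root_norm \<beta> - 2 * c * coroot_value A \<beta> i + 2 * c\<^sup>2"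
proof -
  have "(\<Sum>k\<in>UNIV. \<beta> $ k * A $ k $ i) = coroot_value A \<beta> i"
    unfolding coroot_value_sum by (intro sum.cong HOL.refl) (simp add: symmetric[of i] mult.commute)
  moreover have "(\<Sum>k\<in>UNIV. \<alpha> i $ k * f k) = f i" for f :: "'n \<Rightarrow> int"
    by (simp add: simple_root_def axis_def if_distrib[of "\<lambda>x. x * _"] cong: if_cong)
  moreover have "root_norm (\<beta> - c *s \<alpha> i) = (\<Sum>k\<in>UNIV. \<beta> $ k * coroot_value A \<beta> k) - c * (\<Sum>k\<in>UNIV. \<beta> $ k * A $ k $ i)
     - c * (\<Sum>k\<in>UNIV. \<alpha> i $ k * coroot_value A \<beta> k) + c * c * (\<Sum>k\<in>UNIV. \<alpha> i $ k * A $ k $ i)"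
    unfolding root_norm_def coroot_value_simps sum_distrib_left sum_subtractf[symmetric] sum.distrib[symmetric]
    by (intro sum.cong HOL.refl) (simp add: algebra_simps)
  ultimately show ?thesis by (simp add: root_norm_def diag power2_eq_square)
qed

lemma root_norm_real_root: "\<beta> \<in> real_roots A \<Longrightarrow> root_norm \<beta> = 2"
proof -
  assume "\<beta> \<in> real_roots A"
  then obtain w i where w: "w \<in> weyl_group A" "\<beta> = w (\<alpha> i)" unfolding real_roots_def by blast
  have "root_norm (w x) = root_norm x" for x
    using w(1)
  proof (induction rule: weyl_group.induct)
    case (step w i)
    have "root_norm (s i (w x)) = root_norm (w x)"
      unfolding simple_reflection_def root_norm_diff_simple by (simp add: power2_eq_square)
    then show ?case using step by simp
  qed simp
  moreover have "root_norm (0 - (- 1) *s \<alpha> i) = 2"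
    unfolding root_norm_diff_simple by (simp add: root_norm_def coroot_value_sum)
  moreover have "0 - (- 1) *s \<alpha> i = \<alpha> i" by (simp add: vec_eq_iff)
  ultimately show ?thesis using w(2) by simp
qed

lemma root_norm_pair:
  "root_norm (a *s \<alpha> i + b *s \<alpha> j) = 2 * a\<^sup>2 + 2 * b\<^sup>2 + 2 * a * b * A $ i $ j"
proof -
  \<comment> \<open>The combination is reached from \<open>0\<close> by two applications of the difference formula.\<close>
  have "root_norm (0 - (- a) *s \<alpha> i - (- b) *s \<alpha> j) = 2 * a\<^sup>2 + 2 * b\<^sup>2 + 2 * a * b * A $ i $ j"
    unfolding root_norm_diff_simple coroot_value_simps
    by (simp add: root_norm_def coroot_value_sum[of A 0] symmetric[of j i])
  moreover have "0 - (- a) *s \<alpha> i - (- b) *s \<alpha> j = a *s \<alpha> i + b *s \<alpha> j" by (simp add: vec_eq_iff)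
  ultimately show ?thesis by simp
qed

lemma commutator_indices_eq:
  assumes "{ij. 1 \<le> fst ij \<and> 1 \<le> snd ij \<and> int_comb \<beta> \<gamma> ij \<in> real_roots A} = set xs" "distinct xs" "length xs \<le> 1"
  shows "commutator_indices A \<beta> \<gamma> = xs"
  unfolding commutator_indices_def assms(1)
proof (rule some_equality)
  show "distinct xs \<and> set xs = set xs" using assms(2) by simp
  fix ys assume "distinct ys \<and> set ys = set xs"
  moreover from this have "length ys = length xs" using assms(2) by (metis distinct_card)
  ultimately show "ys = xs" using assms(3) by (cases xs; cases ys) auto
qed

lemma commutator_indices_orthogonal:
  assumes "A $ i $ j = 0"
  shows "commutator_indices A (\<alpha> i) (\<alpha> j) = []"
proof (rule commutator_indices_eq)
  have "False" if "1 \<le> a" "1 \<le> b" "int a *s \<alpha> i + int b *s \<alpha> j \<in> real_roots A" for a b :: nat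
  proof -
    have "(int a)\<^sup>2 + (int b)\<^sup>2 = 1" using root_norm_real_root[OF that(3)] assms by (simp add: root_norm_pair)
    moreover have "1 \<le> (int a)\<^sup>2" "1 \<le> (int b)\<^sup>2" using that by (simp_all add: one_le_power)
    ultimately show False by simp
  qed
  then show "{ij. 1 \<le> fst ij \<and> 1 \<le> snd ij \<and> int_comb (\<alpha> i) (\<alpha> j) ij \<in> real_roots A} = set []"
    by (auto simp: int_comb_def)
qed simp_all

lemma adjacent_sum_real_root: "A $ i $ j = - 1 \<Longrightarrow> \<alpha> i + \<alpha> j \<in> real_roots A"
  using weyl_group_real_roots[OF simple_reflection_in_weyl_group simple_root_in_real_roots, of A i j]
  by (simp add: simple_reflection_adjacent)

lemma commutator_indices_adjacent:
  assumes "A $ i $ j = - 1"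
  shows "commutator_indices A (\<alpha> i) (\<alpha> j) = [(1, 1)]"
proof (rule commutator_indices_eq)
  have "a = 1 \<and> b = 1" if "1 \<le> a" "1 \<le> b" "int a *s \<alpha> i + int b *s \<alpha> j \<in> real_roots A" for a b :: nat
  proof -
    have "(int a)\<^sup>2 + (int b)\<^sup>2 - int a * int b = 1"
      using root_norm_real_root[OF that(3)] assms by (simp add: root_norm_pair)
    then have *: "(int a - int b)\<^sup>2 + int a * int b = 1" by (simp add: power2_eq_square algebra_simps)
    have "int a * int b \<le> 1" using * zero_le_power2[of "int a - int b"] by linarith
    then have "a * b \<le> 1" by (simp flip: of_nat_mult)
    then show ?thesis using that by (metis le_antisym mult_le_mono nat_mult_1 nat_mult_1_right le_trans mult.commute mult_le_mono1)
  qed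
  moreover have "int_comb (\<alpha> i) (\<alpha> j) (1, 1) \<in> real_roots A"
    using adjacent_sum_real_root[OF assms] by (simp add: int_comb_def)
  ultimately show "{ij. 1 \<le> fst ij \<and> 1 \<le> snd ij \<and> int_comb (\<alpha> i) (\<alpha> j) ij \<in> real_roots A} = set [(1, 1)]"
    by (auto simp: int_comb_def)
qed simp_all

lemma commutator_indices_sum:
  assumes "A $ i $ j = - 1"
  shows "commutator_indices A (\<alpha> i) (\<alpha> i + \<alpha> j) = []"
proof (rule commutator_indices_eq)
  have "False" if "1 \<le> a" "1 \<le> b" "int a *s \<alpha> i + int b *s (\<alpha> i + \<alpha> j) \<in> real_roots A" for a b :: nat
  proof -
    have "int a *s \<alpha> i + int b *s (\<alpha> i + \<alpha> j) = int (a + b) *s \<alpha> i + int b *s \<alpha> j"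
      by (simp add: vec_eq_iff algebra_simps)
    then have "root_norm (int (a + b) *s \<alpha> i + int b *s \<alpha> j) = 2"
      using root_norm_real_root[OF that(3)] by (simp only:)
    then have "(int a)\<^sup>2 + int a * int b + (int b)\<^sup>2 = 1"
      unfolding root_norm_pair using assms by (simp add: power2_eq_square algebra_simps)
    moreover have "1 \<le> (int a)\<^sup>2" "1 \<le> (int b)\<^sup>2" "0 \<le> int a * int b" using that by (simp_all add: one_le_power)
    ultimately show False by simp
  qed
  then show "{ij. 1 \<le> fst ij \<and> 1 \<le> snd ij \<and> int_comb (\<alpha> i) (\<alpha> i + \<alpha> j) ij \<in> real_roots A} = set []"
    by (auto simp: int_comb_def)
qed simp_all

lemma prenilpotent_orthogonal:
  assumes "i \<noteq> j" "A $ i $ j = 0"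
  shows "prenilpotent A (\<alpha> i) (\<alpha> j)"
proof -
  have "(s i \<circ> s j) (\<alpha> i) = - \<alpha> i" "(s i \<circ> s j) (\<alpha> j) = - \<alpha> j"
    using assms symmetric[of i j]
    by (simp_all add: simple_reflection_self[OF diag] simple_reflection_minus simple_reflection_simple_root[of A j i] simple_reflection_simple_root[of A i j])
  moreover have "s i \<circ> s j \<in> weyl_group A" by (intro weyl_group_comp simple_reflection_in_weyl_group)
  ultimately show ?thesis
    unfolding prenilpotent_def
    by (intro conjI bexI[of _ "s i \<circ> s j"] bexI[of _ id])
       (auto simp: weyl_group.one simple_root_in_positive_real_roots)
qed

lemma adjacent_sum_positive: "A $ i $ j = - 1 \<Longrightarrow> \<alpha> i + \<alpha> j \<in> positive_real_roots A"
  by (simp add: positive_real_roots_def adjacent_sum_real_root) (simp add: simple_root_def axis_def)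

lemma prenilpotent_adjacent:
  assumes "A $ i $ j = - 1" "\<beta> \<in> {\<alpha> i, \<alpha> j, \<alpha> i + \<alpha> j}" "\<gamma> \<in> {\<alpha> i, \<alpha> j, \<alpha> i + \<alpha> j}"
  shows "prenilpotent A \<beta> \<gamma>"
proof -
  let ?w = "s i \<circ> s j \<circ> s i"
  note adj = simple_reflection_adjacent[OF assms(1)] simple_reflection_adjacent[of A j i]
  have "?w (\<alpha> i) = - \<alpha> j" "?w (\<alpha> j) = - \<alpha> i" "?w (\<alpha> i + \<alpha> j) = - (\<alpha> i + \<alpha> j)"
    using assms(1) symmetric[of i j]
    by (simp_all add: adj simple_reflection_self[OF diag] simple_reflection_minus simple_reflection_add
        simple_reflection_diff)
  then have "- ?w (\<alpha> i) = \<alpha> j" "- ?w (\<alpha> j) = \<alpha> i" "- ?w (\<alpha> i + \<alpha> j) = \<alpha> i + \<alpha> j"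
    by (simp_all only: minus_minus)
  then have negative: "- ?w \<delta> \<in> positive_real_roots A" if "\<delta> \<in> {\<alpha> i, \<alpha> j, \<alpha> i + \<alpha> j}" for \<delta>
    using that simple_root_in_positive_real_roots adjacent_sum_positive[OF assms(1)] by (auto simp del: comp_apply)
  have positive: "id \<delta> \<in> positive_real_roots A" if "\<delta> \<in> {\<alpha> i, \<alpha> j, \<alpha> i + \<alpha> j}" for \<delta>
    using that simple_root_in_positive_real_roots adjacent_sum_positive[OF assms(1)] by auto
  have "?w \<in> weyl_group A" by (intro weyl_group_comp simple_reflection_in_weyl_group)
  then show ?thesis
    unfolding prenilpotent_def using negative positive assms(2,3) weyl_group.one[of A] by blast
qed

end

section \<open>Root subgroups of the Kac-Moody group\<close>

lemma word_class_eqI: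
  assumes "(u, v) \<in> R" "u \<in> words_over X" "v \<in> words_over X"
  shows "word_class X R u = word_class X R v"
  using equiv_class_eq[OF equiv_word_congruence word_congruence.rel[OF assms]]
  by (simp add: word_class_def)

lemma word_class_inverse_word:
  assumes "u \<in> words_over X"
  shows "word_class X R (inverse_word u) = inv\<^bsub>presented_group X R\<^esub> (word_class X R u)"
proof -
  interpret group "presented_group X R" by (rule group_presented_group)
  have "word_class X R (inverse_word u @ u) = word_class X R []"
    using equiv_class_eq[OF equiv_word_congruence inverse_word_left[OF assms]]
    by (simp add: word_class_def)
  then have "word_class X R (inverse_word u) \<otimes>\<^bsub>presented_group X R\<^esub> word_class X R u = \<one>\<^bsub>presented_group X R\<^esub>"
    using presented_group_mult[OF inverse_word_in_words[OF assms] assms]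
    by (simp add: presented_group_def)
  then show ?thesis
    using assms inverse_word_in_words[OF assms] by (intro inv_equality[symmetric]) (auto simp: presented_group_carrier)
qed

lemma (in group) conjugate_commutator:
  assumes "g \<in> carrier G" "a \<in> carrier G" "b \<in> carrier G"
  shows "g \<otimes> (a \<otimes> b \<otimes> inv a \<otimes> inv b) \<otimes> inv g
    = (g \<otimes> a \<otimes> inv g) \<otimes> (g \<otimes> b \<otimes> inv g) \<otimes> inv (g \<otimes> a \<otimes> inv g) \<otimes> inv (g \<otimes> b \<otimes> inv g)"
proof -
  have cancel: "inv g \<otimes> (g \<otimes> y) = y" if "y \<in> carrier G" for y
    using assms that by (simp add: m_assoc[symmetric])
  show ?thesis using assms by (simp add: m_assoc inv_mult_group cancel)
qed

lemma (in group) commutator_eq_imp: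
  assumes "a \<in> carrier G" "b \<in> carrier G" "a \<otimes> b \<otimes> inv a \<otimes> inv b = z"
  shows "a \<otimes> b = z \<otimes> (b \<otimes> a)"
proof -
  have cancel: "inv y \<otimes> (y \<otimes> x) = x" if "y \<in> carrier G" "x \<in> carrier G" for x y
    using that by (simp add: m_assoc[symmetric])
  show ?thesis unfolding assms(3)[symmetric] using assms(1,2) by (simp add: m_assoc cancel)
qed

locale simply_laced_km_group = simply_laced A for A :: "int ^ 'n ^ 'n" +
  fixes e :: "int ^ 'n \<Rightarrow> 'n km_term" and F :: "'f::field itself"
  assumes sys: "chevalley_system A e"
begin

abbreviation "G \<equiv> km_group F A e"
abbreviation "cl \<equiv> word_class (real_roots A \<times> (UNIV :: 'f set)) (km_relations A e)"
abbreviation "wds \<equiv> words_over (real_roots A \<times> (UNIV :: 'f set))"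

definition x_elt :: "int ^ 'n \<Rightarrow> 'f \<Rightarrow> ('n, 'f) km_word set" where
  "x_elt \<beta> r = cl (x_word \<beta> r)"

lemma root_subgroup_eq: "root_subgroup F A e \<beta> = range (x_elt \<beta>)"
  by (auto simp: root_subgroup_def x_elt_def)

interpretation G: group G
  unfolding km_group_def by (rule group_presented_group)

lemma carrier_G: "carrier G = cl ` wds"
  by (simp add: km_group_def presented_group_carrier)

lemma mult_G: "u \<in> wds \<Longrightarrow> v \<in> wds \<Longrightarrow> cl u \<otimes>\<^bsub>G\<^esub> cl v = cl (u @ v)"
  unfolding km_group_def by (rule presented_group_mult)

lemma inv_G: "u \<in> wds \<Longrightarrow> cl (inverse_word u) = inv\<^bsub>G\<^esub> (cl u)"
  unfolding km_group_def by (rule word_class_inverse_word)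

lemma one_G: "\<one>\<^bsub>G\<^esub> = cl []"
  by (simp add: km_group_def presented_group_def)

lemma x_word_in: "\<beta> \<in> real_roots A \<Longrightarrow> x_word \<beta> r \<in> wds"
  by (simp add: x_word_def)

lemma x_elt_carrier: "\<beta> \<in> real_roots A \<Longrightarrow> x_elt \<beta> r \<in> carrier G"
  unfolding x_elt_def carrier_G by (intro imageI x_word_in)

lemma neg_simple_root: "- simple_root i \<in> real_roots A"
  using weyl_group_real_roots[OF simple_reflection_in_weyl_group simple_root_in_real_roots, of A i i]
  by (simp add: simple_reflection_self[OF diag])

lemma w_word_in: "w_word i t \<in> wds"
  by (simp add: w_word_def x_word_def simple_root_in_real_roots neg_simple_root)

lemma x_elt_add:
  assumes "\<beta> \<in> real_roots A"
  shows "x_elt \<beta> r \<otimes>\<^bsub>G\<^esub> x_elt \<beta> t = x_elt \<beta> (r + t)"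
proof -
  have "x_elt \<beta> r \<otimes>\<^bsub>G\<^esub> x_elt \<beta> t = cl (x_word \<beta> r @ x_word \<beta> t)"
    unfolding x_elt_def by (intro mult_G x_word_in assms)
  also have "\<dots> = x_elt \<beta> (r + t)"
    unfolding x_elt_def using assms x_word_in
    by (intro word_class_eqI km_relations.add) (simp_all add: x_word_def)
  finally show ?thesis .
qed

lemma w_conjugation:
  assumes \<beta>: "\<beta> \<in> real_roots A"
  obtains c :: 'f where "c * c = 1" "\<And>r. cl (w_word i 1) \<otimes>\<^bsub>G\<^esub> x_elt \<beta> r \<otimes>\<^bsub>G\<^esub> inv\<^bsub>G\<^esub> cl (w_word i 1) = x_elt (s i \<beta>) (c * r)"
proof
  let ?c = "of_int (reflection_sign A e i \<beta>) :: 'f" and ?w = "w_word i 1 :: ('n, 'f) km_word"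
  show "?c * ?c = 1" by (simp add: reflection_sign_def)
  fix r
  have s: "s i \<beta> \<in> real_roots A" by (rule weyl_group_real_roots[OF simple_reflection_in_weyl_group \<beta>])
  have in1: "?w @ x_word \<beta> r \<in> wds" using w_word_in[of i 1] x_word_in[OF \<beta>, of r] by (simp only: append_in_lists_conv)
  have in2: "inverse_word ?w \<in> wds" by (rule inverse_word_in_words[OF w_word_in])
  have in3: "(?w @ x_word \<beta> r) @ inverse_word ?w \<in> wds"
    using in1 in2 by (simp only: append_in_lists_conv)
  have "cl ?w \<otimes>\<^bsub>G\<^esub> x_elt \<beta> r \<otimes>\<^bsub>G\<^esub> inv\<^bsub>G\<^esub> cl ?w = cl ((?w @ x_word \<beta> r) @ inverse_word ?w)"
    unfolding x_elt_def inv_G[OF w_word_in, symmetric] mult_G[OF w_word_in x_word_in[OF \<beta>]] mult_G[OF in1 in2] ..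
  also have "\<dots> = x_elt (s i \<beta>) (?c * r)"
    unfolding x_elt_def using km_relations.w_conj[OF \<beta>, of i r e] in3 x_word_in[OF s]
    by (intro word_class_eqI) simp_all
  finally show "cl ?w \<otimes>\<^bsub>G\<^esub> x_elt \<beta> r \<otimes>\<^bsub>G\<^esub> inv\<^bsub>G\<^esub> cl ?w = x_elt (s i \<beta>) (?c * r)" .
qed

text \<open>Every Weyl group element lifts to a group element that permutes the root subgroups accordingly. The
  signs \<open>c\<close> depend on the root, but only \<open>c\<^sup>2 = 1\<close> matters, as it makes \<open>r \<mapsto> c r\<close> bijective.\<close>

lemma weyl_conjugation:
  assumes "w \<in> weyl_group A"
  shows "\<exists>g \<in> carrier G. \<forall>\<beta> \<in> real_roots A. \<exists>c. c * c = 1 \<and>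
    (\<forall>r. g \<otimes>\<^bsub>G\<^esub> x_elt \<beta> r \<otimes>\<^bsub>G\<^esub> inv\<^bsub>G\<^esub> g = x_elt (w \<beta>) (c * r))"
  using assms
proof (induction rule: weyl_group.induct)
  case one
  show ?case
    by (rule bexI[of _ "\<one>\<^bsub>G\<^esub>"]) (auto intro!: exI[of _ 1] simp: x_elt_carrier)
next
  case (step w i)
  then obtain g where g: "g \<in> carrier G" and conj: "\<forall>\<beta> \<in> real_roots A. \<exists>c. c * c = 1 \<and>
    (\<forall>r. g \<otimes>\<^bsub>G\<^esub> x_elt \<beta> r \<otimes>\<^bsub>G\<^esub> inv\<^bsub>G\<^esub> g = x_elt (w \<beta>) (c * r))" by blast
  let ?n = "cl (w_word i 1)"
  have n: "?n \<in> carrier G" unfolding carrier_G by (intro imageI w_word_in)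
  show ?case
  proof (rule bexI[of _ "?n \<otimes>\<^bsub>G\<^esub> g"], rule ballI)
    fix \<beta> assume \<beta>: "\<beta> \<in> real_roots A"
    have w\<beta>: "w \<beta> \<in> real_roots A" by (rule weyl_group_real_roots[OF step.hyps \<beta>])
    obtain c where c: "c * c = 1" "\<And>r. g \<otimes>\<^bsub>G\<^esub> x_elt \<beta> r \<otimes>\<^bsub>G\<^esub> inv\<^bsub>G\<^esub> g = x_elt (w \<beta>) (c * r)"
      using conj \<beta> by blast
    obtain c' :: 'f where c': "c' * c' = 1" "\<And>r. ?n \<otimes>\<^bsub>G\<^esub> x_elt (w \<beta>) r \<otimes>\<^bsub>G\<^esub> inv\<^bsub>G\<^esub> ?n = x_elt (s i (w \<beta>)) (c' * r)"
      using w_conjugation[OF w\<beta>, of i] by blast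
    have "?n \<otimes>\<^bsub>G\<^esub> g \<otimes>\<^bsub>G\<^esub> x_elt \<beta> r \<otimes>\<^bsub>G\<^esub> inv\<^bsub>G\<^esub> (?n \<otimes>\<^bsub>G\<^esub> g)
        = ?n \<otimes>\<^bsub>G\<^esub> (g \<otimes>\<^bsub>G\<^esub> x_elt \<beta> r \<otimes>\<^bsub>G\<^esub> inv\<^bsub>G\<^esub> g) \<otimes>\<^bsub>G\<^esub> inv\<^bsub>G\<^esub> ?n" for r
      using n g x_elt_carrier[OF \<beta>] by (simp add: G.m_assoc G.inv_mult_group)
    then have "?n \<otimes>\<^bsub>G\<^esub> g \<otimes>\<^bsub>G\<^esub> x_elt \<beta> r \<otimes>\<^bsub>G\<^esub> inv\<^bsub>G\<^esub> (?n \<otimes>\<^bsub>G\<^esub> g) = x_elt ((s i \<circ> w) \<beta>) (c' * c * r)" for r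
      by (simp add: c c' mult.assoc)
    moreover have "c' * c * (c' * c) = 1"
      using c(1) c'(1) by (metis mult.assoc mult.commute mult.left_neutral)
    ultimately show "\<exists>c. c * c = 1 \<and> (\<forall>r. ?n \<otimes>\<^bsub>G\<^esub> g \<otimes>\<^bsub>G\<^esub> x_elt \<beta> r \<otimes>\<^bsub>G\<^esub> inv\<^bsub>G\<^esub> (?n \<otimes>\<^bsub>G\<^esub> g)
        = x_elt ((s i \<circ> w) \<beta>) (c * r))"
      by (intro exI[of _ "c' * c"]) blast
  qed (use n g in simp)
qed

lemma x_elt_commutator:
  assumes \<beta>: "\<beta> \<in> real_roots A" and \<gamma>: "\<gamma> \<in> real_roots A"
    and pre: "prenilpotent A \<beta> \<gamma>" "\<beta> \<noteq> \<gamma>" "\<beta> \<noteq> - \<gamma>"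
    and words: "concat (map (\<lambda>ij. x_word (int_comb \<beta> \<gamma> ij)
         (of_int (structure_constants A e \<beta> \<gamma> ij) * r ^ fst ij * t ^ snd ij))
       (commutator_indices A \<beta> \<gamma>)) = u" "u \<in> wds"
  shows "x_elt \<beta> r \<otimes>\<^bsub>G\<^esub> x_elt \<gamma> t \<otimes>\<^bsub>G\<^esub> inv\<^bsub>G\<^esub> x_elt \<beta> r \<otimes>\<^bsub>G\<^esub> inv\<^bsub>G\<^esub> x_elt \<gamma> t = cl u"
proof -
  let ?x = "x_word \<beta> r" and ?y = "x_word \<gamma> t"
  have 1: "?x @ ?y \<in> wds" using \<beta> \<gamma> by (simp add: x_word_def)
  have 2: "(?x @ ?y) @ inverse_word ?x \<in> wds" using \<beta> \<gamma> by (simp add: x_word_def inverse_word_def)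
  have 3: "((?x @ ?y) @ inverse_word ?x) @ inverse_word ?y \<in> wds" using \<beta> \<gamma> by (simp add: x_word_def inverse_word_def)
  note x = x_word_in[OF \<beta>, of r] and y = x_word_in[OF \<gamma>, of t]
  have "x_elt \<beta> r \<otimes>\<^bsub>G\<^esub> x_elt \<gamma> t \<otimes>\<^bsub>G\<^esub> inv\<^bsub>G\<^esub> x_elt \<beta> r \<otimes>\<^bsub>G\<^esub> inv\<^bsub>G\<^esub> x_elt \<gamma> t
      = cl (((?x @ ?y) @ inverse_word ?x) @ inverse_word ?y)"
    unfolding x_elt_def inv_G[OF x, symmetric] inv_G[OF y, symmetric] mult_G[OF x y]
      mult_G[OF 1 inverse_word_in_words[OF x]] mult_G[OF 2 inverse_word_in_words[OF y]] ..
  also have "\<dots> = cl u"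
    using km_relations.commutator[OF \<beta> \<gamma> pre, of r t e] 3 words
    by (intro word_class_eqI) simp_all
  finally show ?thesis .
qed

lemma simple_roots_distinct:
  assumes "i \<noteq> j"
  shows "\<alpha> i \<noteq> \<alpha> j" "\<alpha> i \<noteq> - \<alpha> j" "\<alpha> i \<noteq> \<alpha> i + \<alpha> j" "\<alpha> i \<noteq> - (\<alpha> i + \<alpha> j)"
  using assms by (auto simp: simple_root_def axis_def vec_eq_iff split: if_splits intro!: exI[of _ i])

lemma orthogonal_commute:
  assumes "i \<noteq> j" "A $ i $ j = 0"
  shows "x_elt (\<alpha> i) r \<otimes>\<^bsub>G\<^esub> x_elt (\<alpha> j) t = x_elt (\<alpha> j) t \<otimes>\<^bsub>G\<^esub> x_elt (\<alpha> i) r"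
proof -
  note c = x_elt_carrier[OF simple_root_in_real_roots]
  have "x_elt (\<alpha> i) r \<otimes>\<^bsub>G\<^esub> x_elt (\<alpha> j) t \<otimes>\<^bsub>G\<^esub> inv\<^bsub>G\<^esub> x_elt (\<alpha> i) r \<otimes>\<^bsub>G\<^esub> inv\<^bsub>G\<^esub> x_elt (\<alpha> j) t = cl []"
    by (rule x_elt_commutator)
       (use assms in \<open>simp_all add: simple_root_in_real_roots prenilpotent_orthogonal simple_roots_distinct
         commutator_indices_orthogonal\<close>)
  then have "x_elt (\<alpha> i) r \<otimes>\<^bsub>G\<^esub> x_elt (\<alpha> j) t = \<one>\<^bsub>G\<^esub> \<otimes>\<^bsub>G\<^esub> (x_elt (\<alpha> j) t \<otimes>\<^bsub>G\<^esub> x_elt (\<alpha> i) r)"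
    unfolding one_G by (rule G.commutator_eq_imp[OF c c])
  then show ?thesis using c by simp
qed

lemma adjacent_central:
  assumes "i \<noteq> j" "A $ i $ j = - 1"
  shows "x_elt (\<alpha> i) r \<otimes>\<^bsub>G\<^esub> x_elt (\<alpha> i + \<alpha> j) t = x_elt (\<alpha> i + \<alpha> j) t \<otimes>\<^bsub>G\<^esub> x_elt (\<alpha> i) r"
proof -
  note c = x_elt_carrier[OF simple_root_in_real_roots] and c' = x_elt_carrier[OF adjacent_sum_real_root[OF assms(2)]]
  have "x_elt (\<alpha> i) r \<otimes>\<^bsub>G\<^esub> x_elt (\<alpha> i + \<alpha> j) t \<otimes>\<^bsub>G\<^esub> inv\<^bsub>G\<^esub> x_elt (\<alpha> i) r \<otimes>\<^bsub>G\<^esub> inv\<^bsub>G\<^esub> x_elt (\<alpha> i + \<alpha> j) t = cl []"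
  proof (rule x_elt_commutator)
    show "prenilpotent A (\<alpha> i) (\<alpha> i + \<alpha> j)" by (rule prenilpotent_adjacent[OF assms(2)]) simp_all
    show "\<alpha> i \<noteq> \<alpha> i + \<alpha> j" "\<alpha> i \<noteq> - (\<alpha> i + \<alpha> j)" by (rule simple_roots_distinct[OF assms(1)])+
  qed (use assms in \<open>simp_all add: simple_root_in_real_roots adjacent_sum_real_root commutator_indices_sum\<close>)
  then have "x_elt (\<alpha> i) r \<otimes>\<^bsub>G\<^esub> x_elt (\<alpha> i + \<alpha> j) t = \<one>\<^bsub>G\<^esub> \<otimes>\<^bsub>G\<^esub> (x_elt (\<alpha> i + \<alpha> j) t \<otimes>\<^bsub>G\<^esub> x_elt (\<alpha> i) r)"
    unfolding one_G by (rule G.commutator_eq_imp[OF c c'])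
  then show ?thesis using c c' by simp
qed

lemma adjacent_commutator:
  assumes "i \<noteq> j" "A $ i $ j = - 1"
  obtains c :: 'f where "c \<noteq> 0" "\<And>r t. x_elt (\<alpha> i) r \<otimes>\<^bsub>G\<^esub> x_elt (\<alpha> j) t \<otimes>\<^bsub>G\<^esub> inv\<^bsub>G\<^esub> x_elt (\<alpha> i) r \<otimes>\<^bsub>G\<^esub> inv\<^bsub>G\<^esub> x_elt (\<alpha> j) t
      = x_elt (\<alpha> i + \<alpha> j) (c * r * t)"
proof
  let ?C = "structure_constants A e (\<alpha> i) (\<alpha> j) (1, 1)"
  have "?C \<in> {1, - 1}"
    using assms symmetric[of j i]
    by (intro structure_constant_simple_pair[OF sys] simple_reflection_adjacent simple_root_in_real_roots
        adjacent_sum_real_root commutator_indices_adjacent diag) simp_all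
  then show "of_int ?C \<noteq> (0 :: 'f)" by auto
  fix r t :: 'f
  show "x_elt (\<alpha> i) r \<otimes>\<^bsub>G\<^esub> x_elt (\<alpha> j) t \<otimes>\<^bsub>G\<^esub> inv\<^bsub>G\<^esub> x_elt (\<alpha> i) r \<otimes>\<^bsub>G\<^esub> inv\<^bsub>G\<^esub> x_elt (\<alpha> j) t
      = x_elt (\<alpha> i + \<alpha> j) (of_int ?C * r * t)"
    unfolding x_elt_def[of "\<alpha> i + \<alpha> j"]
  proof (rule x_elt_commutator)
    show "prenilpotent A (\<alpha> i) (\<alpha> j)" by (rule prenilpotent_adjacent[OF assms(2)]) simp_all
    show "\<alpha> i \<noteq> \<alpha> j" "\<alpha> i \<noteq> - \<alpha> j" by (rule simple_roots_distinct[OF assms(1)])+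
  qed (use assms in \<open>simp_all add: simple_root_in_real_roots adjacent_sum_real_root commutator_indices_adjacent
        int_comb_def x_word_in\<close>)
qed

definition "simple_generated = generate G (simple_root_elements F A e)"

lemma simple_root_elements_eq: "simple_root_elements F A e = (\<Union>i. range (x_elt (\<alpha> i)))"
  by (simp add: simple_root_elements_def root_subgroup_eq)

lemma simple_root_elements_carrier: "simple_root_elements F A e \<subseteq> carrier G"
  unfolding simple_root_elements_eq using x_elt_carrier[OF simple_root_in_real_roots] by blast

text \<open>Conjugating the commutator formula of two adjacent simple roots by a lift of \<open>w\<close> expresses the
  elements of the root subgroup of \<open>w (\<alpha>\<^sub>i + \<alpha>\<^sub>j)\<close> by those of \<open>w \<alpha>\<^sub>i\<close> and \<open>w \<alpha>\<^sub>j\<close>. In this way only the structure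
  constants of simple pairs enter.\<close>

lemma positive_root_element_in_simple_generated:
  assumes "\<beta> \<in> positive_real_roots A"
  shows "x_elt \<beta> r \<in> simple_generated"
proof -
  have sub: "subgroup simple_generated G"
    unfolding simple_generated_def by (rule G.generate_is_subgroup[OF simple_root_elements_carrier])
  have "\<forall>r. x_elt \<beta> r \<in> simple_generated"
    using assms
  proof (induction rule: positive_real_root_induct)
    case (simple i)
    then show ?case
      unfolding simple_generated_def simple_root_elements_eq by (auto intro: generate.incl)
  next
    case (sum w i j)
    show ?case
    proof
      fix t
      have ij: "i \<noteq> j" using sum(2) diag[of i] by auto
      obtain c :: 'f where c: "c \<noteq> 0" "\<And>r t. x_elt (\<alpha> i) r \<otimes>\<^bsub>G\<^esub> x_elt (\<alpha> j) t \<otimes>\<^bsub>G\<^esub> inv\<^bsub>G\<^esub> x_elt (\<alpha> i) r \<otimes>\<^bsub>G\<^esub> inv\<^bsub>G\<^esub> x_elt (\<alpha> j) t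
        = x_elt (\<alpha> i + \<alpha> j) (c * r * t)"
        using adjacent_commutator[OF ij sum(2)] by blast
      obtain g where g: "g \<in> carrier G" and conj: "\<And>\<beta>. \<beta> \<in> real_roots A \<Longrightarrow> \<exists>c. c * c = 1 \<and>
          (\<forall>r. g \<otimes>\<^bsub>G\<^esub> x_elt \<beta> r \<otimes>\<^bsub>G\<^esub> inv\<^bsub>G\<^esub> g = x_elt (w \<beta>) (c * r))"
        using weyl_conjugation[OF sum(1)] by blast
      obtain a where a: "a * a = 1" "\<And>r. g \<otimes>\<^bsub>G\<^esub> x_elt (\<alpha> i + \<alpha> j) r \<otimes>\<^bsub>G\<^esub> inv\<^bsub>G\<^esub> g = x_elt (w (\<alpha> i + \<alpha> j)) (a * r)"
        using conj[OF adjacent_sum_real_root[OF sum(2)]] by blast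
      note x = x_elt_carrier[OF simple_root_in_real_roots]
      have mem: "g \<otimes>\<^bsub>G\<^esub> x_elt (\<alpha> k) r \<otimes>\<^bsub>G\<^esub> inv\<^bsub>G\<^esub> g \<in> simple_generated" if "k = i \<or> k = j" for k r
        using conj[OF simple_root_in_real_roots[of k]] sum(5,6) that by metis
      \<comment> \<open>Chosen so that the commutator with \<open>x\<^sub>\<alpha>\<^sub>j(1)\<close> is conjugated to parameter \<open>a * a * t = t\<close>.\<close>
      let ?r = "inverse c * a * t"
      have "x_elt (w (\<alpha> i + \<alpha> j)) t = g \<otimes>\<^bsub>G\<^esub> x_elt (\<alpha> i + \<alpha> j) (c * ?r * 1) \<otimes>\<^bsub>G\<^esub> inv\<^bsub>G\<^esub> g"
        unfolding a(2) using c(1) a(1) by (simp add: mult.assoc[symmetric])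
      also have "\<dots> = (g \<otimes>\<^bsub>G\<^esub> x_elt (\<alpha> i) ?r \<otimes>\<^bsub>G\<^esub> inv\<^bsub>G\<^esub> g) \<otimes>\<^bsub>G\<^esub> (g \<otimes>\<^bsub>G\<^esub> x_elt (\<alpha> j) 1 \<otimes>\<^bsub>G\<^esub> inv\<^bsub>G\<^esub> g)
          \<otimes>\<^bsub>G\<^esub> inv\<^bsub>G\<^esub> (g \<otimes>\<^bsub>G\<^esub> x_elt (\<alpha> i) ?r \<otimes>\<^bsub>G\<^esub> inv\<^bsub>G\<^esub> g) \<otimes>\<^bsub>G\<^esub> inv\<^bsub>G\<^esub> (g \<otimes>\<^bsub>G\<^esub> x_elt (\<alpha> j) 1 \<otimes>\<^bsub>G\<^esub> inv\<^bsub>G\<^esub> g)"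
        unfolding c(2)[symmetric] by (rule G.conjugate_commutator[OF g x x])
      also have "\<dots> \<in> simple_generated"
        by (intro subgroup.m_closed[OF sub, OF subgroup.m_closed[OF sub, OF subgroup.m_closed[OF sub]]]
            subgroup.m_inv_closed[OF sub] mem disjI1[OF HOL.refl] disjI2[OF HOL.refl])
      finally show "x_elt (w (\<alpha> i + \<alpha> j)) t \<in> simple_generated" .
    qed
  qed
  then show ?thesis by blast
qed

lemma carrier_km_U: "carrier (km_U F A e) = simple_generated"
proof -
  let ?P = "\<Union>\<beta> \<in> positive_real_roots A. root_subgroup F A e \<beta>"
  have "?P \<subseteq> simple_generated"
    using positive_root_element_in_simple_generated by (auto simp: root_subgroup_eq)
  then have "generate G ?P \<subseteq> simple_generated"
    unfolding simple_generated_def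
    by (rule G.generate_subgroup_incl[OF _ G.generate_is_subgroup[OF simple_root_elements_carrier]])
  moreover have "simple_root_elements F A e \<subseteq> ?P"
    unfolding simple_root_elements_def using simple_root_in_positive_real_roots by blast
  then have "simple_generated \<subseteq> generate G ?P"
    unfolding simple_generated_def by (rule G.mono_generate)
  ultimately show ?thesis by (simp add: km_U_def)
qed

end

section \<open>Unitary representations\<close>

instance complex_hilbert_space \<subseteq> banach ..

lemma closed_csubspaceD:
  assumes "closed_csubspace V"
  shows "subspace V" "closed V"
  using assms unfolding closed_csubspace_def subspace_def by (auto simp: scaleR_scaleC)

lemma isometric_action_of_representation:
  assumes rep: "unitary_representation G V \<pi>"
    and x: "\<And>r. x r \<in> carrier G" "\<And>r t. x r \<otimes>\<^bsub>G\<^esub> x t = x (r + t)"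
  shows "isometric_action_on V (\<lambda>r. \<pi> (x r))"
proof -
  have uni: "unitary_on V (\<pi> (x r))" for r
    using rep x(1) unfolding unitary_representation_def by blast
  have mult: "\<pi> (x (r + t)) v = \<pi> (x r) (\<pi> (x t) v)" if "v \<in> V" for r t v
    using rep x that unfolding unitary_representation_def by metis
  have V: "subspace V" using rep closed_csubspaceD unfolding unitary_representation_def by blast
  have mem: "\<pi> (x r) v \<in> V" if "v \<in> V" for r v using uni[of r] that unfolding unitary_on_def by blast
  have add: "\<pi> (x r) (v + w) = \<pi> (x r) v + \<pi> (x r) w" if "v \<in> V" "w \<in> V" for r v w
    using uni[of r] that unfolding unitary_on_def by blast
  have inner: "inner (\<pi> (x r) v) (\<pi> (x r) w) = inner v w" if "v \<in> V" "w \<in> V" for r v w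
    using uni[of r] that unfolding unitary_on_def inner_cinner by simp
  have scale: "\<pi> (x r) (c *\<^sub>R v) = c *\<^sub>R \<pi> (x r) v" if "v \<in> V" for r c v
    using uni[of r] that unfolding unitary_on_def scaleR_scaleC by blast
  have zero: "\<pi> (x 0) v = v" if v: "v \<in> V" for v
  proof -
    obtain w where w: "w \<in> V" "v = \<pi> (x 0) w" using uni[of 0] v unfolding unitary_on_def by blast
    then show ?thesis using mult[OF w(1), of 0 0] by simp
  qed
  show ?thesis
    unfolding isometric_action_on_def using mem add inner scale zero mult by simp
qed

locale finite_simply_laced_km_group = simply_laced_km_group A e F
  for A :: "int ^ 'n ^ 'n" and e and F :: "'f::{field,finite} itself"
begin

abbreviation "U \<equiv> km_U F A e"

lemma x_elt_carrier_U: "\<beta> \<in> positive_real_roots A \<Longrightarrow> x_elt \<beta> r \<in> carrier U"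
  unfolding carrier_km_U by (rule positive_root_element_in_simple_generated)

lemma mult_U: "g \<otimes>\<^bsub>U\<^esub> h = g \<otimes>\<^bsub>G\<^esub> h"
  by (simp add: km_U_def)

lemma positive_imp_real: "\<beta> \<in> positive_real_roots A \<Longrightarrow> \<beta> \<in> real_roots A"
  by (simp add: positive_real_roots_def)

text \<open>Two simple root subgroups either commute or generate a quotient of the Heisenberg group, in
  which the root subgroup of the sum is central.\<close>

lemma simple_root_pair_bound:
  fixes V :: "'v::complex_hilbert_space set"
  assumes rep: "unitary_representation U V \<pi>" and ij: "i \<noteq> j" and v: "v \<in> V"
  defines "T \<equiv> \<lambda>\<beta> r. \<pi> (x_elt \<beta> r)"
  shows "- (1 / sqrt (real CARD('f))) * ((norm (v - average (T (\<alpha> i)) v))\<^sup>2 + (norm (v - average (T (\<alpha> j)) v))\<^sup>2)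
    \<le> 2 * inner (v - average (T (\<alpha> i)) v) (v - average (T (\<alpha> j)) v)"
proof -
  have V: "subspace V" using rep closed_csubspaceD unfolding unitary_representation_def by blast
  have T: "isometric_action_on V (T \<beta>)" if "\<beta> \<in> positive_real_roots A" for \<beta>
    unfolding T_def
    by (rule isometric_action_of_representation[OF rep x_elt_carrier_U[OF that]])
       (simp add: mult_U x_elt_add[OF positive_imp_real[OF that]])
  have mult: "\<pi> (g \<otimes>\<^bsub>G\<^esub> h) x = \<pi> g (\<pi> h x)" if "g \<in> carrier U" "h \<in> carrier U" "x \<in> V" for g h x
    using rep that unfolding unitary_representation_def by (metis mult_U)
  have TT: "T \<beta> r (T \<gamma> t x) = \<pi> (x_elt \<beta> r \<otimes>\<^bsub>G\<^esub> x_elt \<gamma> t) x"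
    if "\<beta> \<in> positive_real_roots A" "\<gamma> \<in> positive_real_roots A" "x \<in> V" for \<beta> \<gamma> r t x
    unfolding T_def using mult[OF x_elt_carrier_U x_elt_carrier_U] that by simp
  note s = simple_root_in_positive_real_roots[of _ A]
  note Ti = T[OF s, of i] and Tj = T[OF s, of j]
  from ij show ?thesis
  proof (cases rule: adjacent_cases)
    case 1
    have "average (T (\<alpha> i)) (average (T (\<alpha> j)) v) = average (T (\<alpha> j)) (average (T (\<alpha> i)) v)"
      by (rule averages_commute[OF V Ti Tj v]) (simp add: TT[OF s s v] orthogonal_commute[OF ij 1(1)])
    then have "0 \<le> inner (v - average (T (\<alpha> i)) v) (v - average (T (\<alpha> j)) v)"
      by (intro commuting_projections_inner_nonneg[OF V _ _ v] orthogonal_projection_on_average[OF V] Ti Tj)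
    moreover have "0 \<le> 1 / sqrt (real CARD('f)) * ((norm (v - average (T (\<alpha> i)) v))\<^sup>2 + (norm (v - average (T (\<alpha> j)) v))\<^sup>2)"
      by simp
    ultimately show ?thesis by linarith
  next
    case 2
    let ?\<gamma> = "\<alpha> i + \<alpha> j"
    have \<gamma>: "?\<gamma> \<in> positive_real_roots A" by (rule adjacent_sum_positive[OF 2(1)])
    note Tz = T[OF \<gamma>]
    obtain c :: 'f where c: "c \<noteq> 0" "\<And>r t. x_elt (\<alpha> i) r \<otimes>\<^bsub>G\<^esub> x_elt (\<alpha> j) t \<otimes>\<^bsub>G\<^esub> inv\<^bsub>G\<^esub> x_elt (\<alpha> i) r \<otimes>\<^bsub>G\<^esub> inv\<^bsub>G\<^esub> x_elt (\<alpha> j) t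
      = x_elt ?\<gamma> (c * r * t)"
      using adjacent_commutator[OF ij 2(1)] by blast
    interpret G: group G unfolding km_group_def by (rule group_presented_group)
    interpret U: subgroup "carrier U" G
      unfolding carrier_km_U simple_generated_def by (rule G.generate_is_subgroup[OF simple_root_elements_carrier])
    note x = x_elt_carrier[OF simple_root_in_real_roots]
    show ?thesis
    proof (rule heisenberg_pair_bound[where Z = "T ?\<gamma>", OF V Ti Tj Tz c(1) _ _ _ v])
      fix r t x assume x': "x \<in> V"
      have "x_elt (\<alpha> i) r \<otimes>\<^bsub>G\<^esub> x_elt (\<alpha> j) t = x_elt ?\<gamma> (c * r * t) \<otimes>\<^bsub>G\<^esub> (x_elt (\<alpha> j) t \<otimes>\<^bsub>G\<^esub> x_elt (\<alpha> i) r)"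
        by (rule G.commutator_eq_imp[OF x x c(2)])
      then show "T (\<alpha> i) r (T (\<alpha> j) t x) = T ?\<gamma> (c * r * t) (T (\<alpha> j) t (T (\<alpha> i) r x))"
        unfolding TT[OF s s x'] by (simp add: T_def mult[OF x_elt_carrier_U[OF \<gamma>] U.m_closed[OF x_elt_carrier_U[OF s] x_elt_carrier_U[OF s]] x'])
      show "T (\<alpha> i) r (T ?\<gamma> t x) = T ?\<gamma> t (T (\<alpha> i) r x)"
        unfolding TT[OF s \<gamma> x'] TT[OF \<gamma> s x'] by (simp add: adjacent_central[OF ij 2(1)])
      show "T (\<alpha> j) r (T ?\<gamma> t x) = T ?\<gamma> t (T (\<alpha> j) r x)"
        unfolding TT[OF s \<gamma> x'] TT[OF \<gamma> s x']
        using adjacent_central[of j i r t] ij 2(2) by (simp add: add.commute)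
    qed
  qed
qed

lemma fixed_by_simple_root_elements:
  fixes V :: "'v::complex_hilbert_space set"
  assumes rep: "unitary_representation U V \<pi>" and v: "v \<in> V"
    and fixed: "\<And>i r. \<pi> (x_elt (\<alpha> i) r) v = v" and g: "g \<in> carrier U"
  shows "\<pi> g v = v"
proof -
  interpret G: group G unfolding km_group_def by (rule group_presented_group)
  interpret U: subgroup "carrier U" G
    unfolding carrier_km_U simple_generated_def by (rule G.generate_is_subgroup[OF simple_root_elements_carrier])
  have mult: "\<pi> (a \<otimes>\<^bsub>G\<^esub> b) x = \<pi> a (\<pi> b x)" if "a \<in> carrier U" "b \<in> carrier U" "x \<in> V" for a b x
    using rep that unfolding unitary_representation_def by (metis mult_U)
  have one: "\<pi> \<one>\<^bsub>G\<^esub> v = v"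
  proof -
    \<comment> \<open>Any simple root serves to write the identity as a simple root element.\<close>
    have "x_elt (\<alpha> undefined) 0 \<otimes>\<^bsub>G\<^esub> x_elt (\<alpha> undefined) 0 = x_elt (\<alpha> undefined) 0"
      by (simp add: x_elt_add[OF simple_root_in_real_roots])
    then have "x_elt (\<alpha> undefined) 0 = \<one>\<^bsub>G\<^esub>"
      using G.l_cancel_one[OF x_elt_carrier x_elt_carrier] simple_root_in_real_roots by metis
    then show ?thesis using fixed by metis
  qed
  have "g \<in> generate G (simple_root_elements F A e)"
    using g by (simp only: carrier_km_U simple_generated_def)
  then show ?thesis
  proof (induction rule: generate.induct)
    case one
    show ?case by (rule \<open>\<pi> \<one>\<^bsub>G\<^esub> v = v\<close>)
  next
    case (incl h)
    then show ?case using fixed by (auto simp: simple_root_elements_eq)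
  next
    case (inv h)
    then have "\<pi> h v = v" "h \<in> carrier U"
      using fixed x_elt_carrier_U[OF simple_root_in_positive_real_roots] by (auto simp: simple_root_elements_eq)
    then show ?case
      using mult[OF U.m_inv_closed _ v, of h h] \<open>\<pi> \<one>\<^bsub>G\<^esub> v = v\<close> U.subset by (auto simp: G.l_inv subset_iff)
  next
    case (eng a b)
    then have "a \<in> carrier U" "b \<in> carrier U" by (simp_all add: carrier_km_U simple_generated_def)
    then show ?case using mult[OF _ _ v] eng by simp
  qed
qed

lemma kazhdan_constant_ge:
  assumes q: "(real CARD('n) - 1)\<^sup>2 < real CARD('f)"
  shows "ereal (sqrt (2 / real CARD('n) * (1 - (real CARD('n) - 1) / sqrt (real CARD('f)))))
    \<le> kazhdan_constant TYPE('v::complex_hilbert_space) U (simple_root_elements F A e)"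
  unfolding kazhdan_constant_def
proof (rule Inf_greatest, clarify)
  fix V :: "'v set" and \<pi>
  assume rep: "unitary_representation U V \<pi>" and noinv: "no_invariant_vectors U V \<pi>"
  have V: "subspace V" "closed V" using rep closed_csubspaceD unfolding unitary_representation_def by blast+
  let ?\<epsilon> = "1 / sqrt (real CARD('f))"
  have "real CARD('n) - 1 < sqrt (real CARD('f))" using q by (rule real_less_rsqrt)
  then have \<epsilon>: "(real CARD('n) - 1) * ?\<epsilon> < 1" by (simp add: field_simps)
  show "ereal (sqrt (2 / real CARD('n) * (1 - (real CARD('n) - 1) / sqrt (real CARD('f)))))
    \<le> kazhdan_constant_of_rep (simple_root_elements F A e) V \<pi>"
    unfolding kazhdan_constant_of_rep_def
  proof (rule Inf_greatest, clarify)
    fix \<delta> v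
    assume \<delta>: "0 < \<delta>" and v: "v \<in> V" "v \<noteq> 0"
      and small: "\<forall>g\<in>simple_root_elements F A e. norm (\<pi> g v - v) \<le> \<delta> * norm v"
    have "sqrt (2 / real CARD('n) * (1 - (real CARD('n) - 1) * ?\<epsilon>)) \<le> \<delta>"
    proof (rule sum_of_displacements_bound[where T = "\<lambda>i r. \<pi> (x_elt (\<alpha> i) r)", OF V _ _ _ \<epsilon> _ v \<delta>])
      show "isometric_action_on V (\<lambda>r. \<pi> (x_elt (\<alpha> i) r))" for i
        by (rule isometric_action_of_representation[OF rep x_elt_carrier_U[OF simple_root_in_positive_real_roots]])
           (simp add: mult_U x_elt_add[OF simple_root_in_real_roots])
      show "- ?\<epsilon> * ((norm (w - average (\<lambda>r. \<pi> (x_elt (\<alpha> i) r)) w))\<^sup>2 + (norm (w - average (\<lambda>r. \<pi> (x_elt (\<alpha> j) r)) w))\<^sup>2)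
          \<le> 2 * inner (w - average (\<lambda>r. \<pi> (x_elt (\<alpha> i) r)) w) (w - average (\<lambda>r. \<pi> (x_elt (\<alpha> j) r)) w)"
        if "i \<noteq> j" "w \<in> V" for i j w
        by (rule simple_root_pair_bound[OF rep that])
      show "w = 0" if "w \<in> V" "\<And>i r. \<pi> (x_elt (\<alpha> i) r) w = w" for w
        using noinv fixed_by_simple_root_elements[OF rep that] that(1) unfolding no_invariant_vectors_def by blast
      show "norm (\<pi> (x_elt (\<alpha> i) r) v - v) \<le> \<delta> * norm v" for i r
        using small by (auto simp: simple_root_elements_eq)
    qed simp
    then show "ereal (sqrt (2 / real CARD('n) * (1 - (real CARD('n) - 1) / sqrt (real CARD('f))))) \<le> ereal \<delta>"
      by simp
  qed
qed

lemma property_T_U: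
  assumes q: "(real CARD('n) - 1)\<^sup>2 < real CARD('f)"
  shows "property_T TYPE('v::complex_hilbert_space) U"
  unfolding property_T_def
proof (intro exI[of _ "simple_root_elements F A e"] conjI)
  show "finite (simple_root_elements F A e)" by (simp add: simple_root_elements_eq)
  show "simple_root_elements F A e \<subseteq> carrier U"
    using x_elt_carrier_U[OF simple_root_in_positive_real_roots] by (auto simp: simple_root_elements_eq)
  have "real CARD('n) - 1 < sqrt (real CARD('f))" using q by (rule real_less_rsqrt)
  then have "(real CARD('n) - 1) / sqrt (real CARD('f)) < 1" by (simp add: divide_less_eq)
  then have "0 < 2 / real CARD('n) * (1 - (real CARD('n) - 1) / sqrt (real CARD('f)))"
    by (intro mult_pos_pos) simp_all
  then have "0 < sqrt (2 / real CARD('n) * (1 - (real CARD('n) - 1) / sqrt (real CARD('f))))"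
    by (rule real_sqrt_gt_zero)
  then show "0 < kazhdan_constant TYPE('v) U (simple_root_elements F A e)"
    using kazhdan_constant_ge[OF q, where 'v = 'v] by (metis ereal_less(2) order_less_le_trans)
qed

end

theorem corollary7p3:
  fixes A :: "int ^ 'n ^ 'n"
    and e :: "int ^ 'n \<Rightarrow> 'n km_term"
  assumes "generalized_cartan_matrix A"
    and "\<forall>i j. i \<noteq> j \<longrightarrow> A $ i $ j = 0 \<or> A $ i $ j = - 1"
    and "chevalley_system A e"
    and "real CARD('f::{field, finite}) > (real CARD('n) - 1)\<^sup>2"
  shows "property_T TYPE('v::complex_hilbert_space) (km_U TYPE('f) A e) \<and>
    kazhdan_constant TYPE('v) (km_U TYPE('f) A e) (simple_root_elements TYPE('f) A e)
      \<ge> ereal (sqrt (2 / real CARD('n) * (1 - (real CARD('n) - 1) / sqrt (real CARD('f)))))"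
proof -
  interpret finite_simply_laced_km_group A e "TYPE('f)"
    by unfold_locales (use assms(1-3) in auto)
  show ?thesis using property_T_U[OF assms(4)] kazhdan_constant_ge[OF assms(4)] by simp
qed

end
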